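(* Let $R$ be a partition ring and let $r(t)=\sum_{m\ge0}r_mt^m\in R[[\Sigma]]$ be an exponential element. Then $$r(-t)^{-1}=\sum_{m\ge0}(s_m*r_m)\,t^m,$$ where $r(-t)=\sum_{m\ge0}(-1)^mr_mt^m$, the inverse is taken in the commutative ring $R[[\Sigma]]$, and $s_m\in R(m)$ is the sign element in degree $m$.
   Context: Partitions. A partition $\Lambda=(X,\sim_\Lambda)$ is a finite set $X$ with an equivalence relation; its classes are called blocks. A morphism $f\colon\Lambda\to\Omega=(Y,\sim_\Omega)$ is a bijection $f\colon X\to Y$ with $x\sim_\Lambda x'\Rightarrow f(x)\sim_\Omega f(x')$. There is a (unique) 2-isomorphism $f\Rightarrow g$ between morphisms $f,g\colon\Lambda\to\Omega$ exactly when $f(x)\sim_\Omega g(x)$ for all $x$. This defines a $(2,1)$-category $\mathcal P$; functors from $\mathcal P$ to an ordinary category identify 2-isomorphic morphisms. Write $\Lambda\le\Omega$ if $X=Y$ and the identity is a morphism $\Lambda\to\Omega$. $\Lambda\cap\Gamma$ is the coarsest common refinement; $\Lambda\sqcup\Omega$ the disjoint union. $\underline m$ is $[m]=\{1,\dots,m\}$ with the indiscrete relation ($\underline 0$ empty). $\underline i\sqcup\underline j\le\underline{i+j}$ denotes the morphism sending $\underline i$ to the first $i$ and $\underline j$ to the last $j$ elements. $\Sigma_\Lambda$ is the group of bijections of $X$ preserving every block; $\Sigma_m=\Sigma_{\underline m}$. $\sigma\Lambda$ denotes the partition transported along a bijection $\sigma$. Partition rings. A partition functor $M$ consists of abelian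 groups $M(\Lambda)$, a contravariant functor $M^*$ (restrictions) and a covariant functor $M_*$ (transfers) from $\mathcal P$ to abelian groups with common values $M(\Lambda)$, with $M_*(f)=M^*(f^{-1})$ for isomorphisms $f$, and for $\Gamma,\Lambda\le\Omega$ $$M^*(\Gamma\le\Omega)M_*(\Lambda\le\Omega)=\sum_{[\sigma]\in\Sigma_\Gamma\backslash\Sigma_\Omega/\Sigma_\Lambda}M_*(\Gamma\cap\sigma\Lambda\le\Gamma)\,M_*(\sigma)\,M^*(\sigma^{-1}\Gamma\cap\Lambda\le\Lambda).$$ It is lax symmetric monoidal if equipped with a unit $\mathbb Z\to M(0)$ and external products $M(\Lambda)\otimes M(\Omega)\to M(\Lambda\sqcup\Omega)$, $x\otimes y\mapsto x\boxtimes y$, natural in pairs of restrictions and pairs of transfers, associative, unital, symmetric. A partition ring $R$ is a lax symmetric monoidal partition functor with each $R(\Lambda)$ a commutative ring (product $*$), restrictions and external products ring maps, and $R_*(f)(R^*(f)(a)*b)=a*R_*(f)(b)$. Write $R(m)=R(\underline m)$. $R[[\Sigma]]=\prod_mR(m)$ is a commutative ring under the transfer product $xy=R_*(\underline i\sqcup\underline j\le\underline{i+j})(x\boxtimes y)$ for $x\in R(i)$, $y\in R(j)$; elements are written $\sum_mr_mt^m$ with $r_m\in R(m)$, and such an element is exponential if $r_0=1$ and $R^*(\underline i\sqcup\underline j\le\underline{i+j})(r_{i+j})=r_i\boxtimes r_j$ for all $i,j\ge0$. Sign elements. The complex representation rings $\Lambda\mapsto RU(\Sigma_\Lambda)$,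 with restriction and induction along the injections $\Sigma_\Lambda\to\Sigma_\Omega$, $\sigma\mapsto f\sigma f^{-1}$, and external tensor product of representations, form a partition ring, which is the initial partition ring. For a partition ring $R$, the sign element $s_m\in R(m)$ is the image of the class $[\mathrm{sgn}_m]\in RU(\Sigma_m)$ of the one-dimensional sign representation under the unique map of partition rings $RU(\Sigma_{(-)})\to R$. *)

theory Defs
  imports
    "Jordan_Normal_Form.Matrix"
    "HOL-Algebra.Elementary_Groups"
    "HOL-Combinatorics.Permutations"
    "HOL-Library.Nat_Bijection"
begin

section \<open>Partitions\<close>

text \<open>
  The points of a partition are natural numbers. Every finite set is in bijection with a finite set
  of naturals, so this is the category of partitions up to equivalence; the disjoint union is formed
  through the bijection \<^const>\<open>sum_encode\<close> between \<^typ>\<open>nat + nat\<close> and \<^typ>\<open>nat\<close>.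
\<close>

record partition =
  points :: "nat set"
  sim :: "(nat \<times> nat) set"

definition is_partition :: "partition \<Rightarrow> bool" where
  "is_partition \<Lambda> \<longleftrightarrow> finite (points \<Lambda>) \<and> equiv (points \<Lambda>) (sim \<Lambda>)"

definition morphism :: "partition \<Rightarrow> partition \<Rightarrow> (nat \<Rightarrow> nat) \<Rightarrow> bool" where
  "morphism \<Lambda> \<Omega> f \<longleftrightarrow> is_partition \<Lambda> \<and> is_partition \<Omega> \<and> bij_betw f (points \<Lambda>) (points \<Omega>) \<and>
     (\<forall>x y. (x, y) \<in> sim \<Lambda> \<longrightarrow> (f x, f y) \<in> sim \<Omega>)"

definition isomorphism :: "partition \<Rightarrow> partition \<Rightarrow> (nat \<Rightarrow> nat) \<Rightarrow> bool" where
  "isomorphism \<Lambda> \<Omega> f \<longleftrightarrow> morphism \<Lambda> \<Omega> f \<and> morphism \<Omega> \<Lambda> (inv_into (points \<Lambda>) f)"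

text \<open>
  Functions that agree on the points of \<open>\<Lambda>\<close> are 2-isomorphic by reflexivity, so invariance under
  2-isomorphism also makes the values of a function off \<open>\<Lambda>\<close> irrelevant.
\<close>

definition two_isomorphic :: "partition \<Rightarrow> partition \<Rightarrow> (nat \<Rightarrow> nat) \<Rightarrow> (nat \<Rightarrow> nat) \<Rightarrow> bool" where
  "two_isomorphic \<Lambda> \<Omega> f g \<longleftrightarrow> (\<forall>x\<in>points \<Lambda>. (f x, g x) \<in> sim \<Omega>)"

definition refines :: "partition \<Rightarrow> partition \<Rightarrow> bool" where
  "refines \<Lambda> \<Omega> \<longleftrightarrow> points \<Lambda> = points \<Omega> \<and> morphism \<Lambda> \<Omega> id"

definition meet :: "partition \<Rightarrow> partition \<Rightarrow> partition" where
  "meet \<Lambda> \<Gamma> = \<lparr>points = points \<Lambda> \<inter> points \<Gamma>, sim = sim \<Lambda> \<inter> sim \<Gamma>\<rparr>"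

definition transport :: "(nat \<Rightarrow> nat) \<Rightarrow> partition \<Rightarrow> partition" where
  "transport \<sigma> \<Lambda> = \<lparr>points = \<sigma> ` points \<Lambda>, sim = map_prod \<sigma> \<sigma> ` sim \<Lambda>\<rparr>"

definition indiscrete :: "nat \<Rightarrow> partition" where
  "indiscrete m = \<lparr>points = {1..m}, sim = {1..m} \<times> {1..m}\<rparr>"

abbreviation inl :: "nat \<Rightarrow> nat" where "inl x \<equiv> sum_encode (Inl x)"
abbreviation inr :: "nat \<Rightarrow> nat" where "inr x \<equiv> sum_encode (Inr x)"

definition disj_union :: "partition \<Rightarrow> partition \<Rightarrow> partition" where
  "disj_union \<Lambda> \<Omega> = \<lparr>points = inl ` points \<Lambda> \<union> inr ` points \<Omega>,
     sim = map_prod inl inl ` sim \<Lambda> \<union> map_prod inr inr ` sim \<Omega>\<rparr>"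

definition copair :: "(nat \<Rightarrow> nat) \<Rightarrow> (nat \<Rightarrow> nat) \<Rightarrow> nat \<Rightarrow> nat" where
  "copair f g n = case_sum f g (sum_decode n)"

definition union_map :: "(nat \<Rightarrow> nat) \<Rightarrow> (nat \<Rightarrow> nat) \<Rightarrow> nat \<Rightarrow> nat" where
  "union_map f g = copair (\<lambda>x. inl (f x)) (\<lambda>y. inr (g y))"

definition assoc_map :: "nat \<Rightarrow> nat" where
  "assoc_map = copair (copair inl (\<lambda>y. inr (inl y))) (\<lambda>z. inr (inr z))"

definition swap_map :: "nat \<Rightarrow> nat" where
  "swap_map = copair inr inl"

text \<open>
  The two coherence maps \<open>\<emptyset> \<squnion> \<Lambda> \<rightarrow> \<Lambda>\<close> and \<open>\<Lambda> \<squnion> \<emptyset> \<rightarrow> \<Lambda>\<close>; the same underlying function serves for both.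
\<close>

definition unit_coh :: "nat \<Rightarrow> nat" where
  "unit_coh = copair id id"

text \<open>Sends the points of \<open>indiscrete i\<close> to the first \<open>i\<close>, those of \<open>indiscrete j\<close> to the last \<open>j\<close> points of \<open>indiscrete (i + j)\<close>.\<close>

definition concat_map :: "nat \<Rightarrow> nat \<Rightarrow> nat" where
  "concat_map i = copair id (\<lambda>y. i + y)"

definition block_perms :: "partition \<Rightarrow> (nat \<Rightarrow> nat) monoid" where
  "block_perms \<Lambda> = \<lparr>carrier = {\<sigma>. \<sigma> permutes points \<Lambda> \<and> (\<forall>x\<in>points \<Lambda>. (x, \<sigma> x) \<in> sim \<Lambda>)},
     mult = (\<circ>), one = id\<rparr>"

definition double_coset_reps ::
  "(nat \<Rightarrow> nat) set \<Rightarrow> (nat \<Rightarrow> nat) set \<Rightarrow> (nat \<Rightarrow> nat) set \<Rightarrow> (nat \<Rightarrow> nat) set \<Rightarrow> bool" where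
  "double_coset_reps H G K T \<longleftrightarrow> T \<subseteq> G \<and> (\<forall>g\<in>G. \<exists>!\<tau>. \<tau> \<in> T \<and> (\<exists>h\<in>H. \<exists>k\<in>K. g = h \<circ> \<tau> \<circ> k))"


section \<open>Partition functors and partition rings\<close>

text \<open>
  For \<open>f : \<Lambda> \<rightarrow> \<Omega>\<close>, \<open>res M \<Lambda> \<Omega> f\<close> maps \<open>M(\<Omega>)\<close> to \<open>M(\<Lambda>)\<close> and \<open>tr M \<Lambda> \<Omega> f\<close> maps \<open>M(\<Lambda>)\<close> to \<open>M(\<Omega>)\<close>.
  The groups \<open>M(\<Lambda>)\<close> are the additive parts of ring records; the multiplicative part plays
  a role only for partition rings.
\<close>

record 'r partition_functor_data =
  obj :: "partition \<Rightarrow> 'r ring"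
  res :: "partition \<Rightarrow> partition \<Rightarrow> (nat \<Rightarrow> nat) \<Rightarrow> 'r \<Rightarrow> 'r"
  tr :: "partition \<Rightarrow> partition \<Rightarrow> (nat \<Rightarrow> nat) \<Rightarrow> 'r \<Rightarrow> 'r"

record 'r partition_ring_data = "'r partition_functor_data" +
  unit_map :: "int \<Rightarrow> 'r"
  ext :: "partition \<Rightarrow> partition \<Rightarrow> 'r \<Rightarrow> 'r \<Rightarrow> 'r"

text \<open>
  The summand of the double coset formula does not depend on the chosen representative \<open>\<sigma>\<close>
  (by functoriality and invariance under 2-isomorphism), so the formula is required for every
  system of representatives.
\<close>

locale partition_functor =
  fixes M :: "('r, 'x) partition_functor_data_scheme"
  assumes abelian_obj: "is_partition \<Lambda> \<Longrightarrow> abelian_group (obj M \<Lambda>)"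
    and res_hom: "morphism \<Lambda> \<Omega> f \<Longrightarrow>
      res M \<Lambda> \<Omega> f \<in> hom (add_monoid (obj M \<Omega>)) (add_monoid (obj M \<Lambda>))"
    and tr_hom: "morphism \<Lambda> \<Omega> f \<Longrightarrow>
      tr M \<Lambda> \<Omega> f \<in> hom (add_monoid (obj M \<Lambda>)) (add_monoid (obj M \<Omega>))"
    and res_id: "is_partition \<Lambda> \<Longrightarrow> x \<in> carrier (obj M \<Lambda>) \<Longrightarrow> res M \<Lambda> \<Lambda> id x = x"
    and tr_id: "is_partition \<Lambda> \<Longrightarrow> x \<in> carrier (obj M \<Lambda>) \<Longrightarrow> tr M \<Lambda> \<Lambda> id x = x"
    and res_comp: "morphism \<Lambda> \<Omega> f \<Longrightarrow> morphism \<Omega> \<Theta> g \<Longrightarrow> x \<in> carrier (obj M \<Theta>) \<Longrightarrow>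
      res M \<Lambda> \<Theta> (g \<circ> f) x = res M \<Lambda> \<Omega> f (res M \<Omega> \<Theta> g x)"
    and tr_comp: "morphism \<Lambda> \<Omega> f \<Longrightarrow> morphism \<Omega> \<Theta> g \<Longrightarrow> x \<in> carrier (obj M \<Lambda>) \<Longrightarrow>
      tr M \<Lambda> \<Theta> (g \<circ> f) x = tr M \<Omega> \<Theta> g (tr M \<Lambda> \<Omega> f x)"
    and res_two_iso: "morphism \<Lambda> \<Omega> f \<Longrightarrow> morphism \<Lambda> \<Omega> g \<Longrightarrow> two_isomorphic \<Lambda> \<Omega> f g \<Longrightarrow>
      x \<in> carrier (obj M \<Omega>) \<Longrightarrow> res M \<Lambda> \<Omega> f x = res M \<Lambda> \<Omega> g x"
    and tr_two_iso: "morphism \<Lambda> \<Omega> f \<Longrightarrow> morphism \<Lambda> \<Omega> g \<Longrightarrow> two_isomorphic \<Lambda> \<Omega> f g \<Longrightarrow>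
      x \<in> carrier (obj M \<Lambda>) \<Longrightarrow> tr M \<Lambda> \<Omega> f x = tr M \<Lambda> \<Omega> g x"
    and tr_iso: "isomorphism \<Lambda> \<Omega> f \<Longrightarrow> x \<in> carrier (obj M \<Lambda>) \<Longrightarrow>
      tr M \<Lambda> \<Omega> f x = res M \<Omega> \<Lambda> (inv_into (points \<Lambda>) f) x"
    and double_coset: "refines \<Gamma> \<Omega> \<Longrightarrow> refines \<Lambda> \<Omega> \<Longrightarrow>
      double_coset_reps (carrier (block_perms \<Gamma>)) (carrier (block_perms \<Omega>))
        (carrier (block_perms \<Lambda>)) T \<Longrightarrow>
      x \<in> carrier (obj M \<Lambda>) \<Longrightarrow>
      res M \<Gamma> \<Omega> id (tr M \<Lambda> \<Omega> id x) =
        finsum (obj M \<Gamma>) (\<lambda>\<sigma>.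
          tr M (meet \<Gamma> (transport \<sigma> \<Lambda>)) \<Gamma> id
            (tr M (meet (transport (inv_into UNIV \<sigma>) \<Gamma>) \<Lambda>) (meet \<Gamma> (transport \<sigma> \<Lambda>)) \<sigma>
              (res M (meet (transport (inv_into UNIV \<sigma>) \<Gamma>) \<Lambda>) \<Lambda> id x))) T"

locale lax_partition_functor = partition_functor M
  for M :: "('r, 'x) partition_ring_data_scheme" +
  assumes unit_hom: "unit_map M \<in> hom integer_group (add_monoid (obj M (indiscrete 0)))"
    and ext_closed: "is_partition \<Lambda> \<Longrightarrow> is_partition \<Omega> \<Longrightarrow>
      a \<in> carrier (obj M \<Lambda>) \<Longrightarrow> b \<in> carrier (obj M \<Omega>) \<Longrightarrow>
      ext M \<Lambda> \<Omega> a b \<in> carrier (obj M (disj_union \<Lambda> \<Omega>))"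
    and ext_add_left: "is_partition \<Lambda> \<Longrightarrow> is_partition \<Omega> \<Longrightarrow>
      a \<in> carrier (obj M \<Lambda>) \<Longrightarrow> a' \<in> carrier (obj M \<Lambda>) \<Longrightarrow> b \<in> carrier (obj M \<Omega>) \<Longrightarrow>
      ext M \<Lambda> \<Omega> (a \<oplus>\<^bsub>obj M \<Lambda>\<^esub> a') b =
        ext M \<Lambda> \<Omega> a b \<oplus>\<^bsub>obj M (disj_union \<Lambda> \<Omega>)\<^esub> ext M \<Lambda> \<Omega> a' b"
    and ext_add_right: "is_partition \<Lambda> \<Longrightarrow> is_partition \<Omega> \<Longrightarrow>
      a \<in> carrier (obj M \<Lambda>) \<Longrightarrow> b \<in> carrier (obj M \<Omega>) \<Longrightarrow> b' \<in> carrier (obj M \<Omega>) \<Longrightarrow>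
      ext M \<Lambda> \<Omega> a (b \<oplus>\<^bsub>obj M \<Omega>\<^esub> b') =
        ext M \<Lambda> \<Omega> a b \<oplus>\<^bsub>obj M (disj_union \<Lambda> \<Omega>)\<^esub> ext M \<Lambda> \<Omega> a b'"
    and ext_res: "morphism \<Lambda> \<Lambda>' f \<Longrightarrow> morphism \<Omega> \<Omega>' g \<Longrightarrow>
      a \<in> carrier (obj M \<Lambda>') \<Longrightarrow> b \<in> carrier (obj M \<Omega>') \<Longrightarrow>
      ext M \<Lambda> \<Omega> (res M \<Lambda> \<Lambda>' f a) (res M \<Omega> \<Omega>' g b) =
        res M (disj_union \<Lambda> \<Omega>) (disj_union \<Lambda>' \<Omega>') (union_map f g) (ext M \<Lambda>' \<Omega>' a b)"
    and ext_tr: "morphism \<Lambda> \<Lambda>' f \<Longrightarrow> morphism \<Omega> \<Omega>' g \<Longrightarrow>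
      a \<in> carrier (obj M \<Lambda>) \<Longrightarrow> b \<in> carrier (obj M \<Omega>) \<Longrightarrow>
      ext M \<Lambda>' \<Omega>' (tr M \<Lambda> \<Lambda>' f a) (tr M \<Omega> \<Omega>' g b) =
        tr M (disj_union \<Lambda> \<Omega>) (disj_union \<Lambda>' \<Omega>') (union_map f g) (ext M \<Lambda> \<Omega> a b)"
    and ext_assoc: "is_partition \<Lambda> \<Longrightarrow> is_partition \<Omega> \<Longrightarrow> is_partition \<Theta> \<Longrightarrow>
      a \<in> carrier (obj M \<Lambda>) \<Longrightarrow> b \<in> carrier (obj M \<Omega>) \<Longrightarrow> c \<in> carrier (obj M \<Theta>) \<Longrightarrow>
      tr M (disj_union (disj_union \<Lambda> \<Omega>) \<Theta>) (disj_union \<Lambda> (disj_union \<Omega> \<Theta>)) assoc_map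
          (ext M (disj_union \<Lambda> \<Omega>) \<Theta> (ext M \<Lambda> \<Omega> a b) c) =
        ext M \<Lambda> (disj_union \<Omega> \<Theta>) a (ext M \<Omega> \<Theta> b c)"
    and ext_unit_left: "is_partition \<Lambda> \<Longrightarrow> a \<in> carrier (obj M \<Lambda>) \<Longrightarrow>
      tr M (disj_union (indiscrete 0) \<Lambda>) \<Lambda> unit_coh (ext M (indiscrete 0) \<Lambda> (unit_map M 1) a) = a"
    and ext_unit_right: "is_partition \<Lambda> \<Longrightarrow> a \<in> carrier (obj M \<Lambda>) \<Longrightarrow>
      tr M (disj_union \<Lambda> (indiscrete 0)) \<Lambda> unit_coh (ext M \<Lambda> (indiscrete 0) a (unit_map M 1)) = a"
    and ext_sym: "is_partition \<Lambda> \<Longrightarrow> is_partition \<Omega> \<Longrightarrow>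
      a \<in> carrier (obj M \<Lambda>) \<Longrightarrow> b \<in> carrier (obj M \<Omega>) \<Longrightarrow>
      tr M (disj_union \<Lambda> \<Omega>) (disj_union \<Omega> \<Lambda>) swap_map (ext M \<Lambda> \<Omega> a b) = ext M \<Omega> \<Lambda> b a"

text \<open>
  \<open>ext_mult\<close> and \<open>ext_one\<close> say that the additive map \<open>R(\<Lambda>) \<otimes> R(\<Omega>) \<rightarrow> R(\<Lambda> \<squnion> \<Omega>)\<close> is a ring map;
  \<open>projection\<close> is Frobenius reciprocity for the product of \<open>R(\<Lambda>)\<close>.
\<close>

locale partition_ring = lax_partition_functor R
  for R :: "('r, 'x) partition_ring_data_scheme" +
  assumes cring_obj: "is_partition \<Lambda> \<Longrightarrow> cring (obj R \<Lambda>)"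
    and res_ring_hom: "morphism \<Lambda> \<Omega> f \<Longrightarrow> res R \<Lambda> \<Omega> f \<in> ring_hom (obj R \<Omega>) (obj R \<Lambda>)"
    and ext_mult: "is_partition \<Lambda> \<Longrightarrow> is_partition \<Omega> \<Longrightarrow>
      a \<in> carrier (obj R \<Lambda>) \<Longrightarrow> a' \<in> carrier (obj R \<Lambda>) \<Longrightarrow>
      b \<in> carrier (obj R \<Omega>) \<Longrightarrow> b' \<in> carrier (obj R \<Omega>) \<Longrightarrow>
      ext R \<Lambda> \<Omega> (a \<otimes>\<^bsub>obj R \<Lambda>\<^esub> a') (b \<otimes>\<^bsub>obj R \<Omega>\<^esub> b') =
        ext R \<Lambda> \<Omega> a b \<otimes>\<^bsub>obj R (disj_union \<Lambda> \<Omega>)\<^esub> ext R \<Lambda> \<Omega> a' b'"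
    and ext_one: "is_partition \<Lambda> \<Longrightarrow> is_partition \<Omega> \<Longrightarrow>
      ext R \<Lambda> \<Omega> \<one>\<^bsub>obj R \<Lambda>\<^esub> \<one>\<^bsub>obj R \<Omega>\<^esub> = \<one>\<^bsub>obj R (disj_union \<Lambda> \<Omega>)\<^esub>"
    and projection: "morphism \<Lambda> \<Omega> f \<Longrightarrow> a \<in> carrier (obj R \<Omega>) \<Longrightarrow> b \<in> carrier (obj R \<Lambda>) \<Longrightarrow>
      tr R \<Lambda> \<Omega> f (res R \<Lambda> \<Omega> f a \<otimes>\<^bsub>obj R \<Lambda>\<^esub> b) = a \<otimes>\<^bsub>obj R \<Omega>\<^esub> tr R \<Lambda> \<Omega> f b"

definition partition_ring_map ::
  "('r, 'x) partition_ring_data_scheme \<Rightarrow> ('s, 'y) partition_ring_data_scheme \<Rightarrow>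
    (partition \<Rightarrow> 'r \<Rightarrow> 's) \<Rightarrow> bool" where
  "partition_ring_map R S \<phi> \<longleftrightarrow>
     (\<forall>\<Lambda>. is_partition \<Lambda> \<longrightarrow> \<phi> \<Lambda> \<in> ring_hom (obj R \<Lambda>) (obj S \<Lambda>)) \<and>
     (\<forall>\<Lambda> \<Omega> f. morphism \<Lambda> \<Omega> f \<longrightarrow>
        (\<forall>a\<in>carrier (obj R \<Omega>). \<phi> \<Lambda> (res R \<Lambda> \<Omega> f a) = res S \<Lambda> \<Omega> f (\<phi> \<Omega> a)) \<and>
        (\<forall>a\<in>carrier (obj R \<Lambda>). \<phi> \<Omega> (tr R \<Lambda> \<Omega> f a) = tr S \<Lambda> \<Omega> f (\<phi> \<Lambda> a))) \<and>
     (\<forall>n. \<phi> (indiscrete 0) (unit_map R n) = unit_map S n) \<and>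
     (\<forall>\<Lambda> \<Omega>. is_partition \<Lambda> \<longrightarrow> is_partition \<Omega> \<longrightarrow>
        (\<forall>a\<in>carrier (obj R \<Lambda>). \<forall>b\<in>carrier (obj R \<Omega>).
           \<phi> (disj_union \<Lambda> \<Omega>) (ext R \<Lambda> \<Omega> a b) = ext S \<Lambda> \<Omega> (\<phi> \<Lambda> a) (\<phi> \<Omega> b)))"


section \<open>The power series ring with the transfer product\<close>

definition deg :: "('r, 'x) partition_functor_data_scheme \<Rightarrow> nat \<Rightarrow> 'r ring" where
  "deg R m = obj R (indiscrete m)"

definition transfer_prod ::
  "('r, 'x) partition_ring_data_scheme \<Rightarrow> nat \<Rightarrow> nat \<Rightarrow> 'r \<Rightarrow> 'r \<Rightarrow> 'r" where
  "transfer_prod R i j x y =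
     tr R (disj_union (indiscrete i) (indiscrete j)) (indiscrete (i + j)) (concat_map i)
       (ext R (indiscrete i) (indiscrete j) x y)"

definition power_series :: "('r, 'x) partition_ring_data_scheme \<Rightarrow> (nat \<Rightarrow> 'r) ring" where
  "power_series R = \<lparr>
     carrier = {r. \<forall>m. r m \<in> carrier (deg R m)},
     mult = (\<lambda>r s m. finsum (deg R m) (\<lambda>i. transfer_prod R i (m - i) (r i) (s (m - i))) {..m}),
     one = (\<lambda>m. if m = 0 then \<one>\<^bsub>deg R 0\<^esub> else \<zero>\<^bsub>deg R m\<^esub>),
     zero = (\<lambda>m. \<zero>\<^bsub>deg R m\<^esub>),
     add = (\<lambda>r s m. r m \<oplus>\<^bsub>deg R m\<^esub> s m)\<rparr>"

definition exponential :: "('r, 'x) partition_ring_data_scheme \<Rightarrow> (nat \<Rightarrow> 'r) \<Rightarrow> bool" where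
  "exponential R r \<longleftrightarrow> r \<in> carrier (power_series R) \<and> r 0 = \<one>\<^bsub>deg R 0\<^esub> \<and>
     (\<forall>i j. res R (disj_union (indiscrete i) (indiscrete j)) (indiscrete (i + j)) (concat_map i)
               (r (i + j)) =
             ext R (indiscrete i) (indiscrete j) (r i) (r j))"

text \<open>The series \<open>r(-t)\<close>.\<close>

definition neg_arg :: "('r, 'x) partition_ring_data_scheme \<Rightarrow> (nat \<Rightarrow> 'r) \<Rightarrow> (nat \<Rightarrow> 'r)" where
  "neg_arg R r = (\<lambda>m. [((-1) ^ m :: int)] \<cdot>\<^bsub>deg R m\<^esub> r m)"


section \<open>Complex representation rings\<close>

text \<open>
  A representation is a dimension \<open>n\<close> with a homomorphism to the invertible complex
  \<open>n \<times> n\<close> matrices (\<open>n = 0\<close> allowed).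
\<close>

type_synonym 'g rep = "nat \<times> ('g \<Rightarrow> complex mat)"

definition is_rep :: "('g, 'm) monoid_scheme \<Rightarrow> 'g rep \<Rightarrow> bool" where
  "is_rep G V \<longleftrightarrow>
     (\<forall>g\<in>carrier G. snd V g \<in> carrier_mat (fst V) (fst V)) \<and>
     snd V \<one>\<^bsub>G\<^esub> = 1\<^sub>m (fst V) \<and>
     (\<forall>g\<in>carrier G. \<forall>h\<in>carrier G. snd V (g \<otimes>\<^bsub>G\<^esub> h) = snd V g * snd V h)"

definition rep_iso :: "('g, 'm) monoid_scheme \<Rightarrow> 'g rep \<Rightarrow> 'g rep \<Rightarrow> bool" where
  "rep_iso G V W \<longleftrightarrow> fst V = fst W \<and>
     (\<exists>P\<in>carrier_mat (fst V) (fst V). invertible_mat P \<and>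
        (\<forall>g\<in>carrier G. P * snd V g = snd W g * P))"

definition zero_rep :: "'g rep" where
  "zero_rep = (0, \<lambda>_. 1\<^sub>m 0)"

definition trivial_rep :: "'g rep" where
  "trivial_rep = (1, \<lambda>_. 1\<^sub>m 1)"

definition direct_sum :: "'g rep \<Rightarrow> 'g rep \<Rightarrow> 'g rep" where
  "direct_sum V W = (fst V + fst W,
     \<lambda>g. four_block_mat (snd V g) (0\<^sub>m (fst V) (fst W)) (0\<^sub>m (fst W) (fst V)) (snd W g))"

text \<open>The matrix of a tensor product is the Kronecker product.\<close>

definition tensor :: "'g rep \<Rightarrow> 'g rep \<Rightarrow> 'g rep" where
  "tensor V W = (fst V * fst W,
     \<lambda>g. mat (fst V * fst W) (fst V * fst W)
       (\<lambda>(a, b). snd V g $$ (a div fst W, b div fst W) * snd W g $$ (a mod fst W, b mod fst W)))"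

definition pullback :: "('h \<Rightarrow> 'g) \<Rightarrow> 'g rep \<Rightarrow> 'h rep" where
  "pullback \<phi> V = (fst V, \<lambda>h. snd V (\<phi> h))"

definition left_transversal :: "('g, 'm) monoid_scheme \<Rightarrow> 'g set \<Rightarrow> 'g list \<Rightarrow> bool" where
  "left_transversal G H ts \<longleftrightarrow> set ts \<subseteq> carrier G \<and>
     (\<forall>g\<in>carrier G. \<exists>!k. k < length ts \<and> inv\<^bsub>G\<^esub> (ts ! k) \<otimes>\<^bsub>G\<^esub> g \<in> H)"

text \<open>
  The representation induced along an injective homomorphism \<open>\<phi> : H \<rightarrow> G\<close>, in the basis
  \<open>t\<^sub>p \<otimes> e\<^sub>i\<close> (numbered \<open>p * n + i\<close>) of \<open>\<complex>[G] \<otimes> V\<close> over \<open>\<complex>[H]\<close>, for coset representatives \<open>t\<^sub>p\<close>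
  of \<open>G/\<phi>(H)\<close>: if \<open>g t\<^sub>q = t\<^sub>p \<phi>(h)\<close> then \<open>g (t\<^sub>q \<otimes> e\<^sub>j) = t\<^sub>p \<otimes> h e\<^sub>j\<close>. The choice of the representatives
  changes it only up to isomorphism.
\<close>

definition induced ::
  "('h, 'm) monoid_scheme \<Rightarrow> ('g, 'n) monoid_scheme \<Rightarrow> ('h \<Rightarrow> 'g) \<Rightarrow> 'h rep \<Rightarrow> 'g rep" where
  "induced H G \<phi> V =
     (let ts = (SOME ts. left_transversal G (\<phi> ` carrier H) ts); n = fst V; N = length ts * n in
      (N, \<lambda>g. mat N N (\<lambda>(a, b).
         let x = inv\<^bsub>G\<^esub> (ts ! (a div n)) \<otimes>\<^bsub>G\<^esub> g \<otimes>\<^bsub>G\<^esub> ts ! (b div n) in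
         if x \<in> \<phi> ` carrier H
         then snd V (the_inv_into (carrier H) \<phi> x) $$ (a mod n, b mod n) else 0)))"

text \<open>
  The representation ring is the Grothendieck group of the commutative monoid of isomorphism classes
  of representations under direct sum: classes of pairs \<open>(V, W)\<close>, standing for \<open>[V] - [W]\<close>.
\<close>

definition rep_pairs :: "('g, 'm) monoid_scheme \<Rightarrow> ('g rep \<times> 'g rep) set" where
  "rep_pairs G = {(V, W). is_rep G V \<and> is_rep G W}"

definition groth_rel ::
  "('g, 'm) monoid_scheme \<Rightarrow> (('g rep \<times> 'g rep) \<times> ('g rep \<times> 'g rep)) set" where
  "groth_rel G = {((V, W), (V', W')). (V, W) \<in> rep_pairs G \<and> (V', W') \<in> rep_pairs G \<and>
     (\<exists>U. is_rep G U \<and>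
        rep_iso G (direct_sum (direct_sum V W') U) (direct_sum (direct_sum V' W) U))}"

definition virtual :: "('g, 'm) monoid_scheme \<Rightarrow> 'g rep \<Rightarrow> 'g rep \<Rightarrow> ('g rep \<times> 'g rep) set" where
  "virtual G V W = groth_rel G `` {(V, W)}"

definition rep_class :: "('g, 'm) monoid_scheme \<Rightarrow> 'g rep \<Rightarrow> ('g rep \<times> 'g rep) set" where
  "rep_class G V = virtual G V zero_rep"

definition rep_ring :: "('g, 'm) monoid_scheme \<Rightarrow> ('g rep \<times> 'g rep) set ring" where
  "rep_ring G = \<lparr>
     carrier = rep_pairs G // groth_rel G,
     mult = (\<lambda>x y. \<Union>(V, W)\<in>x. \<Union>(V', W')\<in>y.
       virtual G (direct_sum (tensor V V') (tensor W W')) (direct_sum (tensor V W') (tensor W V'))),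
     one = rep_class G trivial_rep,
     zero = rep_class G zero_rep,
     add = (\<lambda>x y. \<Union>(V, W)\<in>x. \<Union>(V', W')\<in>y. virtual G (direct_sum V V') (direct_sum W W'))\<rparr>"

definition rep_ring_pullback ::
  "('h, 'm) monoid_scheme \<Rightarrow> ('h \<Rightarrow> 'g) \<Rightarrow> ('g rep \<times> 'g rep) set \<Rightarrow> ('h rep \<times> 'h rep) set" where
  "rep_ring_pullback H \<phi> x = (\<Union>(V, W)\<in>x. virtual H (pullback \<phi> V) (pullback \<phi> W))"

definition rep_ring_induced ::
  "('h, 'm) monoid_scheme \<Rightarrow> ('g, 'n) monoid_scheme \<Rightarrow> ('h \<Rightarrow> 'g) \<Rightarrow>
    ('h rep \<times> 'h rep) set \<Rightarrow> ('g rep \<times> 'g rep) set" where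
  "rep_ring_induced H G \<phi> x = (\<Union>(V, W)\<in>x. virtual G (induced H G \<phi> V) (induced H G \<phi> W))"


section \<open>The partition ring of representation rings and the sign elements\<close>

text \<open>The injection \<open>\<Sigma>\<^sub>\<Lambda> \<rightarrow> \<Sigma>\<^sub>\<Omega>\<close>, \<open>\<sigma> \<mapsto> f \<sigma> f\<^sup>-\<^sup>1\<close>, induced by a morphism \<open>f : \<Lambda> \<rightarrow> \<Omega>\<close>.\<close>

definition conj_perm :: "partition \<Rightarrow> (nat \<Rightarrow> nat) \<Rightarrow> (nat \<Rightarrow> nat) \<Rightarrow> (nat \<Rightarrow> nat)" where
  "conj_perm \<Lambda> f \<sigma> =
     (\<lambda>y. if y \<in> f ` points \<Lambda> then f (\<sigma> (inv_into (points \<Lambda>) f y)) else y)"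

text \<open>The two projections of \<open>\<Sigma>\<^bsub>\<Lambda> \<squnion> \<Omega>\<^esub> = \<Sigma>\<^sub>\<Lambda> \<times> \<Sigma>\<^sub>\<Omega>\<close>.\<close>

definition left_perm :: "(nat \<Rightarrow> nat) \<Rightarrow> (nat \<Rightarrow> nat)" where
  "left_perm \<sigma> = (\<lambda>x. projl (sum_decode (\<sigma> (inl x))))"

definition right_perm :: "(nat \<Rightarrow> nat) \<Rightarrow> (nat \<Rightarrow> nat)" where
  "right_perm \<sigma> = (\<lambda>y. projr (sum_decode (\<sigma> (inr y))))"

type_synonym virtual_rep = "((nat \<Rightarrow> nat) rep \<times> (nat \<Rightarrow> nat) rep) set"

definition RU :: "virtual_rep partition_ring_data" where
  "RU = \<lparr>
     obj = (\<lambda>\<Lambda>. rep_ring (block_perms \<Lambda>)),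
     res = (\<lambda>\<Lambda> \<Omega> f. rep_ring_pullback (block_perms \<Lambda>) (conj_perm \<Lambda> f)),
     tr = (\<lambda>\<Lambda> \<Omega> f. rep_ring_induced (block_perms \<Lambda>) (block_perms \<Omega>) (conj_perm \<Lambda> f)),
     unit_map = (\<lambda>n. [n] \<cdot>\<^bsub>rep_ring (block_perms (indiscrete 0))\<^esub>
                     \<one>\<^bsub>rep_ring (block_perms (indiscrete 0))\<^esub>),
     ext = (\<lambda>\<Lambda> \<Omega> x y.
       rep_ring_pullback (block_perms (disj_union \<Lambda> \<Omega>)) left_perm x
         \<otimes>\<^bsub>rep_ring (block_perms (disj_union \<Lambda> \<Omega>))\<^esub>
       rep_ring_pullback (block_perms (disj_union \<Lambda> \<Omega>)) right_perm y)\<rparr>"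

definition sign_rep :: "(nat \<Rightarrow> nat) rep" where
  "sign_rep = (1, \<lambda>\<sigma>. of_int (sign \<sigma>) \<cdot>\<^sub>m 1\<^sub>m 1)"

text \<open>
  The sign element of \<open>R(m)\<close>, where \<open>\<phi>\<close> is the (unique) map of partition rings from \<open>RU\<close> to \<open>R\<close>.
\<close>

definition sign_element :: "(partition \<Rightarrow> virtual_rep \<Rightarrow> 'r) \<Rightarrow> nat \<Rightarrow> 'r" where
  "sign_element \<phi> m = \<phi> (indiscrete m) (rep_class (block_perms (indiscrete m)) sign_rep)"

end

theory Submission
  imports Defs
begin

text \<open>
  Multiplying termwise by an exponential series is compatible with the transfer product, by Frobenius
  reciprocity, so the claim reduces to \<open>\<Sum>\<^sub>j (-1)\<^sup>j Ind (1 \<otimes> sgn\<^sub>j) = 0\<close> in \<open>RU(\<Sigma>\<^sub>m)\<close> for \<open>m > 0\<close>, the induction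
  being from \<open>\<Sigma>\<^bsub>m-j\<^esub> \<times> \<Sigma>\<^sub>j\<close>. The induced representation is the exterior power \<open>\<Lambda>\<^sup>j \<complex>\<^sup>m\<close> of the permutation
  representation, and Clifford multiplication by the invariant vector \<open>(1, \<dots>, 1)\<close> is an equivariant map with
  square \<open>m\<close> that exchanges the even and the odd part of the exterior algebra.
\<close>

section \<open>Families of matrices over finite index sets\<close>

text \<open>The classical reason for the identity is exactness of the Koszul complex. An exact
  complex yields a relation between classes only after it has been split. Adding contraction to
  exterior multiplication gives instead a single equivariant isomorphism from the even to the odd
  part, because the scalar \<open>m\<close> is invertible over the complex numbers for
  \<open>m > 0\<close>; degree 0 is checked directly. Comparing even with odd degrees also keeps
  minus signs out of the representation ring: two honest representations are isomorphic, and an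
  additive map turns this into an equality of two finite sums in \<open>deg R m\<close>.
  Representations are given by matrices with numerical indices, while the bases that occur here are
  subsets of \<open>{1..m}\<close>, disjoint sums and pairs. Matrices are therefore replaced by
  families indexed by arbitrary finite sets, where most isomorphisms are bijections of index sets,
  possibly with signs, and the numbering of a basis enters only in a few translation lemmas.\<close>

definition fam_rep :: "('g, 'm) monoid_scheme \<Rightarrow> 'b set \<Rightarrow> ('g \<Rightarrow> 'b \<Rightarrow> 'b \<Rightarrow> complex) \<Rightarrow> bool" where
  "fam_rep G B \<rho> \<longleftrightarrow>
     (\<forall>b\<in>B. \<forall>c\<in>B. \<rho> \<one>\<^bsub>G\<^esub> b c = of_bool (b = c)) \<and>
     (\<forall>g\<in>carrier G. \<forall>h\<in>carrier G. \<forall>b\<in>B. \<forall>c\<in>B. \<rho> (g \<otimes>\<^bsub>G\<^esub> h) b c = (\<Sum>d\<in>B. \<rho> g b d * \<rho> h d c))"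

text \<open>Both products are required to be identities, since \<open>B\<close> and \<open>C\<close>
  may have different types and sizes. For finite sets equality of the sizes is then a consequence,
  by a trace computation.\<close>

definition inverse_fams :: "'b set \<Rightarrow> 'c set \<Rightarrow> ('c \<Rightarrow> 'b \<Rightarrow> complex) \<Rightarrow> ('b \<Rightarrow> 'c \<Rightarrow> complex) \<Rightarrow> bool" where
  "inverse_fams B C P Q \<longleftrightarrow>
     (\<forall>c\<in>C. \<forall>d\<in>C. (\<Sum>b\<in>B. P c b * Q b d) = of_bool (c = d)) \<and>
     (\<forall>b\<in>B. \<forall>d\<in>B. (\<Sum>c\<in>C. Q b c * P c d) = of_bool (b = d))"

definition intertwines :: "('g, 'm) monoid_scheme \<Rightarrow> 'b set \<Rightarrow> ('g \<Rightarrow> 'b \<Rightarrow> 'b \<Rightarrow> complex) \<Rightarrow>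
    'c set \<Rightarrow> ('g \<Rightarrow> 'c \<Rightarrow> 'c \<Rightarrow> complex) \<Rightarrow> ('c \<Rightarrow> 'b \<Rightarrow> complex) \<Rightarrow> bool" where
  "intertwines G B \<rho> C \<sigma> P \<longleftrightarrow>
     (\<forall>g\<in>carrier G. \<forall>c\<in>C. \<forall>b\<in>B. (\<Sum>b'\<in>B. P c b' * \<rho> g b' b) = (\<Sum>c'\<in>C. \<sigma> g c c' * P c' b))"

definition fam_iso :: "('g, 'm) monoid_scheme \<Rightarrow> 'b set \<Rightarrow> ('g \<Rightarrow> 'b \<Rightarrow> 'b \<Rightarrow> complex) \<Rightarrow>
    'c set \<Rightarrow> ('g \<Rightarrow> 'c \<Rightarrow> 'c \<Rightarrow> complex) \<Rightarrow> bool" where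
  "fam_iso G B \<rho> C \<sigma> \<longleftrightarrow> finite B \<and> finite C \<and>
     (\<exists>P Q. inverse_fams B C P Q \<and> intertwines G B \<rho> C \<sigma> P)"

section \<open>Isomorphism of families is an equivalence relation\<close>

lemma inverse_fams_sym: "inverse_fams B C P Q \<Longrightarrow> inverse_fams C B Q P"
  by (auto simp: inverse_fams_def)

text \<open>In matrix notation,
  \<open>Q \<sigma> = Q \<sigma> P Q = Q P \<rho> Q = \<rho> Q\<close>.\<close>

lemma intertwines_inverse:
  assumes "finite B" "finite C" "inverse_fams B C P Q" "intertwines G B \<rho> C \<sigma> P"
  shows "intertwines G C \<sigma> B \<rho> Q"
  unfolding intertwines_def
proof (intro ballI)
  fix g b c assume g: "g \<in> carrier G" and b: "b \<in> B" and c: "c \<in> C"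
  note inv = assms(3)[unfolded inverse_fams_def]
  have "(\<Sum>c'\<in>C. Q b c' * \<sigma> g c' c)
      = (\<Sum>c'\<in>C. \<Sum>d\<in>C. Q b c' * \<sigma> g c' d * of_bool (d = c))"
    using c assms(2) by (simp add: of_bool_def sum.delta if_distrib cong: if_cong)
  also have "\<dots> = (\<Sum>c'\<in>C. \<Sum>d\<in>C. \<Sum>e\<in>B. Q b c' * \<sigma> g c' d * (P d e * Q e c))"
    by (intro sum.cong refl) (simp add: inv[THEN conjunct1, rule_format] c sum_distrib_left[symmetric])
  also have "\<dots> = (\<Sum>c'\<in>C. \<Sum>e\<in>B. Q b c' * (\<Sum>d\<in>C. \<sigma> g c' d * P d e) * Q e c)"
    by (intro sum.cong refl, subst sum.swap) (simp add: sum_distrib_left sum_distrib_right mult.assoc)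
  also have "\<dots> = (\<Sum>c'\<in>C. \<Sum>e\<in>B. Q b c' * (\<Sum>e'\<in>B. P c' e' * \<rho> g e' e) * Q e c)"
    using assms(4) g by (intro sum.cong refl) (simp add: intertwines_def)
  also have "\<dots> = (\<Sum>e\<in>B. \<Sum>e'\<in>B. (\<Sum>c'\<in>C. Q b c' * P c' e') * \<rho> g e' e * Q e c)"
    apply (subst sum.swap, intro sum.cong refl)
    apply (simp add: sum_distrib_left sum_distrib_right)
    by (subst sum.swap) (simp add: mult.assoc)
  also have "\<dots> = (\<Sum>e\<in>B. \<Sum>e'\<in>B. of_bool (b = e') * \<rho> g e' e * Q e c)"
    by (intro sum.cong refl) (simp add: inv[THEN conjunct2, rule_format] b)
  also have "\<dots> = (\<Sum>e\<in>B. \<rho> g b e * Q e c)"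
    using b assms(1) by (simp add: of_bool_def if_distrib if_distribR sum.delta cong: if_cong)
  finally show "(\<Sum>c'\<in>C. Q b c' * \<sigma> g c' c) = (\<Sum>e\<in>B. \<rho> g b e * Q e c)" .
qed

lemma fam_iso_sym: "fam_iso G B \<rho> C \<sigma> \<Longrightarrow> fam_iso G C \<sigma> B \<rho>"
  unfolding fam_iso_def by (metis inverse_fams_sym intertwines_inverse)

text \<open>Associativity of the matrix product in terms of entries; as a rewrite rule it nests
  products to the right.\<close>

lemma sum_mult_sum:
  fixes P :: "'a \<Rightarrow> complex"
  shows "(\<Sum>b\<in>B. (\<Sum>c\<in>C. P c * P' c b) * R b) = (\<Sum>c\<in>C. P c * (\<Sum>b\<in>B. P' c b * R b))"
  by (simp add: sum_distrib_left sum_distrib_right mult.assoc) (rule sum.swap)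

lemma inverse_fams_comp:
  assumes "finite B" "finite C" "finite D" "inverse_fams B C P Q" "inverse_fams C D P' Q'"
  shows "inverse_fams B D (\<lambda>d b. \<Sum>c\<in>C. P' d c * P c b) (\<lambda>b d. \<Sum>c\<in>C. Q b c * Q' c d)"
proof -
  \<comment> \<open>Generalised over the sets and their types, because the second half of the claim
    is the same computation with the two ends exchanged.\<close>
  have *: "(\<Sum>b\<in>B. (\<Sum>c\<in>C. P' d c * P c b) * (\<Sum>c\<in>C. Q b c * Q' c e)) = of_bool (d = e)"
    if "d \<in> D" "e \<in> D" "finite B" "finite C" "finite D" "inverse_fams B C P Q" "inverse_fams C D P' Q'"
    for B :: "'x set" and C :: "'y set" and D :: "'z set" and P Q P' Q' d e
  proof -
    note inv = that(6)[unfolded inverse_fams_def] that(7)[unfolded inverse_fams_def]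
    have "(\<Sum>b\<in>B. (\<Sum>c\<in>C. P' d c * P c b) * (\<Sum>c\<in>C. Q b c * Q' c e))
        = (\<Sum>c\<in>C. P' d c * (\<Sum>c'\<in>C. (\<Sum>b\<in>B. P c b * Q b c') * Q' c' e))"
      by (simp add: sum_mult_sum)
    also have "\<dots> = (\<Sum>c\<in>C. P' d c * (\<Sum>c'\<in>C. of_bool (c = c') * Q' c' e))"
      by (intro sum.cong refl arg_cong2[where f="(*)"]) (simp add: inv(1)[THEN conjunct1, rule_format])
    also have "\<dots> = (\<Sum>c\<in>C. P' d c * Q' c e)"
      using that(4) by (intro sum.cong refl) (simp add: of_bool_def if_distrib if_distribR sum.delta cong: if_cong)
    finally show ?thesis using inv(2) that by simp
  qed
  show ?thesis unfolding inverse_fams_def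
    using *[OF _ _ assms] *[OF _ _ assms(3,2,1) inverse_fams_sym[OF assms(5)] inverse_fams_sym[OF assms(4)]]
    by auto
qed

lemma fam_iso_trans:
  assumes "fam_iso G B \<rho> C \<sigma>" "fam_iso G C \<sigma> D \<tau>"
  shows "fam_iso G B \<rho> D \<tau>"
proof -
  obtain P Q where 1: "finite B" "finite C" "inverse_fams B C P Q" "intertwines G B \<rho> C \<sigma> P"
    using assms(1) by (auto simp: fam_iso_def)
  obtain P' Q' where 2: "finite D" "inverse_fams C D P' Q'" "intertwines G C \<sigma> D \<tau> P'"
    using assms(2) by (auto simp: fam_iso_def)
  have "intertwines G B \<rho> D \<tau> (\<lambda>d b. \<Sum>c\<in>C. P' d c * P c b)"
    unfolding intertwines_def
  proof (intro ballI)
    fix g d b assume g: "g \<in> carrier G" and d: "d \<in> D" and b: "b \<in> B"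
    have "(\<Sum>b'\<in>B. (\<Sum>c\<in>C. P' d c * P c b') * \<rho> g b' b) = (\<Sum>c\<in>C. P' d c * (\<Sum>c'\<in>C. \<sigma> g c c' * P c' b))"
      unfolding sum_mult_sum using 1(4) g b by (intro sum.cong refl) (simp add: intertwines_def)
    also have "\<dots> = (\<Sum>c'\<in>C. (\<Sum>c\<in>C. P' d c * \<sigma> g c c') * P c' b)"
      by (simp add: sum_mult_sum)
    also have "\<dots> = (\<Sum>c'\<in>C. (\<Sum>d'\<in>D. \<tau> g d d' * P' d' c') * P c' b)"
      using 2(3) g d by (intro sum.cong refl) (simp add: intertwines_def)
    finally show "(\<Sum>b'\<in>B. (\<Sum>c\<in>C. P' d c * P c b') * \<rho> g b' b) = (\<Sum>d'\<in>D. \<tau> g d d' * (\<Sum>c\<in>C. P' d' c * P c b))"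
      by (simp add: sum_mult_sum)
  qed
  then show ?thesis using inverse_fams_comp[OF 1(1,2) 2(1) 1(3) 2(2)] 1 2 by (auto simp: fam_iso_def)
qed

text \<open>The intertwiner is the monomial matrix sending the basis vector of \<open>b\<close> to
  \<open>s b\<close> times the basis vector of \<open>h b\<close>. Each side of the intertwining
  relation then has a single surviving term, and the last hypothesis equates the two.\<close>

lemma fam_iso_monomial:
  assumes "finite B" "bij_betw h B C" "\<And>b. b \<in> B \<Longrightarrow> s b \<noteq> (0::complex)"
    and "\<And>g b c. g \<in> carrier G \<Longrightarrow> b \<in> B \<Longrightarrow> c \<in> B \<Longrightarrow> s b * \<rho> g b c = \<sigma> g (h b) (h c) * s c"
  shows "fam_iso G B \<rho> C \<sigma>"
proof -
  let ?P = "\<lambda>c b. if c = h b then s b else 0" and ?Q = "\<lambda>b c. if c = h b then inverse (s b) else 0"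
  have C: "C = h ` B" and inj: "inj_on h B" using assms(2) by (auto simp: bij_betw_def)
  have eq: "h b = h c \<longleftrightarrow> b = c" if "b \<in> B" "c \<in> B" for b c using that inj by (auto dest: inj_onD)
  have sumC: "(\<Sum>c\<in>C. f c) = (\<Sum>b\<in>B. f (h b))" for f :: "'b \<Rightarrow> complex"
    using inj by (simp add: C sum.reindex)
  \<comment> \<open>All four forms are listed because the equation between \<open>h a\<close> and
    \<open>h b\<close> and the two factors occur either way round below.\<close>
  have sd: "(\<Sum>b\<in>B. (if h a = h b then x b else 0) * y b) = x a * y a"
      "(\<Sum>b\<in>B. (if h b = h a then x b else 0) * y b) = x a * y a"
      "(\<Sum>b\<in>B. y b * (if h a = h b then x b else 0)) = y a * x a"
      "(\<Sum>b\<in>B. y b * (if h b = h a then x b else 0)) = y a * x a"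
    if "a \<in> B" for a and x y :: "'a \<Rightarrow> complex"
  proof -
    have "(\<Sum>b\<in>B. (if h a = h b then x b else 0) * y b) = (\<Sum>b\<in>B. if a = b then x b * y b else 0)"
      using that by (intro sum.cong refl) (auto simp: eq)
    moreover have "(\<Sum>b\<in>B. y b * (if h a = h b then x b else 0)) = (\<Sum>b\<in>B. if a = b then y b * x b else 0)"
      using that by (intro sum.cong refl) (auto simp: eq)
    ultimately show "(\<Sum>b\<in>B. (if h a = h b then x b else 0) * y b) = x a * y a"
      "(\<Sum>b\<in>B. y b * (if h a = h b then x b else 0)) = y a * x a"
      "(\<Sum>b\<in>B. (if h b = h a then x b else 0) * y b) = x a * y a"
      "(\<Sum>b\<in>B. y b * (if h b = h a then x b else 0)) = y a * x a"
      using that assms(1) by (simp_all add: sum.delta eq_commute[of "h a"])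
  qed
  \<comment> \<open>Here the scalar belongs to the fixed index \<open>a\<close> instead of the
    summation variable; by injectivity of \<open>h\<close> the two agree wherever the term is
    nonzero.\<close>
  have sc: "(\<Sum>c\<in>B. x c * (if h c = h a then s a else 0)) = x a * s a" 
    "(\<Sum>c\<in>B. (if h c = h a then inverse (s a) else 0) * x c) = inverse (s a) * x a"
    if "a \<in> B" for a x
  proof -
    have "(\<Sum>c\<in>B. x c * (if h c = h a then s a else 0)) = (\<Sum>c\<in>B. x c * (if h c = h a then s c else 0))"
      by (intro sum.cong refl) (use that eq in auto)
    then show "(\<Sum>c\<in>B. x c * (if h c = h a then s a else 0)) = x a * s a"
      using sd(4)[OF that, of x s] by simp
    have "(\<Sum>c\<in>B. (if h c = h a then inverse (s a) else 0) * x c) = (\<Sum>c\<in>B. (if h c = h a then inverse (s c) else 0) * x c)"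
      by (intro sum.cong refl) (use that eq in auto)
    then show "(\<Sum>c\<in>B. (if h c = h a then inverse (s a) else 0) * x c) = inverse (s a) * x a"
      using sd(2)[OF that, of "\<lambda>b. inverse (s b)" x] by simp
  qed
  have "inverse_fams B C ?P ?Q"
    unfolding inverse_fams_def
  proof (intro conjI ballI)
    fix c d assume "c \<in> C" "d \<in> C"
    then obtain a b where ab: "a \<in> B" "b \<in> B" "c = h a" "d = h b" by (auto simp: C)
    show "(\<Sum>b\<in>B. ?P c b * ?Q b d) = of_bool (c = d)"
      unfolding ab(3,4) sd(1)[OF ab(1)] using ab assms(3) by (simp add: eq)
  next
    fix b d assume "b \<in> B" "d \<in> B"
    then show "(\<Sum>c\<in>C. ?Q b c * ?P c d) = of_bool (b = d)"
      unfolding sumC sc(2)[OF \<open>b \<in> B\<close>] using assms(3) by (simp add: eq)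
  qed
  moreover have "intertwines G B \<rho> C \<sigma> ?P"
    unfolding intertwines_def
  proof (intro ballI)
    fix g c b assume "g \<in> carrier G" "c \<in> C" "b \<in> B"
    moreover from this obtain a where "a \<in> B" "c = h a" by (auto simp: C)
    ultimately show "(\<Sum>b'\<in>B. ?P c b' * \<rho> g b' b) = (\<Sum>c'\<in>C. \<sigma> g c c' * ?P c' b)"
      using assms(4) by (simp add: sd sumC sc)
  qed
  ultimately show ?thesis using assms(1,2) by (auto simp: fam_iso_def C)
qed

lemma fam_iso_reindex:
  assumes "finite B" "bij_betw h B C"
    and "\<And>g b c. g \<in> carrier G \<Longrightarrow> b \<in> B \<Longrightarrow> c \<in> B \<Longrightarrow> \<rho> g b c = \<sigma> g (h b) (h c)"
  shows "fam_iso G B \<rho> C \<sigma>"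
  by (rule fam_iso_monomial[where s = "\<lambda>_. 1"]) (use assms in auto)

lemma fam_iso_refl: "finite B \<Longrightarrow> fam_iso G B \<rho> B \<rho>"
  by (rule fam_iso_reindex[where h = id]) auto

lemma fam_rep_reindex:
  assumes "bij_betw h B C" "fam_rep G C \<sigma>" "monoid G"
    and "\<And>g b c. g \<in> carrier G \<Longrightarrow> b \<in> B \<Longrightarrow> c \<in> B \<Longrightarrow> \<rho> g b c = \<sigma> g (h b) (h c)"
  shows "fam_rep G B \<rho>"
proof -
  have C: "C = h ` B" and inj: "inj_on h B" using assms(1) by (auto simp: bij_betw_def)
  interpret monoid G by fact
  show ?thesis
    unfolding fam_rep_def
  proof (intro conjI ballI)
    fix b c assume "b \<in> B" "c \<in> B"
    then show "\<rho> \<one>\<^bsub>G\<^esub> b c = of_bool (b = c)"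
      using assms(2,4) inj by (auto simp: fam_rep_def C inj_on_eq_iff)
  next
    fix g h b c assume "g \<in> carrier G" "h \<in> carrier G" "b \<in> B" "c \<in> B"
    then show "\<rho> (g \<otimes>\<^bsub>G\<^esub> h) b c = (\<Sum>d\<in>B. \<rho> g b d * \<rho> h d c)"
      using assms(2,4) inj by (simp add: fam_rep_def C sum.reindex)
  qed
qed

section \<open>Direct sums of families\<close>

fun fam_sum :: "('g \<Rightarrow> 'b \<Rightarrow> 'b \<Rightarrow> complex) \<Rightarrow> ('g \<Rightarrow> 'c \<Rightarrow> 'c \<Rightarrow> complex) \<Rightarrow> 'g \<Rightarrow> 'b + 'c \<Rightarrow> 'b + 'c \<Rightarrow> complex" where
  "fam_sum \<rho> \<sigma> g (Inl b) (Inl b') = \<rho> g b b'"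
| "fam_sum \<rho> \<sigma> g (Inr c) (Inr c') = \<sigma> g c c'"
| "fam_sum \<rho> \<sigma> g _ _ = 0"

lemma fam_rep_sum:
  assumes "finite B" "finite C" "fam_rep G B \<rho>" "fam_rep G C \<sigma>"
  shows "fam_rep G (B <+> C) (fam_sum \<rho> \<sigma>)"
  using assms unfolding fam_rep_def by (auto simp: sum.Plus)

lemma fam_iso_sum:
  assumes "fam_iso G B \<rho> B' \<rho>'" "fam_iso G C \<sigma> C' \<sigma>'"
  shows "fam_iso G (B <+> C) (fam_sum \<rho> \<sigma>) (B' <+> C') (fam_sum \<rho>' \<sigma>')"
proof -
  obtain P Q where 1: "finite B" "finite B'" "inverse_fams B B' P Q" "intertwines G B \<rho> B' \<rho>' P"
    using assms(1) by (auto simp: fam_iso_def)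
  obtain P' Q' where 2: "finite C" "finite C'" "inverse_fams C C' P' Q'" "intertwines G C \<sigma> C' \<sigma>' P'"
    using assms(2) by (auto simp: fam_iso_def)
  let ?P = "\<lambda>x y. case (x, y) of (Inl a, Inl b) \<Rightarrow> P a b | (Inr a, Inr b) \<Rightarrow> P' a b | _ \<Rightarrow> 0"
  let ?Q = "\<lambda>x y. case (x, y) of (Inl a, Inl b) \<Rightarrow> Q a b | (Inr a, Inr b) \<Rightarrow> Q' a b | _ \<Rightarrow> 0"
  have "inverse_fams (B <+> C) (B' <+> C') ?P ?Q"
    using 1(1-3) 2(1-3) by (auto simp: inverse_fams_def sum.Plus)
  moreover have "intertwines G (B <+> C) (fam_sum \<rho> \<sigma>) (B' <+> C') (fam_sum \<rho>' \<sigma>') ?P"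
    using 1(1,2,4) 2(1,2,4) by (auto simp: intertwines_def sum.Plus)
  ultimately show ?thesis using 1 2 by (auto simp: fam_iso_def)
qed

text \<open>A block matrix whose block at \<open>(d, e)\<close> is the scalar \<open>w g d e\<close>
  times the matrix of \<open>\<rho>\<close> at \<open>\<theta> g d e\<close>. For a tensor product
  \<open>w\<close> is the matrix of the first factor and \<open>\<theta>\<close> returns
  \<open>g\<close>. For an induced representation \<open>w\<close> is the permutation matrix of
  \<open>g\<close> on the cosets and \<open>\<theta>\<close> the element of the subgroup that
  appears when \<open>g\<close> moves one coset representative to another.\<close>

definition twist :: "('g \<Rightarrow> 'd \<Rightarrow> 'd \<Rightarrow> complex) \<Rightarrow> ('g \<Rightarrow> 'd \<Rightarrow> 'd \<Rightarrow> 'h) \<Rightarrow> ('h \<Rightarrow> 'b \<Rightarrow> 'b \<Rightarrow> complex) \<Rightarrow>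
    'g \<Rightarrow> 'd \<times> 'b \<Rightarrow> 'd \<times> 'b \<Rightarrow> complex" where
  "twist w \<theta> \<rho> g x y = w g (fst x) (fst y) * \<rho> (\<theta> g (fst x) (fst y)) (snd x) (snd y)"

text \<open>Closure and the cocycle rule for \<open>\<theta>\<close> are imposed only where
  \<open>w\<close> is nonzero, since for an induced representation \<open>\<theta>\<close> is the
  value of an inverse map that is meaningful only there.\<close>

definition twisting :: "('h, 'm) monoid_scheme \<Rightarrow> ('g, 'n) monoid_scheme \<Rightarrow> 'd set \<Rightarrow>
    ('g \<Rightarrow> 'd \<Rightarrow> 'd \<Rightarrow> complex) \<Rightarrow> ('g \<Rightarrow> 'd \<Rightarrow> 'd \<Rightarrow> 'h) \<Rightarrow> bool" where
  "twisting H G D w \<theta> \<longleftrightarrow> finite D \<and> fam_rep G D w \<and> (\<forall>d\<in>D. \<theta> \<one>\<^bsub>G\<^esub> d d = \<one>\<^bsub>H\<^esub>) \<and>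
     (\<forall>g\<in>carrier G. \<forall>d\<in>D. \<forall>e\<in>D. w g d e \<noteq> 0 \<longrightarrow> \<theta> g d e \<in> carrier H) \<and>
     (\<forall>g\<in>carrier G. \<forall>h\<in>carrier G. \<forall>c\<in>D. \<forall>d\<in>D. \<forall>e\<in>D. w g c d \<noteq> 0 \<longrightarrow> w h d e \<noteq> 0 \<longrightarrow>
        \<theta> (g \<otimes>\<^bsub>G\<^esub> h) c e = \<theta> g c d \<otimes>\<^bsub>H\<^esub> \<theta> h d e)"

text \<open>Multiplicativity of \<open>w\<close> expands the left side into a sum over intermediate
  \<open>d\<close>. In every nonzero term the cocycle rule factors the same argument
  \<open>\<theta> (g \<otimes> h) c e\<close> through that \<open>d\<close>, and multiplicativity of
  \<open>\<rho>\<close> applies.\<close>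

lemma fam_rep_twist:
  assumes "twisting H G D w \<theta>" "finite B" "fam_rep H B \<rho>"
  shows "fam_rep G (D \<times> B) (twist w \<theta> \<rho>)"
  unfolding fam_rep_def
proof (intro conjI ballI)
  fix x y assume "x \<in> D \<times> B" "y \<in> D \<times> B"
  then show "twist w \<theta> \<rho> \<one>\<^bsub>G\<^esub> x y = of_bool (x = y)"
    using assms by (cases x; cases y) (auto simp: twist_def twisting_def fam_rep_def)
next
  fix g h x y assume g: "g \<in> carrier G" and h: "h \<in> carrier G" and "x \<in> D \<times> B" "y \<in> D \<times> B"
  then obtain c a e b where xy: "x = (c, a)" "y = (e, b)" "c \<in> D" "a \<in> B" "e \<in> D" "b \<in> B" by auto
  have w: "w (g \<otimes>\<^bsub>G\<^esub> h) c e = (\<Sum>d\<in>D. w g c d * w h d e)"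
    using assms g h xy by (auto simp: twisting_def fam_rep_def)
  have "twist w \<theta> \<rho> (g \<otimes>\<^bsub>G\<^esub> h) x y = (\<Sum>d\<in>D. w g c d * w h d e * \<rho> (\<theta> (g \<otimes>\<^bsub>G\<^esub> h) c e) a b)"
    by (simp add: twist_def xy w sum_distrib_right)
  also have "\<dots> = (\<Sum>d\<in>D. \<Sum>b'\<in>B. (w g c d * \<rho> (\<theta> g c d) a b') * (w h d e * \<rho> (\<theta> h d e) b' b))"
  proof (intro sum.cong refl)
    fix d assume d: "d \<in> D"
    show "w g c d * w h d e * \<rho> (\<theta> (g \<otimes>\<^bsub>G\<^esub> h) c e) a b =
        (\<Sum>b'\<in>B. (w g c d * \<rho> (\<theta> g c d) a b') * (w h d e * \<rho> (\<theta> h d e) b' b))"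
    proof (cases "w g c d = 0 \<or> w h d e = 0")
      case False
      then have "\<theta> (g \<otimes>\<^bsub>G\<^esub> h) c e = \<theta> g c d \<otimes>\<^bsub>H\<^esub> \<theta> h d e" "\<theta> g c d \<in> carrier H" "\<theta> h d e \<in> carrier H"
        using assms(1) g h d xy unfolding twisting_def by blast+
      then show ?thesis using assms(3) xy by (simp add: fam_rep_def sum_distrib_left algebra_simps)
    qed auto
  qed
  finally show "twist w \<theta> \<rho> (g \<otimes>\<^bsub>G\<^esub> h) x y = (\<Sum>z\<in>D \<times> B. twist w \<theta> \<rho> g x z * twist w \<theta> \<rho> h z y)"
    by (simp add: sum.cartesian_product' twist_def xy)
qed

text \<open>The intertwiner is the identity of \<open>D\<close> tensored with \<open>P\<close>. It
  commutes with the scalars \<open>w\<close>, and blocks with \<open>w = 0\<close> impose no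
  condition, so the arguments of \<open>\<rho>\<close> that matter lie in \<open>H\<close>.\<close>

lemma fam_iso_twist:
  assumes "twisting H G D w \<theta>" "fam_iso H B \<rho> C \<sigma>"
  shows "fam_iso G (D \<times> B) (twist w \<theta> \<rho>) (D \<times> C) (twist w \<theta> \<sigma>)"
proof -
  obtain P Q where 1: "finite B" "finite C" "inverse_fams B C P Q" "intertwines H B \<rho> C \<sigma> P"
    using assms(2) by (auto simp: fam_iso_def)
  have D: "finite D" using assms(1) by (simp add: twisting_def)
  let ?P = "\<lambda>x y. of_bool (fst x = fst y) * P (snd x) (snd y)"
  let ?Q = "\<lambda>x y. of_bool (fst x = fst y) * Q (snd x) (snd y)"
  have sd: "(\<Sum>x\<in>D. f x * of_bool (x = d) * k) = f d * k" "(\<Sum>x\<in>D. f x * of_bool (d = x) * k) = f d * k"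
    if "d \<in> D" for f d and k :: complex
    using that D by (simp_all add: sum_distrib_right[symmetric] of_bool_def if_distrib if_distribR sum.delta sum.delta' cong: if_cong)
  have inv: "(\<Sum>y\<in>D \<times> B. (of_bool (d = fst y) * P c (snd y)) * (of_bool (fst y = e) * Q (snd y) c')) =
     of_bool ((d, c) = (e, c'))"
    if "d \<in> D" "c \<in> C" "e \<in> D" "c' \<in> C" "finite B" "inverse_fams B C P Q"
    for d c e c' and B :: "'x set" and C :: "'y set" and P Q
  proof -
    have "(\<Sum>y\<in>D \<times> B. (of_bool (d = fst y) * P c (snd y)) * (of_bool (fst y = e) * Q (snd y) c')) =
      (\<Sum>x\<in>D. of_bool (x = e) * of_bool (d = x) * (\<Sum>b\<in>B. P c b * Q b c'))"
      by (simp add: sum.cartesian_product' sum_distrib_left mult_ac)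
    then show ?thesis using that by (simp add: sd inverse_fams_def)
  qed
  have "inverse_fams (D \<times> B) (D \<times> C) ?P ?Q"
    unfolding inverse_fams_def using inv[OF _ _ _ _ 1(1,3)] inv[OF _ _ _ _ 1(2) inverse_fams_sym[OF 1(3)]]
    by auto
  moreover have "intertwines G (D \<times> B) (twist w \<theta> \<rho>) (D \<times> C) (twist w \<theta> \<sigma>) ?P"
    unfolding intertwines_def
  proof (intro ballI)
    fix g x y assume g: "g \<in> carrier G" and "x \<in> D \<times> C" "y \<in> D \<times> B"
    then obtain c a e b where xy: "x = (c, a)" "y = (e, b)" "c \<in> D" "a \<in> C" "e \<in> D" "b \<in> B" by auto
    have "(\<Sum>z\<in>D \<times> B. ?P x z * twist w \<theta> \<rho> g z y) =
      (\<Sum>d\<in>D. (\<Sum>b'\<in>B. P a b' * \<rho> (\<theta> g d e) b' b) * w g d e * of_bool (c = d) * 1)"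
      by (simp add: sum.cartesian_product' twist_def xy sum_distrib_left sum_distrib_right mult_ac)
    also have "\<dots> = w g c e * (\<Sum>b'\<in>B. P a b' * \<rho> (\<theta> g c e) b' b)"
      using xy by (subst sd) auto
    also have "\<dots> = w g c e * (\<Sum>c'\<in>C. \<sigma> (\<theta> g c e) a c' * P c' b)"
      using 1(4) xy g assms(1) unfolding twisting_def intertwines_def by (cases "w g c e = 0") auto
    also have "\<dots> = (\<Sum>d\<in>D. (\<Sum>c'\<in>C. \<sigma> (\<theta> g c d) a c' * P c' b) * w g c d * of_bool (d = e) * 1)"
      using xy by (subst sd) auto
    also have "\<dots> = (\<Sum>z\<in>D \<times> C. twist w \<theta> \<sigma> g x z * ?P z y)"
      by (simp add: sum.cartesian_product' twist_def xy sum_distrib_left sum_distrib_right mult_ac)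
    finally show "(\<Sum>z\<in>D \<times> B. ?P x z * twist w \<theta> \<rho> g z y) = (\<Sum>z\<in>D \<times> C. twist w \<theta> \<sigma> g x z * ?P z y)" .
  qed
  ultimately show ?thesis using 1 D by (auto simp: fam_iso_def)
qed

lemma fam_iso_twist_sum:
  assumes "finite D" "finite B" "finite C"
  shows "fam_iso G (D \<times> (B <+> C)) (twist w \<theta> (fam_sum \<rho> \<sigma>)) (D \<times> B <+> D \<times> C) (fam_sum (twist w \<theta> \<rho>) (twist w \<theta> \<sigma>))"
  by (rule fam_iso_reindex[where h = "\<lambda>(d, x). case x of Inl b \<Rightarrow> Inl (d, b) | Inr c \<Rightarrow> Inr (d, c)"])
    (use assms in \<open>auto simp: bij_betw_def inj_on_def twist_def image_iff split: sum.splits\<close>, force+)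

section \<open>The representation ring\<close>

abbreviation coef :: "'g rep \<Rightarrow> 'g \<Rightarrow> nat \<Rightarrow> nat \<Rightarrow> complex" where
  "coef V g i j \<equiv> snd V g $$ (i, j)"

section \<open>Translation between matrices and families\<close>

lemma is_rep_iff_fam_rep:
  assumes "monoid G"
  shows "is_rep G V \<longleftrightarrow>
    (\<forall>g\<in>carrier G. snd V g \<in> carrier_mat (fst V) (fst V)) \<and> fam_rep G {..<fst V} (coef V)"
proof -
  interpret monoid G by fact
  let ?n = "fst V"
  show ?thesis
  proof (cases "\<forall>g\<in>carrier G. snd V g \<in> carrier_mat ?n ?n")
    case True
    have "snd V \<one>\<^bsub>G\<^esub> = 1\<^sub>m ?n \<longleftrightarrow> (\<forall>i\<in>{..<?n}. \<forall>j\<in>{..<?n}. coef V \<one>\<^bsub>G\<^esub> i j = of_bool (i = j))"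
      using True one_closed by (auto simp: mat_eq_iff dest: carrier_matD)
    moreover have "snd V (g \<otimes>\<^bsub>G\<^esub> h) = snd V g * snd V h \<longleftrightarrow>
        (\<forall>i\<in>{..<?n}. \<forall>j\<in>{..<?n}. coef V (g \<otimes>\<^bsub>G\<^esub> h) i j = (\<Sum>k\<in>{..<?n}. coef V g i k * coef V h k j))"
      if "g \<in> carrier G" "h \<in> carrier G" for g h
    proof -
      have "snd V g \<in> carrier_mat ?n ?n" "snd V h \<in> carrier_mat ?n ?n" "snd V (g \<otimes>\<^bsub>G\<^esub> h) \<in> carrier_mat ?n ?n"
        using True that by auto
      then show ?thesis
        by (auto simp: mat_eq_iff scalar_prod_def atLeast0LessThan dest!: carrier_matD)
    qed
    ultimately show ?thesis using True by (simp add: is_rep_def fam_rep_def)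
  qed (auto simp: is_rep_def)
qed

lemma rep_iso_iff_fam_iso:
  assumes "is_rep G V" "is_rep G W"
  shows "rep_iso G V W \<longleftrightarrow> fam_iso G {..<fst V} (coef V) {..<fst W} (coef W)"
proof
  assume "rep_iso G V W"
  then obtain P where n: "fst V = fst W" and P: "P \<in> carrier_mat (fst V) (fst V)" "invertible_mat P"
    and eq: "\<And>g. g \<in> carrier G \<Longrightarrow> P * snd V g = snd W g * P"
    by (auto simp: rep_iso_def)
  let ?n = "fst V"
  obtain Q where PQ: "P * Q = 1\<^sub>m ?n" and QP: "Q * P = 1\<^sub>m (dim_row Q)"
    using P by (auto simp: invertible_mat_def inverts_mat_def)
  \<comment> \<open>\<open>inverts_mat\<close> does not prescribe the shape of \<open>Q\<close>;
    comparing column counts in the two identities recovers it.\<close>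
  have "dim_col Q = ?n" using arg_cong[OF PQ, of dim_col] by simp
  moreover have "dim_row Q = ?n" using arg_cong[OF QP, of dim_col] P(1) by simp
  ultimately have Q: "Q \<in> carrier_mat ?n ?n" "Q * P = 1\<^sub>m ?n" using QP by auto
  have "(\<Sum>b\<in>{..<?n}. P $$ (c, b) * Q $$ (b, d)) = of_bool (c = d)"
    "(\<Sum>b\<in>{..<?n}. Q $$ (c, b) * P $$ (b, d)) = of_bool (c = d)" if "c < ?n" "d < ?n" for c d
    using that arg_cong[OF PQ, of "\<lambda>M. M $$ (c, d)"] arg_cong[OF Q(2), of "\<lambda>M. M $$ (c, d)"] P(1) Q(1)
    by (auto simp: scalar_prod_def atLeast0LessThan)
  then have "inverse_fams {..<?n} {..<?n} (\<lambda>c b. P $$ (c, b)) (\<lambda>b c. Q $$ (b, c))"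
    by (simp add: inverse_fams_def)
  moreover have "(\<Sum>b'\<in>{..<?n}. P $$ (c, b') * coef V g b' b) = (\<Sum>c'\<in>{..<?n}. coef W g c c' * P $$ (c', b))"
    if "g \<in> carrier G" "c < ?n" "b < ?n" for g c b
  proof -
    have "snd V g \<in> carrier_mat ?n ?n" "snd W g \<in> carrier_mat ?n ?n"
      using assms that(1) n by (auto simp: is_rep_def)
    then show ?thesis
      using that arg_cong[OF eq[OF that(1)], of "\<lambda>M. M $$ (c, b)"] P(1)
      by (auto simp: scalar_prod_def atLeast0LessThan)
  qed
  ultimately show "fam_iso G {..<?n} (coef V) {..<fst W} (coef W)"
    unfolding fam_iso_def intertwines_def n[symmetric] by (intro conjI exI) auto
next
  let ?n = "fst V" and ?m = "fst W"
  assume "fam_iso G {..<?n} (coef V) {..<?m} (coef W)"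
  then obtain p q where pq: "inverse_fams {..<?n} {..<?m} p q" and int: "intertwines G {..<?n} (coef V) {..<?m} (coef W) p"
    by (auto simp: fam_iso_def)
  \<comment> \<open>The traces of the two products \<open>PQ\<close> and \<open>QP\<close> agree,
    which forces the two dimensions to be equal as complex numbers.\<close>
  have "of_nat ?m = (\<Sum>c\<in>{..<?m}. \<Sum>b\<in>{..<?n}. p c b * q b c)"
    using pq by (simp add: inverse_fams_def)
  also have "\<dots> = (\<Sum>b\<in>{..<?n}. \<Sum>c\<in>{..<?m}. q b c * p c b)"
    by (subst sum.swap) (simp add: mult.commute)
  also have "\<dots> = of_nat ?n"
    using pq by (simp add: inverse_fams_def)
  finally have n: "?n = ?m" by (simp only: of_nat_eq_iff)
  let ?P = "mat ?n ?n (\<lambda>(i, j). p i j)" and ?Q = "mat ?n ?n (\<lambda>(i, j). q i j)"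
  have "?P * ?Q = 1\<^sub>m ?n" "?Q * ?P = 1\<^sub>m ?n"
    using pq n by (auto simp: mat_eq_iff scalar_prod_def atLeast0LessThan inverse_fams_def)
  then have "invertible_mat ?P" by (auto simp: invertible_mat_def inverts_mat_def)
  moreover have "?P * snd V g = snd W g * ?P" if g: "g \<in> carrier G" for g
  proof -
    have "snd V g \<in> carrier_mat ?n ?n" "snd W g \<in> carrier_mat ?n ?n"
      using assms g n by (auto simp: is_rep_def)
    then show ?thesis using int g n
      by (auto simp: mat_eq_iff scalar_prod_def atLeast0LessThan intertwines_def)
  qed
  ultimately show "rep_iso G V W" using n by (auto simp: rep_iso_def)
qed

section \<open>Direct sums of representations up to isomorphism\<close>

lemma is_rep_zero [simp]: "is_rep G zero_rep"
  by (simp add: is_rep_def zero_rep_def)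

lemma rep_iso_refl: "is_rep G V \<Longrightarrow> rep_iso G V V"
  by (simp add: rep_iso_iff_fam_iso fam_iso_refl)

lemma rep_iso_sym: "is_rep G V \<Longrightarrow> is_rep G W \<Longrightarrow> rep_iso G V W \<Longrightarrow> rep_iso G W V"
  by (simp add: rep_iso_iff_fam_iso fam_iso_sym)

lemma rep_iso_trans:
  "is_rep G U \<Longrightarrow> is_rep G V \<Longrightarrow> is_rep G W \<Longrightarrow> rep_iso G U V \<Longrightarrow> rep_iso G V W \<Longrightarrow> rep_iso G U W"
  using fam_iso_trans by (simp add: rep_iso_iff_fam_iso) blast

lemma rep_iso_dim_zero: "fst V = 0 \<Longrightarrow> fst W = 0 \<Longrightarrow> is_rep G V \<Longrightarrow> is_rep G W \<Longrightarrow> rep_iso G V W"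
  by (simp add: rep_iso_iff_fam_iso fam_iso_def inverse_fams_def intertwines_def)

lemma fam_direct_sum:
  assumes "is_rep G V" "is_rep G W"
  defines "h \<equiv> \<lambda>i. if i < fst V then Inl i else Inr (i - fst V)"
  shows "bij_betw h {..<fst (direct_sum V W)} ({..<fst V} <+> {..<fst W})"
    and "g \<in> carrier G \<Longrightarrow> i < fst V + fst W \<Longrightarrow> j < fst V + fst W \<Longrightarrow>
      coef (direct_sum V W) g i j = fam_sum (coef V) (coef W) g (h i) (h j)"
proof -
  show "bij_betw h {..<fst (direct_sum V W)} ({..<fst V} <+> {..<fst W})"
    by (rule bij_betw_byWitness[where f' = "\<lambda>x. case x of Inl i \<Rightarrow> i | Inr j \<Rightarrow> fst V + j"])
      (auto simp: h_def direct_sum_def split: if_splits)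
next
  assume "g \<in> carrier G" "i < fst V + fst W" "j < fst V + fst W"
  moreover from this have "snd V g \<in> carrier_mat (fst V) (fst V)" "snd W g \<in> carrier_mat (fst W) (fst W)"
    using assms by (auto simp: is_rep_def)
  ultimately show "coef (direct_sum V W) g i j = fam_sum (coef V) (coef W) g (h i) (h j)"
    by (auto simp: direct_sum_def h_def)
qed

lemma fst_direct_sum [simp]: "fst (direct_sum V W) = fst V + fst W"
  by (simp add: direct_sum_def)

lemma fam_iso_direct_sum:
  assumes "is_rep G V" "is_rep G W"
  shows "fam_iso G {..<fst V + fst W} (coef (direct_sum V W)) ({..<fst V} <+> {..<fst W}) (fam_sum (coef V) (coef W))"
  by (rule fam_iso_reindex[OF _ fam_direct_sum(1)[OF assms, simplified]])
    (use fam_direct_sum(2)[OF assms] in auto)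

lemma is_rep_direct_sum:
  assumes "monoid G" "is_rep G V" "is_rep G W"
  shows "is_rep G (direct_sum V W)"
proof -
  have "fam_rep G {..<fst V + fst W} (coef (direct_sum V W))"
    by (rule fam_rep_reindex[OF fam_direct_sum(1)[OF assms(2,3), simplified] fam_rep_sum assms(1)])
      (use assms fam_direct_sum(2)[OF assms(2,3)] in \<open>auto simp: is_rep_iff_fam_rep\<close>)
  moreover have "snd (direct_sum V W) g \<in> carrier_mat (fst V + fst W) (fst V + fst W)" if "g \<in> carrier G" for g
    using assms that by (auto simp: is_rep_def direct_sum_def)
  ultimately show ?thesis using assms(1) by (simp add: is_rep_iff_fam_rep)
qed

lemma rep_iso_direct_sum_cong:
  assumes "monoid G" "is_rep G V" "is_rep G W" "is_rep G V'" "is_rep G W'" "rep_iso G V V'" "rep_iso G W W'"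
  shows "rep_iso G (direct_sum V W) (direct_sum V' W')"
proof -
  have "fam_iso G ({..<fst V} <+> {..<fst W}) (fam_sum (coef V) (coef W))
      ({..<fst V'} <+> {..<fst W'}) (fam_sum (coef V') (coef W'))"
    using assms by (intro fam_iso_sum) (simp_all add: rep_iso_iff_fam_iso)
  then show ?thesis
    using assms fam_iso_trans[OF fam_iso_trans[OF fam_iso_direct_sum[of G V W]] fam_iso_sym[OF fam_iso_direct_sum[of G V' W']]]
    by (simp add: rep_iso_iff_fam_iso is_rep_direct_sum)
qed

lemma rep_iso_direct_sum_commute:
  assumes "monoid G" "is_rep G V" "is_rep G W"
  shows "rep_iso G (direct_sum V W) (direct_sum W V)"
proof -
  have "fam_iso G ({..<fst V} <+> {..<fst W}) (fam_sum (coef V) (coef W)) ({..<fst W} <+> {..<fst V}) (fam_sum (coef W) (coef V))"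
    by (rule fam_iso_reindex[where h = "case_sum Inr Inl"]) (auto simp: bij_betw_def inj_on_def image_iff, force+)
  then show ?thesis
    using assms fam_iso_trans[OF fam_iso_trans[OF fam_iso_direct_sum[of G V W]] fam_iso_sym[OF fam_iso_direct_sum[of G W V]]]
    by (simp add: rep_iso_iff_fam_iso is_rep_direct_sum)
qed

lemma rep_iso_direct_sum_assoc:
  assumes "monoid G" "is_rep G U" "is_rep G V" "is_rep G W"
  shows "rep_iso G (direct_sum (direct_sum U V) W) (direct_sum U (direct_sum V W))"
proof -
  let ?u = "{..<fst U}" and ?v = "{..<fst V}" and ?w = "{..<fst W}"
  let ?U = "coef U" and ?V = "coef V" and ?W = "coef W"
  have reps: "is_rep G (direct_sum U V)" "is_rep G (direct_sum V W)"
    using assms by (auto intro: is_rep_direct_sum)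
  have "fam_iso G {..<fst U + fst V + fst W} (coef (direct_sum (direct_sum U V) W))
      ({..<fst U + fst V} <+> ?w) (fam_sum (coef (direct_sum U V)) ?W)"
    using fam_iso_direct_sum[OF reps(1) assms(4)] by simp
  moreover have "fam_iso G ({..<fst U + fst V} <+> ?w) (fam_sum (coef (direct_sum U V)) ?W)
      ((?u <+> ?v) <+> ?w) (fam_sum (fam_sum ?U ?V) ?W)"
    using assms by (intro fam_iso_sum fam_iso_direct_sum fam_iso_refl) auto
  moreover have "fam_iso G ((?u <+> ?v) <+> ?w) (fam_sum (fam_sum ?U ?V) ?W) (?u <+> (?v <+> ?w)) (fam_sum ?U (fam_sum ?V ?W))"
    by (rule fam_iso_reindex[where h = "case_sum (case_sum Inl (Inr \<circ> Inl)) (Inr \<circ> Inr)"])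
      (auto simp: bij_betw_def inj_on_def image_iff, force+)
  moreover have "fam_iso G (?u <+> (?v <+> ?w)) (fam_sum ?U (fam_sum ?V ?W))
      (?u <+> {..<fst V + fst W}) (fam_sum ?U (coef (direct_sum V W)))"
    using assms by (intro fam_iso_sum fam_iso_direct_sum[THEN fam_iso_sym] fam_iso_refl) auto
  moreover have "fam_iso G (?u <+> {..<fst V + fst W}) (fam_sum ?U (coef (direct_sum V W)))
      {..<fst U + fst V + fst W} (coef (direct_sum U (direct_sum V W)))"
    using fam_iso_sym[OF fam_iso_direct_sum[OF assms(2) reps(2)]] by (simp add: add.assoc)
  ultimately show ?thesis
    using assms(1) reps assms(2,4)
    by (simp add: rep_iso_iff_fam_iso is_rep_direct_sum add.assoc) (blast intro: fam_iso_trans)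
qed

section \<open>The commutative monoid of isomorphism classes and its Grothendieck group\<close>

definition iso_class :: "('g, 'm) monoid_scheme \<Rightarrow> 'g rep \<Rightarrow> 'g rep set" where
  "iso_class G V = {W. is_rep G W \<and> rep_iso G V W}"

text \<open>Iso classes are added as sets of representations, which makes addition associative and commutative
  on the nose and so accessible to rewriting.\<close>

definition iso_add :: "('g, 'm) monoid_scheme \<Rightarrow> 'g rep set \<Rightarrow> 'g rep set \<Rightarrow> 'g rep set" where
  "iso_add G A B = {X. is_rep G X \<and> (\<exists>V\<in>A. \<exists>W\<in>B. is_rep G V \<and> is_rep G W \<and> rep_iso G (direct_sum V W) X)}"

lemma iso_class_eq_iff:
  "is_rep G V \<Longrightarrow> is_rep G W \<Longrightarrow> iso_class G V = iso_class G W \<longleftrightarrow> rep_iso G V W"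
  unfolding iso_class_def by (blast intro: rep_iso_refl rep_iso_sym rep_iso_trans)

lemma iso_class_direct_sum:
  assumes "monoid G" "is_rep G V" "is_rep G W"
  shows "iso_class G (direct_sum V W) = iso_add G (iso_class G V) (iso_class G W)"
proof (intro equalityI subsetI)
  fix X assume "X \<in> iso_class G (direct_sum V W)"
  then show "X \<in> iso_add G (iso_class G V) (iso_class G W)"
    using assms rep_iso_refl unfolding iso_class_def iso_add_def by blast
next
  note ds = is_rep_direct_sum[OF assms(1)]
  fix X assume "X \<in> iso_add G (iso_class G V) (iso_class G W)"
  then obtain V' W' where r: "is_rep G X" "is_rep G V'" "is_rep G W'"
    and i: "rep_iso G V V'" "rep_iso G W W'" "rep_iso G (direct_sum V' W') X"
    by (auto simp: iso_add_def iso_class_def)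
  have "rep_iso G (direct_sum V W) (direct_sum V' W')"
    using assms r i by (intro rep_iso_direct_sum_cong)
  then show "X \<in> iso_class G (direct_sum V W)"
    using rep_iso_trans[OF ds ds _ _ i(3)] assms r by (simp add: iso_class_def)
qed

lemma iso_add_commute:
  assumes "monoid G"
  shows "iso_add G A B = iso_add G B A"
proof -
  have "iso_add G A B \<subseteq> iso_add G B A" for A B
  proof
    note ds = is_rep_direct_sum[OF assms]
    fix X assume "X \<in> iso_add G A B"
    then obtain V W where r: "is_rep G X" "is_rep G V" "is_rep G W" "V \<in> A" "W \<in> B"
      and i: "rep_iso G (direct_sum V W) X"
      by (auto simp: iso_add_def)
    have "rep_iso G (direct_sum W V) X"
      using rep_iso_trans[OF ds ds _ rep_iso_direct_sum_commute i] assms r by simp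
    then show "X \<in> iso_add G B A" using r by (auto simp: iso_add_def)
  qed
  then show ?thesis by blast
qed

lemma iso_add_assoc:
  assumes "monoid G"
  shows "iso_add G (iso_add G A B) C = iso_add G A (iso_add G B C)"
proof -
  note ds = is_rep_direct_sum[OF assms]
  have sub: "iso_add G (iso_add G A B) C \<subseteq> iso_add G A (iso_add G B C)" for A B C
  proof
    fix X assume "X \<in> iso_add G (iso_add G A B) C"
    then obtain Y W U V where X: "is_rep G X" "rep_iso G (direct_sum Y W) X"
      and Y: "is_rep G Y" "rep_iso G (direct_sum U V) Y"
      and r: "is_rep G U" "is_rep G V" "is_rep G W" "U \<in> A" "V \<in> B" "W \<in> C"
      by (auto simp: iso_add_def)
    have "rep_iso G (direct_sum (direct_sum U V) W) (direct_sum Y W)"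
      using r Y assms by (intro rep_iso_direct_sum_cong rep_iso_refl ds)
    then have "rep_iso G (direct_sum (direct_sum U V) W) X"
      using rep_iso_trans[OF _ _ X(1) _ X(2)] ds r Y(1) by simp
    then have "rep_iso G (direct_sum U (direct_sum V W)) X"
      using rep_iso_trans[OF _ _ X(1) rep_iso_sym[OF _ _ rep_iso_direct_sum_assoc[OF assms]]] ds r by simp
    moreover have "direct_sum V W \<in> iso_add G B C"
      using r ds[OF r(2,3)] rep_iso_refl unfolding iso_add_def by blast
    ultimately show "X \<in> iso_add G A (iso_add G B C)"
      using r X(1) ds[OF r(2,3)] unfolding iso_add_def[of G A] by blast
  qed
  from sub[of A B C] sub[of C B A] show ?thesis
    by (metis assms iso_add_commute subset_antisym)
qed

lemma iso_add_left_commute: "monoid G \<Longrightarrow> iso_add G A (iso_add G B C) = iso_add G B (iso_add G A C)"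
  by (metis iso_add_assoc iso_add_commute)

lemmas iso_add_ac = iso_add_assoc iso_add_commute iso_add_left_commute

text \<open>Turns the relation into an equation between isomorphism classes, where rewriting with
  \<open>iso_add_ac\<close> replaces explicit chains of isomorphisms.\<close>

lemma groth_rel_iff:
  assumes "monoid G"
  shows "((V, W), (V', W')) \<in> groth_rel G \<longleftrightarrow>
    is_rep G V \<and> is_rep G W \<and> is_rep G V' \<and> is_rep G W' \<and>
    (\<exists>U. is_rep G U \<and> iso_add G (iso_add G (iso_class G V) (iso_class G W')) (iso_class G U) =
       iso_add G (iso_add G (iso_class G V') (iso_class G W)) (iso_class G U))"
  using assms
  by (simp add: groth_rel_def rep_pairs_def iso_class_direct_sum[symmetric] is_rep_direct_sum iso_class_eq_iff
      conj_assoc del: split_paired_Ex cong: conj_cong)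

lemma groth_relI:
  assumes "monoid G" "is_rep G V" "is_rep G W" "is_rep G V'" "is_rep G W'"
    and "iso_add G (iso_class G V) (iso_class G W') = iso_add G (iso_class G V') (iso_class G W)"
  shows "((V, W), (V', W')) \<in> groth_rel G"
  unfolding groth_rel_iff[OF assms(1)] using assms(2-)
  by (intro conjI exI[of _ zero_rep]) simp_all

lemma equiv_groth_rel:
  assumes "monoid G"
  shows "equiv (rep_pairs G) (groth_rel G)"
proof (rule equivI)
  show "groth_rel G \<subseteq> rep_pairs G \<times> rep_pairs G" by (auto simp: groth_rel_def)
  show "refl_on (rep_pairs G) (groth_rel G)"
    using assms by (auto simp: refl_on_def rep_pairs_def intro: groth_relI)
  show "sym (groth_rel G)"
    by (rule symI, clarify, unfold groth_rel_iff[OF assms]) metis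
  show "trans (groth_rel G)"
  proof (rule transI)
    fix x y z assume "(x, y) \<in> groth_rel G" "(y, z) \<in> groth_rel G"
    moreover obtain V W V' W' V'' W'' where xyz: "x = (V, W)" "y = (V', W')" "z = (V'', W'')"
      by (metis surj_pair)
    ultimately obtain U U' where r: "is_rep G V" "is_rep G W" "is_rep G V'" "is_rep G W'" "is_rep G V''" "is_rep G W''"
        "is_rep G U" "is_rep G U'"
      and e: "iso_add G (iso_add G (iso_class G V) (iso_class G W')) (iso_class G U) =
         iso_add G (iso_add G (iso_class G V') (iso_class G W)) (iso_class G U)"
         "iso_add G (iso_add G (iso_class G V') (iso_class G W'')) (iso_class G U') =
         iso_add G (iso_add G (iso_class G V'') (iso_class G W')) (iso_class G U')"
      unfolding xyz groth_rel_iff[OF assms] by blast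
    \<comment> \<open>Adding the two equations leaves \<open>V'\<close> and \<open>W'\<close> on
      both sides besides \<open>U\<close> and \<open>U'\<close>; all four go into the stabilising
      summand.\<close>
    let ?X = "direct_sum (direct_sum V' W') (direct_sum U U')"
    have "is_rep G ?X" using r assms by (simp add: is_rep_direct_sum)
    moreover have "iso_add G (iso_add G (iso_class G V) (iso_class G W'')) (iso_class G ?X) =
         iso_add G (iso_add G (iso_class G V'') (iso_class G W)) (iso_class G ?X)"
      using arg_cong2[OF e, of "iso_add G"] assms r
      by (simp add: iso_class_direct_sum is_rep_direct_sum iso_add_ac)
    ultimately show "(x, z) \<in> groth_rel G"
      unfolding xyz groth_rel_iff[OF assms] using r by blast
  qed
qed

lemma virtual_eq_iff:
  assumes "monoid G" "is_rep G V" "is_rep G W" "is_rep G V'" "is_rep G W'"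
  shows "virtual G V W = virtual G V' W' \<longleftrightarrow> ((V, W), (V', W')) \<in> groth_rel G"
  using eq_equiv_class_iff[OF equiv_groth_rel[OF assms(1)]] assms(2-)
  by (simp add: virtual_def rep_pairs_def)

lemma iso_class_zero: "is_rep G V \<Longrightarrow> fst V = 0 \<Longrightarrow> iso_class G V = iso_class G zero_rep"
  by (simp add: iso_class_eq_iff rep_iso_dim_zero zero_rep_def[THEN arg_cong[where f=fst], simplified])

lemma iso_add_zero:
  assumes "monoid G" "is_rep G V"
  shows "iso_add G (iso_class G V) (iso_class G zero_rep) = iso_class G V"
proof -
  have "fam_iso G {..<fst (direct_sum V zero_rep)} (coef (direct_sum V zero_rep)) {..<fst V} (coef V)"
    using assms(2) fam_direct_sum(2)[OF assms(2) is_rep_zero]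
    by (intro fam_iso_reindex[where h = id]) (auto simp: zero_rep_def)
  then show ?thesis
    using assms by (simp add: iso_class_direct_sum[symmetric] is_rep_direct_sum iso_class_eq_iff rep_iso_iff_fam_iso)
qed

lemma virtual_add:
  assumes "monoid G" "is_rep G V" "is_rep G W" "is_rep G V'" "is_rep G W'"
  shows "virtual G V W \<oplus>\<^bsub>rep_ring G\<^esub> virtual G V' W' = virtual G (direct_sum V V') (direct_sum W W')"
proof -
  note equiv = equiv_groth_rel[OF assms(1)]
  have "congruent2 (groth_rel G) (groth_rel G)
     (\<lambda>x y. case x of (V, W) \<Rightarrow> case y of (V', W') \<Rightarrow> virtual G (direct_sum V V') (direct_sum W W'))"
  \<comment> \<open>Direct sum is commutative up to isomorphism, so it suffices to vary the second
    argument.\<close>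
  proof (rule congruent2_commuteI[OF equiv])
    fix x y assume "x \<in> rep_pairs G" "y \<in> rep_pairs G"
    then show "(case x of (V, W) \<Rightarrow> case y of (V', W') \<Rightarrow> virtual G (direct_sum V V') (direct_sum W W')) =
       (case y of (V, W) \<Rightarrow> case x of (V', W') \<Rightarrow> virtual G (direct_sum V V') (direct_sum W W'))"
      using assms(1) by (clarsimp simp: rep_pairs_def virtual_eq_iff is_rep_direct_sum)
        (simp add: is_rep_direct_sum iso_class_direct_sum iso_add_ac groth_relI)
  next
    fix x y z assume "z \<in> rep_pairs G" "(x, y) \<in> groth_rel G"
    then show "(case z of (V, W) \<Rightarrow> case x of (V', W') \<Rightarrow> virtual G (direct_sum V V') (direct_sum W W')) =
       (case z of (V, W) \<Rightarrow> case y of (V', W') \<Rightarrow> virtual G (direct_sum V V') (direct_sum W W'))"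
    proof (clarsimp split: prod.splits simp: rep_pairs_def)
      fix A B V W V' W' assume r: "is_rep G A" "is_rep G B" and xy: "((V, W), (V', W')) \<in> groth_rel G"
      then obtain U where U: "is_rep G U" "is_rep G V" "is_rep G W" "is_rep G V'" "is_rep G W'" "iso_add G (iso_add G (iso_class G V) (iso_class G W')) (iso_class G U) =
         iso_add G (iso_add G (iso_class G V') (iso_class G W)) (iso_class G U)"
        unfolding groth_rel_iff[OF assms(1)] by blast
      have e: "iso_add G (iso_add G (iso_class G (direct_sum A V)) (iso_class G (direct_sum B W'))) (iso_class G U) =
          iso_add G (iso_add G (iso_class G (direct_sum A V')) (iso_class G (direct_sum B W))) (iso_class G U)"
        using U(1-5) r assms(1) arg_cong[OF U(6), of "iso_add G (iso_add G (iso_class G A) (iso_class G B))"]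
        by (simp add: is_rep_direct_sum iso_class_direct_sum iso_add_ac)
      show "virtual G (direct_sum A V) (direct_sum B W) = virtual G (direct_sum A V') (direct_sum B W')"
      proof -
        note reps = is_rep_direct_sum[OF assms(1) r(1) U(2)] is_rep_direct_sum[OF assms(1) r(2) U(3)]
          is_rep_direct_sum[OF assms(1) r(1) U(4)] is_rep_direct_sum[OF assms(1) r(2) U(5)]
        have "((direct_sum A V, direct_sum B W), (direct_sum A V', direct_sum B W')) \<in> groth_rel G"
          unfolding groth_rel_iff[OF assms(1)] by (intro conjI exI[of _ U] reps U(1) e)
        then show ?thesis using virtual_eq_iff[OF assms(1) reps] by simp
      qed
    qed
  qed
  from UN_equiv_class2[OF equiv equiv this, of "(V, W)" "(V', W')"] assms show ?thesis
    by (simp add: rep_ring_def virtual_def rep_pairs_def case_prod_unfold)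
qed

lemma virtual_closed: "is_rep G V \<Longrightarrow> is_rep G W \<Longrightarrow> virtual G V W \<in> carrier (rep_ring G)"
  by (auto simp: rep_ring_def virtual_def rep_pairs_def intro: quotientI)

lemma rep_class_closed: "is_rep G V \<Longrightarrow> rep_class G V \<in> carrier (rep_ring G)"
  by (simp add: rep_class_def virtual_closed)

lemma rep_class_cong:
  "monoid G \<Longrightarrow> is_rep G V \<Longrightarrow> is_rep G W \<Longrightarrow> rep_iso G V W \<Longrightarrow> rep_class G V = rep_class G W"
  by (simp add: rep_class_def virtual_eq_iff groth_relI iso_class_eq_iff[symmetric])

lemma rep_class_direct_sum:
  assumes "monoid G" "is_rep G V" "is_rep G W"
  shows "rep_class G (direct_sum V W) = rep_class G V \<oplus>\<^bsub>rep_ring G\<^esub> rep_class G W"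
  using assms
  by (simp add: rep_class_def virtual_add virtual_eq_iff groth_relI is_rep_direct_sum iso_class_direct_sum iso_add_zero)

section \<open>Additive functors on representations\<close>

text \<open>Such an \<open>F\<close> is additive on isomorphism classes, so it carries an equation
  stabilised by \<open>U\<close> to one stabilised by \<open>F U\<close>.\<close>

lemma groth_rel_functor:
  assumes "monoid H" "monoid G"
    and rep: "\<And>V. is_rep H V \<Longrightarrow> is_rep G (F V)"
    and iso: "\<And>V W. is_rep H V \<Longrightarrow> is_rep H W \<Longrightarrow> rep_iso H V W \<Longrightarrow> rep_iso G (F V) (F W)"
    and sum: "\<And>V W. is_rep H V \<Longrightarrow> is_rep H W \<Longrightarrow> rep_iso G (F (direct_sum V W)) (direct_sum (F V) (F W))"
    and rel: "((V, W), (V', W')) \<in> groth_rel H"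
  shows "((F V, F W), (F V', F W')) \<in> groth_rel G"
proof -
  note ds = is_rep_direct_sum[OF assms(1)]
  obtain U where r: "is_rep H V" "is_rep H W" "is_rep H V'" "is_rep H W'" "is_rep H U"
    and i: "rep_iso H (direct_sum (direct_sum V W') U) (direct_sum (direct_sum V' W) U)"
    using rel by (auto simp: groth_rel_def rep_pairs_def)
  have add: "iso_class G (F (direct_sum A B)) = iso_add G (iso_class G (F A)) (iso_class G (F B))"
    if "is_rep H A" "is_rep H B" for A B
    using that assms(2) rep ds
    by (simp add: iso_class_direct_sum[symmetric] iso_class_eq_iff is_rep_direct_sum sum)
  have "iso_class G (F (direct_sum (direct_sum V W') U)) = iso_class G (F (direct_sum (direct_sum V' W) U))"
    using iso[OF ds[OF ds] ds[OF ds] i] r rep ds by (simp add: iso_class_eq_iff)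
  then have "iso_add G (iso_add G (iso_class G (F V)) (iso_class G (F W'))) (iso_class G (F U)) =
      iso_add G (iso_add G (iso_class G (F V')) (iso_class G (F W))) (iso_class G (F U))"
    using r ds by (simp add: add)
  then show ?thesis
    unfolding groth_rel_iff[OF assms(2)] by (intro conjI exI[of _ "F U"] rep r)
qed

text \<open>By \<open>groth_rel_functor\<close> the union runs over equal sets and collapses to one
  of them. This serves both for pullback and for induction.\<close>

lemma UN_virtual_functor:
  assumes "monoid H" "monoid G" "is_rep H V" "is_rep H W"
    and rep: "\<And>V. is_rep H V \<Longrightarrow> is_rep G (F V)"
    and iso: "\<And>V W. is_rep H V \<Longrightarrow> is_rep H W \<Longrightarrow> rep_iso H V W \<Longrightarrow> rep_iso G (F V) (F W)"
    and sum: "\<And>V W. is_rep H V \<Longrightarrow> is_rep H W \<Longrightarrow> rep_iso G (F (direct_sum V W)) (direct_sum (F V) (F W))"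
  shows "(\<Union>(V, W)\<in>virtual H V W. virtual G (F V) (F W)) = virtual G (F V) (F W)"
proof -
  have "congruent (groth_rel H) (\<lambda>x. case x of (V, W) \<Rightarrow> virtual G (F V) (F W))"
  proof (rule congruentI, clarify)
    fix V W V' W' assume rel: "((V, W), (V', W')) \<in> groth_rel H"
    have "((F V, F W), (F V', F W')) \<in> groth_rel G"
      by (rule groth_rel_functor[OF assms(1,2) rep iso sum rel])
    with rel rep show "virtual G (F V) (F W) = virtual G (F V') (F W')"
      by (subst virtual_eq_iff[OF assms(2)]) (auto simp: groth_rel_def rep_pairs_def)
  qed
  from UN_equiv_class[OF equiv_groth_rel[OF assms(1)] this, of "(V, W)"] assms(3,4)
  show ?thesis by (simp add: virtual_def rep_pairs_def)
qed

section \<open>Pullback of representations\<close>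

lemma is_rep_pullback:
  assumes "f \<in> hom H G" "f \<one>\<^bsub>H\<^esub> = \<one>\<^bsub>G\<^esub>" "is_rep G V"
  shows "is_rep H (pullback f V)"
  using assms by (auto simp: is_rep_def pullback_def hom_def Pi_iff)

lemma rep_ring_pullback_virtual:
  assumes "monoid H" "monoid G" "f \<in> hom H G" "f \<one>\<^bsub>H\<^esub> = \<one>\<^bsub>G\<^esub>" "is_rep G V" "is_rep G W"
  shows "rep_ring_pullback H f (virtual G V W) = virtual H (pullback f V) (pullback f W)"
  unfolding rep_ring_pullback_def
proof (rule UN_virtual_functor[OF assms(2,1,5,6)])
  fix V W assume r: "is_rep G V" "is_rep G W"
  show "rep_iso H (pullback f V) (pullback f W)" if "rep_iso G V W"
    using that assms(3) by (auto simp: rep_iso_def pullback_def hom_def Pi_iff)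
  have "pullback f (direct_sum V W) = direct_sum (pullback f V) (pullback f W)"
    by (simp add: pullback_def direct_sum_def)
  then show "rep_iso H (pullback f (direct_sum V W)) (direct_sum (pullback f V) (pullback f W))"
    using r assms by (simp add: rep_iso_refl is_rep_direct_sum is_rep_pullback)
qed (rule is_rep_pullback[OF assms(3,4)])

text \<open>The common form of the matrices of tensor products and of induced representations.\<close>

definition twisted :: "nat \<Rightarrow> ('g \<Rightarrow> nat \<Rightarrow> nat \<Rightarrow> complex) \<Rightarrow> ('g \<Rightarrow> nat \<Rightarrow> nat \<Rightarrow> 'h) \<Rightarrow> 'h rep \<Rightarrow> 'g rep" where
  "twisted L w \<theta> V = (L * fst V, \<lambda>g. mat (L * fst V) (L * fst V) (\<lambda>(a, b).
     w g (a div fst V) (b div fst V) *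
     coef V (\<theta> g (a div fst V) (b div fst V)) (a mod fst V) (b mod fst V)))"

lemma fst_twisted [simp]: "fst (twisted L w \<theta> V) = L * fst V"
  by (simp add: twisted_def)

lemma coef_twisted:
  "a < L * fst V \<Longrightarrow> b < L * fst V \<Longrightarrow> coef (twisted L w \<theta> V) g a b =
     twist w \<theta> (coef V) g (a div fst V, a mod fst V) (b div fst V, b mod fst V)"
  by (simp add: twisted_def twist_def)

text \<open>The numbering \<open>p * n + i\<close> of pairs is the one used by both
  \<open>tensor\<close> and \<open>induced\<close>; for \<open>n = 0\<close> both index sets are
  empty.\<close>

lemma bij_betw_divmod:
  "bij_betw (\<lambda>a. (a div n, a mod n)) {..<L * n} ({..<L} \<times> {..<n::nat})"
proof (cases "n = 0")
  case False
  show ?thesis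
  proof (rule bij_betw_byWitness[where f' = "\<lambda>(p, i). p * n + i"])
    show "(\<lambda>(p, i). p * n + i) ` ({..<L} \<times> {..<n}) \<subseteq> {..<L * n}"
    proof clarsimp
      fix p i assume "p < L" "i < n"
      then have "p * n + i < Suc p * n" "Suc p * n \<le> L * n" using mult_le_mono1[of "Suc p" L n] by auto
      then show "p * n + i < L * n" by linarith
    qed
  qed (use False in \<open>auto simp: less_mult_imp_div_less\<close>)
qed (simp add: bij_betw_def)

lemma fam_iso_twisted:
  "fam_iso G {..<L * fst V} (coef (twisted L w \<theta> V)) ({..<L} \<times> {..<fst V}) (twist w \<theta> (coef V))"
  by (rule fam_iso_reindex[OF _ bij_betw_divmod]) (auto simp: coef_twisted)

lemma is_rep_twisted:
  assumes "monoid H" "monoid G" "twisting H G {..<L} w \<theta>" "is_rep H V"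
  shows "is_rep G (twisted L w \<theta> V)"
proof -
  have "fam_rep G {..<L * fst V} (coef (twisted L w \<theta> V))"
    by (rule fam_rep_reindex[OF bij_betw_divmod fam_rep_twist assms(2)])
      (use assms in \<open>auto simp: coef_twisted is_rep_iff_fam_rep\<close>)
  then show ?thesis
    using assms(2) by (simp add: is_rep_iff_fam_rep) (simp add: twisted_def)
qed

lemma rep_iso_twisted_cong:
  assumes "monoid H" "monoid G" "twisting H G {..<L} w \<theta>" "is_rep H V" "is_rep H W" "rep_iso H V W"
  shows "rep_iso G (twisted L w \<theta> V) (twisted L w \<theta> W)"
proof -
  have "fam_iso G ({..<L} \<times> {..<fst V}) (twist w \<theta> (coef V)) ({..<L} \<times> {..<fst W}) (twist w \<theta> (coef W))"
    using assms by (intro fam_iso_twist) (simp_all add: rep_iso_iff_fam_iso)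
  from fam_iso_trans[OF fam_iso_trans[OF fam_iso_twisted this] fam_iso_sym[OF fam_iso_twisted]]
  show ?thesis using assms by (simp add: rep_iso_iff_fam_iso is_rep_twisted)
qed

lemma rep_iso_twisted_direct_sum:
  assumes "monoid H" "monoid G" "twisting H G {..<L} w \<theta>" "is_rep H V" "is_rep H W"
  shows "rep_iso G (twisted L w \<theta> (direct_sum V W)) (direct_sum (twisted L w \<theta> V) (twisted L w \<theta> W))"
proof -
  let ?D = "{..<L}" and ?v = "{..<fst V}" and ?w = "{..<fst W}"
  note rt = is_rep_twisted[OF assms(1,2,3)]
  have "fam_iso G {..<L * (fst V + fst W)} (coef (twisted L w \<theta> (direct_sum V W)))
      (?D \<times> {..<fst V + fst W}) (twist w \<theta> (coef (direct_sum V W)))"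
    using fam_iso_twisted[of G L "direct_sum V W"] by simp
  moreover have "fam_iso G (?D \<times> {..<fst V + fst W}) (twist w \<theta> (coef (direct_sum V W)))
      (?D \<times> (?v <+> ?w)) (twist w \<theta> (fam_sum (coef V) (coef W)))"
    by (rule fam_iso_twist[OF assms(3) fam_iso_direct_sum[OF assms(4,5)]])
  moreover have "fam_iso G (?D \<times> (?v <+> ?w)) (twist w \<theta> (fam_sum (coef V) (coef W)))
      (?D \<times> ?v <+> ?D \<times> ?w) (fam_sum (twist w \<theta> (coef V)) (twist w \<theta> (coef W)))"
    by (rule fam_iso_twist_sum) auto
  moreover have "fam_iso G (?D \<times> ?v <+> ?D \<times> ?w) (fam_sum (twist w \<theta> (coef V)) (twist w \<theta> (coef W)))
      ({..<L * fst V} <+> {..<L * fst W}) (fam_sum (coef (twisted L w \<theta> V)) (coef (twisted L w \<theta> W)))"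
    by (intro fam_iso_sum fam_iso_sym[OF fam_iso_twisted])
  moreover have "fam_iso G ({..<L * fst V} <+> {..<L * fst W}) (fam_sum (coef (twisted L w \<theta> V)) (coef (twisted L w \<theta> W)))
      {..<L * (fst V + fst W)} (coef (direct_sum (twisted L w \<theta> V) (twisted L w \<theta> W)))"
    using fam_iso_sym[OF fam_iso_direct_sum[OF rt[OF assms(4)] rt[OF assms(5)]]]
    by (simp add: distrib_left)
  ultimately have "fam_iso G {..<L * (fst V + fst W)} (coef (twisted L w \<theta> (direct_sum V W)))
      {..<L * (fst V + fst W)} (coef (direct_sum (twisted L w \<theta> V) (twisted L w \<theta> W)))"
    by (blast intro: fam_iso_trans)
  then show ?thesis
    using assms by (simp add: rep_iso_iff_fam_iso is_rep_twisted is_rep_direct_sum distrib_left)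
qed

section \<open>Tensor products and the multiplication of the representation ring\<close>

lemma tensor_eq_twisted: "tensor V W = twisted (fst V) (coef V) (\<lambda>g _ _. g) W"
  by (simp add: tensor_def twisted_def)

lemma twisting_coef:
  assumes "monoid G" "is_rep G V"
  shows "twisting G G {..<fst V} (coef V) (\<lambda>g _ _. g)"
  using assms by (simp add: twisting_def is_rep_iff_fam_rep)

lemma is_rep_tensor: "monoid G \<Longrightarrow> is_rep G V \<Longrightarrow> is_rep G W \<Longrightarrow> is_rep G (tensor V W)"
  by (simp add: tensor_eq_twisted is_rep_twisted twisting_coef)

lemma rep_iso_tensor_commute:
  assumes "monoid G" "is_rep G V" "is_rep G W"
  shows "rep_iso G (tensor V W) (tensor W V)"
proof -
  have "fam_iso G ({..<fst V} \<times> {..<fst W}) (twist (coef V) (\<lambda>g _ _. g) (coef W))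
      ({..<fst W} \<times> {..<fst V}) (twist (coef W) (\<lambda>g _ _. g) (coef V))"
    by (rule fam_iso_reindex[where h = prod.swap]) (auto simp: twist_def bij_betw_def inj_on_def)
  from fam_iso_trans[OF fam_iso_trans[OF fam_iso_twisted this] fam_iso_sym[OF fam_iso_twisted]]
  show ?thesis using assms is_rep_tensor[of G V W] is_rep_tensor[of G W V]
    by (simp add: rep_iso_iff_fam_iso tensor_eq_twisted)
qed

lemma groth_rel_tensor:
  assumes "monoid G" "is_rep G A" "((V, W), (V', W')) \<in> groth_rel G"
  shows "((tensor A V, tensor A W), (tensor A V', tensor A W')) \<in> groth_rel G"
proof -
  note tw = twisting_coef[OF assms(1,2)]
  show ?thesis
    unfolding tensor_eq_twisted
    by (rule groth_rel_functor[OF assms(1,1) _ _ _ assms(3)])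
      (simp_all add: is_rep_twisted[OF _ _ tw] rep_iso_twisted_cong[OF _ _ tw] rep_iso_twisted_direct_sum[OF _ _ tw] assms(1))
qed

lemma groth_rel_add:
  assumes "monoid G" "((V, W), (V', W')) \<in> groth_rel G" "((A, B), (A', B')) \<in> groth_rel G"
  shows "((direct_sum V A, direct_sum W B), (direct_sum V' A', direct_sum W' B')) \<in> groth_rel G"
proof -
  note ds = is_rep_direct_sum[OF assms(1)]
  have r: "is_rep G V" "is_rep G W" "is_rep G V'" "is_rep G W'" "is_rep G A" "is_rep G B" "is_rep G A'" "is_rep G B'"
    using assms(2,3) unfolding groth_rel_iff[OF assms(1)] by auto
  have "virtual G V W = virtual G V' W'" "virtual G A B = virtual G A' B'"
    using assms r virtual_eq_iff by blast+
  then have "virtual G (direct_sum V A) (direct_sum W B) = virtual G (direct_sum V' A') (direct_sum W' B')"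
    using assms(1) r by (simp add: virtual_add[symmetric])
  then show ?thesis
    using virtual_eq_iff[OF assms(1) ds[OF r(1,5)] ds[OF r(2,6)] ds[OF r(3,7)] ds[OF r(4,8)]] by simp
qed

text \<open>Negation of formal differences. It is wanted because in \<open>(A - B)(V - W)\<close>
  the factor \<open>B\<close> meets \<open>V\<close> and \<open>W\<close> with exchanged
  signs.\<close>

lemma groth_rel_swap:
  assumes "monoid G" "((V, W), (V', W')) \<in> groth_rel G"
  shows "((W, V), (W', V')) \<in> groth_rel G"
proof -
  from assms(2) obtain U where "is_rep G V" "is_rep G W" "is_rep G V'" "is_rep G W'" "is_rep G U"
    and "iso_add G (iso_add G (iso_class G V) (iso_class G W')) (iso_class G U) =
       iso_add G (iso_add G (iso_class G V') (iso_class G W)) (iso_class G U)"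
    unfolding groth_rel_iff[OF assms(1)] by blast
  then show ?thesis
    unfolding groth_rel_iff[OF assms(1)]
    by (intro conjI exI[of _ U]) (simp_all add: iso_add_commute[OF assms(1), of "iso_class G W"]
        iso_add_commute[OF assms(1), of "iso_class G W'"])
qed

text \<open>The tensor product is commutative up to isomorphism, so only the second factor has to
  vary. With \<open>(A, B)\<close> fixed, the product with \<open>(V, W)\<close> is \<open>A\<close>
  times \<open>(V, W)\<close> plus \<open>B\<close> times \<open>(W, V)\<close>, and each part
  respects the relation by \<open>groth_rel_tensor\<close>.\<close>

lemma virtual_mult:
  assumes "monoid G" "is_rep G V" "is_rep G W" "is_rep G V'" "is_rep G W'"
  shows "virtual G V W \<otimes>\<^bsub>rep_ring G\<^esub> virtual G V' W' =
    virtual G (direct_sum (tensor V V') (tensor W W')) (direct_sum (tensor V W') (tensor W V'))"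
proof -
  note equiv = equiv_groth_rel[OF assms(1)]
  note ds = is_rep_direct_sum[OF assms(1)] and ts = is_rep_tensor[OF assms(1)]
  let ?f = "\<lambda>x y. case x of (V, W) \<Rightarrow> case y of (V', W') \<Rightarrow>
     virtual G (direct_sum (tensor V V') (tensor W W')) (direct_sum (tensor V W') (tensor W V'))"
  have "congruent2 (groth_rel G) (groth_rel G) ?f"
  proof (rule congruent2_commuteI[OF equiv])
    fix x y assume "x \<in> rep_pairs G" "y \<in> rep_pairs G"
    moreover obtain V W V' W' where xy: "x = (V, W)" "y = (V', W')" by (metis surj_pair)
    ultimately have r: "is_rep G V" "is_rep G W" "is_rep G V'" "is_rep G W'" by (auto simp: rep_pairs_def)
    have "iso_class G (tensor A B) = iso_class G (tensor B A)" if "is_rep G A" "is_rep G B" for A B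
      using that assms(1) by (simp add: iso_class_eq_iff is_rep_tensor rep_iso_tensor_commute)
    from this[OF r(1,3)] this[OF r(1,4)] this[OF r(2,3)] this[OF r(2,4)]
    show "?f x y = ?f y x"
      unfolding xy prod.case
      using virtual_eq_iff[OF assms(1) ds[OF ts[OF r(1,3)] ts[OF r(2,4)]] ds[OF ts[OF r(1,4)] ts[OF r(2,3)]]
          ds[OF ts[OF r(3,1)] ts[OF r(4,2)]] ds[OF ts[OF r(3,2)] ts[OF r(4,1)]]] r assms(1)
      by (simp add: groth_relI ds ts iso_class_direct_sum iso_add_ac)
  next
    fix x y z assume "z \<in> rep_pairs G" and rel: "(x, y) \<in> groth_rel G"
    moreover obtain V W V' W' A B where xyz: "x = (V, W)" "y = (V', W')" "z = (A, B)" by (metis surj_pair)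
    ultimately have r: "is_rep G V" "is_rep G W" "is_rep G V'" "is_rep G W'" "is_rep G A" "is_rep G B"
      by (auto simp: rep_pairs_def groth_rel_def)
    have "((tensor A V, tensor A W), (tensor A V', tensor A W')) \<in> groth_rel G"
      "((tensor B W, tensor B V), (tensor B W', tensor B V')) \<in> groth_rel G"
      using rel r groth_rel_swap[OF assms(1)] groth_rel_tensor[OF assms(1)] xyz by auto
    from groth_rel_add[OF assms(1) this]
    show "?f z x = ?f z y"
      unfolding xyz prod.case
      using virtual_eq_iff[OF assms(1) ds[OF ts[OF r(5,1)] ts[OF r(6,2)]] ds[OF ts[OF r(5,2)] ts[OF r(6,1)]]
          ds[OF ts[OF r(5,3)] ts[OF r(6,4)]] ds[OF ts[OF r(5,4)] ts[OF r(6,3)]]] by simp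
  qed
  from UN_equiv_class2[OF equiv equiv this, of "(V, W)" "(V', W')"] assms show ?thesis
    by (simp add: rep_ring_def virtual_def rep_pairs_def case_prod_unfold)
qed

text \<open>The three remaining terms of the product formula contain the factor
  \<open>zero_rep\<close> and have dimension 0.\<close>

lemma rep_class_mult:
  assumes "monoid G" "is_rep G V" "is_rep G W"
  shows "rep_class G V \<otimes>\<^bsub>rep_ring G\<^esub> rep_class G W = rep_class G (tensor V W)"
proof -
  note ts = is_rep_tensor[OF assms(1)]
  have [simp]: "fst (tensor A B) = fst A * fst B" for A B :: "'a rep" by (simp add: tensor_def)
  have zero: "iso_class G (tensor A B) = iso_class G zero_rep"
    if "fst A = 0 \<or> fst B = 0" "is_rep G A" "is_rep G B" for A B
    using that by (intro iso_class_zero ts) auto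
  have [simp]: "fst (zero_rep :: 'a rep) = 0" by (simp add: zero_rep_def)
  show ?thesis
    unfolding rep_class_def using assms
    by (simp add: virtual_mult virtual_eq_iff is_rep_direct_sum is_rep_tensor)
      (rule groth_relI, simp_all add: is_rep_direct_sum is_rep_tensor iso_class_direct_sum zero iso_add_zero)
qed

text \<open>Write \<open>t_p\<close> for \<open>ts ! p\<close>. By definition
  \<open>g t_q = t_p x\<close> with \<open>x = x g p q\<close>, and for given \<open>q\<close>
  exactly one \<open>p\<close> puts \<open>x\<close> into the subgroup, so \<open>w\<close> is the
  permutation matrix of \<open>g\<close> on the cosets. The cocycle rule is the telescoping of
  \<open>x g p q\<close> times \<open>x h q r\<close>, where \<open>t_q\<close> cancels.\<close>

lemma twisting_induced:
  assumes "group H" "group G" "f \<in> hom H G" "inj_on f (carrier H)" "left_transversal G (f ` carrier H) ts"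
  defines "x \<equiv> \<lambda>g p q. inv\<^bsub>G\<^esub> (ts ! p) \<otimes>\<^bsub>G\<^esub> g \<otimes>\<^bsub>G\<^esub> ts ! q"
  shows "twisting H G {..<length ts} (\<lambda>g p q. of_bool (x g p q \<in> f ` carrier H))
    (\<lambda>g p q. the_inv_into (carrier H) f (x g p q))"
proof -
  interpret H: group H by fact
  interpret G: group G by fact
  interpret f: group_hom H G f by unfold_locales fact
  let ?K = "f ` carrier H"
  interpret K: subgroup ?K G by (rule f.img_is_subgroup)
  have t: "ts ! p \<in> carrier G" if "p < length ts" for p
    using assms(5) that by (auto simp: left_transversal_def)
  have uniq: "\<exists>!k. k < length ts \<and> inv\<^bsub>G\<^esub> (ts ! k) \<otimes>\<^bsub>G\<^esub> g \<in> ?K" if "g \<in> carrier G" for g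
    using assms(5) that by (auto simp: left_transversal_def)
  have x_mult: "x (g \<otimes>\<^bsub>G\<^esub> h) p r = x g p q \<otimes>\<^bsub>G\<^esub> x h q r"
    if "g \<in> carrier G" "h \<in> carrier G" "p < length ts" "q < length ts" "r < length ts" for g h p q r
  proof -
    have "ts ! q \<otimes>\<^bsub>G\<^esub> (inv\<^bsub>G\<^esub> (ts ! q) \<otimes>\<^bsub>G\<^esub> (h \<otimes>\<^bsub>G\<^esub> ts ! r)) = h \<otimes>\<^bsub>G\<^esub> ts ! r"
      using t that by (subst G.m_assoc[symmetric]) auto
    then show ?thesis using t that by (simp add: x_def G.m_assoc)
  qed
  have x_closed: "x g p q \<in> carrier G" if "g \<in> carrier G" "p < length ts" "q < length ts" for g p q
    using t that by (simp add: x_def)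
  have inv_mult: "the_inv_into (carrier H) f (a \<otimes>\<^bsub>G\<^esub> b) = the_inv_into (carrier H) f a \<otimes>\<^bsub>H\<^esub> the_inv_into (carrier H) f b"
    if "a \<in> ?K" "b \<in> ?K" for a b
  proof -
    obtain u v where "u \<in> carrier H" "v \<in> carrier H" "a = f u" "b = f v" using \<open>a \<in> ?K\<close> \<open>b \<in> ?K\<close> by auto
    then show ?thesis
      using the_inv_into_f_f[OF assms(4)] f.hom_mult by (metis H.m_closed)
  qed
  have "fam_rep G {..<length ts} (\<lambda>g p q. of_bool (x g p q \<in> ?K))"
    unfolding fam_rep_def
  proof (intro conjI ballI)
    fix p q assume "p \<in> {..<length ts}" "q \<in> {..<length ts}"
    then have "x \<one>\<^bsub>G\<^esub> p q \<in> ?K \<longleftrightarrow> p = q"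
      using uniq[of "ts ! q"] t K.one_closed by (auto simp: x_def simp del: K.one_closed)
    then show "of_bool (x \<one>\<^bsub>G\<^esub> p q \<in> ?K) = of_bool (p = q)" by simp
  next
    fix g h p r assume gh: "g \<in> carrier G" "h \<in> carrier G" and pr: "p \<in> {..<length ts}" "r \<in> {..<length ts}"
    have "x h q r = inv\<^bsub>G\<^esub> (ts ! q) \<otimes>\<^bsub>G\<^esub> (h \<otimes>\<^bsub>G\<^esub> ts ! r)" if "q < length ts" for q
      using gh pr t that by (simp add: x_def G.m_assoc)
    then have "\<exists>!q. q < length ts \<and> x h q r \<in> ?K"
      using uniq[of "h \<otimes>\<^bsub>G\<^esub> ts ! r"] gh pr t by (simp cong: conj_cong)
    \<comment> \<open>The coset of \<open>ts ! s\<close> is the image under \<open>h\<close> of the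
      coset of \<open>ts ! r\<close>, so only the summand \<open>q = s\<close> survives in the
      matrix product.\<close>
    then obtain s where s: "s < length ts" "x h s r \<in> ?K"
      and s_unique: "\<And>q. q < length ts \<Longrightarrow> x h q r \<in> ?K \<Longrightarrow> q = s"
      by blast
    have "(\<Sum>q<length ts. of_bool (x g p q \<in> ?K) * of_bool (x h q r \<in> ?K)) =
        (\<Sum>q<length ts. if q = s then of_bool (x g p s \<in> ?K) else (0::complex))"
    proof (intro sum.cong refl)
      fix q assume "q \<in> {..<length ts}"
      then show "of_bool (x g p q \<in> ?K) * of_bool (x h q r \<in> ?K) =
          (if q = s then of_bool (x g p s \<in> ?K) else (0::complex))"
      proof (cases "q = s")
        case False
        then have "x h q r \<notin> ?K" using s_unique \<open>q \<in> {..<length ts}\<close> by blast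
        then show ?thesis using False by (simp only: of_bool_eq if_False mult_zero_right)
      qed (simp only: s(2) of_bool_eq if_True mult_1_right simp_thms)
    qed
    also have "\<dots> = of_bool (x g p s \<in> ?K)" using s by simp
    also have "x g p s \<in> ?K \<longleftrightarrow> x (g \<otimes>\<^bsub>G\<^esub> h) p r \<in> ?K"
    proof
      assume "x g p s \<in> ?K"
      then show "x (g \<otimes>\<^bsub>G\<^esub> h) p r \<in> ?K"
        using x_mult[OF gh, of p s r] s pr K.m_closed by simp
    next
      assume "x (g \<otimes>\<^bsub>G\<^esub> h) p r \<in> ?K"
      moreover have "x g p s = x (g \<otimes>\<^bsub>G\<^esub> h) p r \<otimes>\<^bsub>G\<^esub> inv\<^bsub>G\<^esub> x h s r"
        using x_mult[OF gh, of p s r] s pr gh x_closed by (simp add: G.m_assoc)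
      ultimately show "x g p s \<in> ?K" using s(2) by (simp only: K.m_closed K.m_inv_closed)
    qed
    finally show "of_bool (x (g \<otimes>\<^bsub>G\<^esub> h) p r \<in> ?K) =
        (\<Sum>q\<in>{..<length ts}. of_bool (x g p q \<in> ?K) * (of_bool (x h q r \<in> ?K) :: complex))" by simp
  qed
  moreover have "the_inv_into (carrier H) f (x \<one>\<^bsub>G\<^esub> p p) = \<one>\<^bsub>H\<^esub>" if "p < length ts" for p
    using t[OF that] the_inv_into_f_f[OF assms(4) H.one_closed] by (simp add: x_def)
  moreover have "the_inv_into (carrier H) f a \<in> carrier H" if "a \<in> ?K" for a
    using the_inv_into_into[OF assms(4) that] by simp
  moreover have "the_inv_into (carrier H) f (x (g \<otimes>\<^bsub>G\<^esub> h) p r) =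
      the_inv_into (carrier H) f (x g p q) \<otimes>\<^bsub>H\<^esub> the_inv_into (carrier H) f (x h q r)"
    if "g \<in> carrier G" "h \<in> carrier G" "p < length ts" "q < length ts" "r < length ts"
      "x g p q \<in> ?K" "x h q r \<in> ?K" for g h p q r
    unfolding x_mult[OF that(1-5)] by (rule inv_mult[OF that(6,7)])
  ultimately show ?thesis
    unfolding twisting_def by simp
qed

text \<open>\<open>SOME\<close> picks the transversal from the groups and \<open>f\<close> alone,
  independently of \<open>V\<close>. Induction is therefore one functor of the form
  \<open>twisted\<close>, to which the results on twistings apply.\<close>

lemma rep_ring_induced_virtual:
  assumes "group H" "group G" "f \<in> hom H G" "inj_on f (carrier H)" "\<exists>ts. left_transversal G (f ` carrier H) ts"
    and "is_rep H V" "is_rep H W"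
  shows "rep_ring_induced H G f (virtual H V W) = virtual G (induced H G f V) (induced H G f W)"
    and "is_rep G (induced H G f V)"
proof -
  define ts where "ts = (SOME ts. left_transversal G (f ` carrier H) ts)"
  have ts: "left_transversal G (f ` carrier H) ts"
    unfolding ts_def using assms(5) by (rule someI_ex)
  define x where "x = (\<lambda>g p q. inv\<^bsub>G\<^esub> (ts ! p) \<otimes>\<^bsub>G\<^esub> g \<otimes>\<^bsub>G\<^esub> ts ! q)"
  define w where "w = (\<lambda>g p q. of_bool (x g p q \<in> f ` carrier H) :: complex)"
  define \<theta> where "\<theta> = (\<lambda>g p q. the_inv_into (carrier H) f (x g p q))"
  have tw: "twisting H G {..<length ts} w \<theta>"
    using twisting_induced[OF assms(1-4) ts] by (simp add: w_def \<theta>_def x_def)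
  have eq: "induced H G f V = twisted (length ts) w \<theta> V" for V
  proof -
    have "(if P then z else 0) = of_bool P * z" for P and z :: complex by simp
    then show ?thesis
      by (simp only: induced_def twisted_def Let_def ts_def[symmetric] w_def \<theta>_def x_def)
  qed
  have mon: "monoid H" "monoid G" using assms(1,2) by (simp_all add: group.is_monoid)
  show "is_rep G (induced H G f V)"
    unfolding eq using is_rep_twisted[OF mon tw] assms(6) .
  show "rep_ring_induced H G f (virtual H V W) = virtual G (induced H G f V) (induced H G f W)"
    unfolding rep_ring_induced_def eq using mon tw assms(6,7)
    by (intro UN_virtual_functor) (simp_all add: is_rep_twisted rep_iso_twisted_cong rep_iso_twisted_direct_sum)
qed

lemma rep_ring_induced_rep_class:
  assumes "group H" "group G" "f \<in> hom H G" "inj_on f (carrier H)" "\<exists>ts. left_transversal G (f ` carrier H) ts"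
    and "is_rep H V"
  shows "rep_ring_induced H G f (rep_class H V) = rep_class G (induced H G f V)"
proof -
  note ind = rep_ring_induced_virtual[OF assms(1-5)]
  have mon: "monoid G" using assms(2) by (rule group.is_monoid)
  have "fst (induced H G f (zero_rep :: 'a rep)) = 0" by (simp add: induced_def zero_rep_def Let_def)
  then have "iso_class G (induced H G f (zero_rep :: 'a rep)) = iso_class G zero_rep"
    using ind(2)[OF is_rep_zero is_rep_zero] by (intro iso_class_zero)
  then show ?thesis
    using assms(6) ind(2)[OF assms(6) is_rep_zero] ind(2)[OF is_rep_zero is_rep_zero] mon
    by (simp add: rep_class_def ind(1) virtual_eq_iff groth_relI)
qed

section \<open>Inversion signs and Clifford multiplication\<close>

text \<open>The sign of moving \<open>e_k\<close> past the basis vectors of smaller index: for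
  \<open>k\<close> outside \<open>A\<close>, the wedge of \<open>e_k\<close> with \<open>e_A\<close>
  is this sign times the basis vector of \<open>insert k A\<close>.\<close>

definition cross_sign :: "nat set \<Rightarrow> nat \<Rightarrow> complex" where
  "cross_sign A k = (\<Prod>x\<in>A. if x < k then -1 else 1)"

text \<open>The parity of the inversions of \<open>g\<close> on \<open>S\<close>. The map need not
  preserve \<open>S\<close>, as in the exterior algebra \<open>g\<close> carries \<open>e_S\<close>
  to the basis vector of another set.\<close>

definition inv_sign :: "(nat \<Rightarrow> nat) \<Rightarrow> nat set \<Rightarrow> complex" where
  "inv_sign g S = (\<Prod>y\<in>S. \<Prod>x\<in>S. if x < y \<and> g y < g x then -1 else 1)"

text \<open>Symmetric difference with \<open>{k}\<close>, so that exterior multiplication by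
  \<open>e_k\<close> and contraction with it become one operation on basis vectors.\<close>

definition toggle :: "nat \<Rightarrow> nat set \<Rightarrow> nat set" where
  "toggle k S = (if k \<in> S then S - {k} else insert k S)"

lemma cross_sign_insert [simp]:
  "finite A \<Longrightarrow> x \<notin> A \<Longrightarrow> cross_sign (insert x A) k = (if x < k then -1 else 1) * cross_sign A k"
  by (simp add: cross_sign_def)

lemma cross_sign_square [simp]: "cross_sign A k * cross_sign A k = 1"
  by (auto simp: cross_sign_def prod.distrib[symmetric] intro!: prod.neutral)

lemma cross_sign_square_left [simp]: "cross_sign A k * (cross_sign A k * z) = z"
  by (simp add: mult.assoc[symmetric])

lemma inv_sign_empty [simp]: "inv_sign g {} = 1"
  by (simp add: inv_sign_def)

text \<open>A pair of distinct points \<open>x\<close>, \<open>k\<close> is an inversion exactly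
  when one, but not both, of \<open>x < k\<close> and \<open>g x < g k\<close> holds. The
  contribution of the pair is thus a product of two comparison signs, which collect into crossing
  signs.\<close>

lemma inv_sign_insert:
  assumes "finite C" "k \<notin> C" "inj_on g (insert k C)"
  shows "inv_sign g (insert k C) = inv_sign g C * cross_sign C k * cross_sign (g ` C) (g k)"
proof -
  define c :: "nat \<Rightarrow> nat \<Rightarrow> complex" where "c x y = (if x < y \<and> g y < g x then -1 else 1)" for x y
  have "inv_sign g (insert k C) = (\<Prod>x\<in>C. c x k) * ((\<Prod>y\<in>C. c k y) * inv_sign g C)"
    using assms by (simp add: inv_sign_def c_def[symmetric] prod.distrib) (simp add: c_def)
  also have "\<dots> = inv_sign g C * (\<Prod>x\<in>C. c x k * c k x)"
    by (simp add: prod.distrib)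
  also have "(\<Prod>x\<in>C. c x k * c k x) = (\<Prod>x\<in>C. (if x < k then -1 else 1) * (if g x < g k then -1 else 1))"
  proof (rule prod.cong [OF refl])
    fix x assume "x \<in> C"
    then have "x \<noteq> k" "g x \<noteq> g k" using assms(2,3) by (auto simp: image_iff)
    then show "c x k * c k x = (if x < k then -1 else 1) * (if g x < g k then -1 else 1)"
      by (auto simp: c_def)
  qed
  also have "\<dots> = cross_sign C k * cross_sign (g ` C) (g k)"
  proof -
    have "inj_on g C" using assms(3) by (rule inj_on_subset) auto
    then show ?thesis by (simp add: cross_sign_def prod.distrib prod.reindex)
  qed
  finally show ?thesis by (simp add: mult.assoc)
qed

text \<open>Induction on \<open>S\<close> by \<open>inv_sign_insert\<close>: the crossing sign of
  \<open>h k\<close> with the image of \<open>C\<close> under \<open>h\<close> occurs once in each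
  factor on the right and squares to 1.\<close>

lemma inv_sign_compose:
  assumes "finite S" "inj_on h S" "inj_on g (h ` S)"
  shows "inv_sign (g \<circ> h) S = inv_sign g (h ` S) * inv_sign h S"
  using assms
proof (induction S rule: finite_induct)
  case (insert k C)
  have "h k \<notin> h ` C" using insert.hyps(2) insert.prems(1) by auto
  then have "inv_sign (g \<circ> h) (insert k C) = inv_sign (g \<circ> h) C * cross_sign C k * cross_sign (g ` h ` C) (g (h k))"
    using insert by (subst inv_sign_insert) (auto simp: image_comp intro: comp_inj_on)
  moreover have "inv_sign g (h ` insert k C) = inv_sign g (h ` C) * cross_sign (h ` C) (h k) * cross_sign (g ` h ` C) (g (h k))"
    using insert \<open>h k \<notin> h ` C\<close> unfolding image_insert by (subst inv_sign_insert) auto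
  moreover have "inv_sign h (insert k C) = inv_sign h C * cross_sign C k * cross_sign (h ` C) (h k)"
    using insert by (subst inv_sign_insert) auto
  moreover have "inv_sign (g \<circ> h) C = inv_sign g (h ` C) * inv_sign h C"
    using insert.prems by (intro insert.IH) (auto intro: inj_on_subset)
  ultimately show ?case by (simp add: mult_ac o_def)
qed simp

lemma inv_sign_cong: "(\<And>x. x \<in> S \<Longrightarrow> g x = h x) \<Longrightarrow> inv_sign g S = inv_sign h S"
  unfolding inv_sign_def by (intro prod.cong refl) simp

lemma inv_sign_id [simp]: "inv_sign (\<lambda>x. x) S = 1"
  by (auto simp: inv_sign_def intro!: prod.neutral)

text \<open>On the remaining points the transposition is the identity. After \<open>b\<close> and
  \<open>a\<close> are inserted, every crossing sign with \<open>C\<close> occurs twice, while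
  exactly one of \<open>a < b\<close> and \<open>b < a\<close> leaves a factor -1.\<close>

lemma inv_sign_transpose:
  assumes "finite S" "a \<in> S" "b \<in> S" "a \<noteq> b"
  shows "inv_sign (Transposition.transpose a b) S = -1"
proof -
  let ?t = "Transposition.transpose a b"
  define C where "C = S - {a, b}"
  have C: "S = insert a (insert b C)" "finite C" "a \<notin> C" "b \<notin> C" using assms by (auto simp: C_def)
  have fix_C: "?t x = x" if "x \<in> C" for x using that C by (auto simp: transpose_def)
  then have t: "?t ` C = C" "?t ` insert b C = insert a C" by force+
  have "inv_sign ?t C = 1" using inv_sign_cong[of C ?t "\<lambda>x. x"] fix_C by simp
  then have "inv_sign ?t S = cross_sign C b * cross_sign C a * cross_sign (insert b C) a * cross_sign (insert a C) b"
    using C assms(4) by (simp add: inv_sign_insert t inj_on_subset[OF inj_on_transpose[of a b UNIV]])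
  then show ?thesis using C assms(4) by (auto simp: mult_ac)
qed

text \<open>Both sides are multiplicative and equal -1 on transpositions.\<close>

lemma sign_eq_inv_sign:
  assumes "p permutes S" "finite S"
  shows "of_int (sign p) = inv_sign p S"
  using assms
proof (induction rule: permutes_induct)
  case (swap a b p)
  have "of_int (sign (Transposition.transpose a b \<circ> p)) = - (of_int (sign p) :: complex)"
    using swap assms(2) permutation_permutes by (subst sign_compose) (auto simp: sign_swap_id permutation_swap_id)
  also have "\<dots> = inv_sign (Transposition.transpose a b) (p ` S) * inv_sign p S"
    using swap assms(2) by (simp add: inv_sign_transpose permutes_image)
  also have "\<dots> = inv_sign (Transposition.transpose a b \<circ> p) S"
    using swap assms(2) permutes_inj_on by (subst inv_sign_compose) (auto intro: inj_on_subset[OF inj_on_transpose[of a b UNIV]])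
  finally show ?case .
qed (simp add: id_def)

section \<open>Toggling points of a subset\<close>

lemma toggle_toggle [simp]: "toggle k (toggle k S) = S"
  by (auto simp: toggle_def)

lemma toggle_commute: "toggle k (toggle l S) = toggle l (toggle k S)"
  by (auto simp: toggle_def)

lemma toggle_Diff: "k \<noteq> l \<Longrightarrow> toggle k S - {l} = toggle k (S - {l})"
  by (auto simp: toggle_def)

lemma toggle_Diff_same [simp]: "toggle k S - {k} = S - {k}"
  by (auto simp: toggle_def)

lemma toggle_image: "inj_on g (insert k S) \<Longrightarrow> toggle (g k) (g ` S) = g ` toggle k S"
  by (auto simp: toggle_def dest: inj_onD)

lemma toggle_subset: "k \<in> A \<Longrightarrow> S \<subseteq> A \<Longrightarrow> toggle k S \<subseteq> A"
  by (auto simp: toggle_def)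

lemma even_card_toggle: "finite S \<Longrightarrow> even (card (toggle k S)) \<longleftrightarrow> odd (card S)"
  using card_Suc_Diff1[of S k] by (auto simp: toggle_def)

lemma cross_sign_toggle:
  assumes "finite A"
  shows "cross_sign (toggle k A) l = (if k < l then -1 else 1) * cross_sign A l"
proof (cases "k \<in> A")
  case True
  then have "cross_sign A l = (if k < l then -1 else 1) * cross_sign (A - {k}) l"
    using cross_sign_insert[of "A - {k}" k l] assms by (simp add: insert_absorb)
  then show ?thesis using True by (simp add: toggle_def)
qed (simp add: toggle_def assms)

text \<open>Whichever of \<open>S\<close> and \<open>toggle k S\<close> contains \<open>k\<close>,
  it arises from the other by inserting \<open>k\<close>, and crossing signs square to 1. In this
  form, free of a case distinction, the equation is the equivariance of a single summand of Clifford
  multiplication.\<close>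

lemma inv_sign_toggle:
  assumes "finite S" "inj_on g (insert k S)"
  shows "inv_sign g (toggle k S) * cross_sign (S - {k}) k = inv_sign g S * cross_sign (g ` S - {g k}) (g k)"
proof -
  let ?C = "S - {k}"
  have im: "g ` S - {g k} = g ` ?C" using inj_on_image_set_diff[OF assms(2), of S "{k}"] by auto
  have ins: "inv_sign g (insert k ?C) = inv_sign g ?C * cross_sign ?C k * cross_sign (g ` ?C) (g k)"
    using assms by (intro inv_sign_insert) (auto intro: inj_on_subset)
  show ?thesis
  proof (cases "k \<in> S")
    case True
    then have "toggle k S = ?C" "S = insert k ?C" by (auto simp: toggle_def)
    then show ?thesis using ins im by (metis (no_types, lifting) cross_sign_square mult.assoc mult.right_neutral)
  next
    case False
    then have "toggle k S = insert k ?C" "S = ?C" by (auto simp: toggle_def)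
    then show ?thesis using ins im by (metis (no_types, lifting) cross_sign_square mult.assoc mult.commute mult.right_neutral)
  qed
qed

text \<open>
  The matrix, in the monomial basis of the exterior algebra of \<open>\<complex>\<^sup>m\<close>, of Clifford multiplication by the invariant
  vector \<open>(1, \<dots>, 1)\<close>, i.e. of the sum of exterior multiplication by it and contraction with it.
\<close>

definition clifford :: "nat \<Rightarrow> nat set \<Rightarrow> nat set \<Rightarrow> complex" where
  "clifford m T S = (\<Sum>k\<in>{1..m}. (if T = toggle k S then cross_sign (S - {k}) k else 0))"

text \<open>The summands of Clifford multiplication for the single basis vectors square to 1 and
  anticommute, so the square of their sum is the number \<open>m\<close> of summands. The set
  \<open>\<T>\<close> only has to contain the intermediate subsets, which permits summing over one
  parity.\<close>

lemma clifford_square: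
  assumes "finite \<T>" "finite S" "\<And>k. k \<in> {1..m} \<Longrightarrow> toggle k S \<in> \<T>"
  shows "(\<Sum>T\<in>\<T>. clifford m U T * clifford m T S) = of_nat m * of_bool (U = S)"
proof -
  let ?I = "{1..m}"
  define F :: "nat \<Rightarrow> nat \<Rightarrow> complex" where
    "F k l = (if U = toggle l (toggle k S) then cross_sign (toggle k S - {l}) l else 0) * cross_sign (S - {k}) k" for k l
  define E where "E k l = (if k = l then 0 else F k l)" for k l
  have "(\<Sum>T\<in>\<T>. clifford m U T * clifford m T S) =
      (\<Sum>k\<in>?I. \<Sum>T\<in>\<T>. (if T = toggle k S then clifford m U T * cross_sign (S - {k}) k else 0))"
    by (subst sum.swap) (simp add: clifford_def[of _ _ S] sum_distrib_left if_distrib cong: if_cong)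
  also have "\<dots> = (\<Sum>k\<in>?I. clifford m U (toggle k S) * cross_sign (S - {k}) k)"
    using assms(1,3) by (intro sum.cong refl) (simp add: sum.delta)
  also have "\<dots> = (\<Sum>k\<in>?I. \<Sum>l\<in>?I. F k l)"
    by (simp add: clifford_def[of m U] F_def sum_distrib_right)
  also have "\<dots> = (\<Sum>k\<in>?I. \<Sum>l\<in>?I. (if k = l then F k k else 0)) + (\<Sum>k\<in>?I. \<Sum>l\<in>?I. E k l)"
  proof -
    have "F k l = (if k = l then F k k else 0) + E k l" for k l by (simp add: E_def)
    then have "(\<Sum>l\<in>?I. F k l) = (\<Sum>l\<in>?I. if k = l then F k k else 0) + (\<Sum>l\<in>?I. E k l)" for k
      by (metis (no_types, lifting) sum.cong sum.distrib)
    then show ?thesis by (simp only: sum.distrib)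
  qed
  also have "(\<Sum>k\<in>?I. \<Sum>l\<in>?I. (if k = l then F k k else 0)) = (\<Sum>k\<in>?I. F k k)"
    by (intro sum.cong refl) (simp add: sum.delta')
  also have "(\<Sum>k\<in>?I. F k k) = of_nat m * of_bool (U = S)"
    by (simp add: F_def)
  also have "(\<Sum>k\<in>?I. \<Sum>l\<in>?I. E k l) = 0"
  proof -
    \<comment> \<open>Toggling \<open>k\<close> first changes the crossing sign at \<open>l\<close>
      exactly when \<open>k < l\<close>, so for \<open>k \<noteq> l\<close> precisely one of the two
      orders picks up a sign.\<close>
    have "E k l = - E l k" for k l
    proof (cases "k = l")
      case False
      then show ?thesis using assms(2)
        by (auto simp: E_def F_def toggle_Diff cross_sign_toggle toggle_commute[of l k])
    qed (simp add: E_def)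
    then have "(\<Sum>k\<in>?I. \<Sum>l\<in>?I. E k l) = (\<Sum>k\<in>?I. \<Sum>l\<in>?I. - E l k)"
      by (intro sum.cong refl)
    also have "\<dots> = - (\<Sum>k\<in>?I. \<Sum>l\<in>?I. E k l)" by (subst sum.swap) (simp add: sum_negf)
    finally show ?thesis by simp
  qed
  finally show ?thesis by simp
qed

text \<open>Invariance of the vector \<open>(1, \<dots>, 1)\<close> appears as a reindexing:
  \<open>g\<close> permutes the summands, taking the one for \<open>k\<close> to the one for
  \<open>g k\<close>, and the signs match by \<open>inv_sign_toggle\<close>.\<close>

lemma clifford_equivariant:
  assumes "g permutes {1..m}" "S \<subseteq> {1..m}" "T \<subseteq> {1..m}"
  shows "clifford m (g ` T) (g ` S) * inv_sign g S = inv_sign g T * clifford m T S"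
proof -
  have inj: "inj_on g A" for A using assms(1) permutes_inj_on by blast
  have fin: "finite S" using assms(2) finite_subset by blast
  have "clifford m (g ` T) (g ` S) = (\<Sum>k\<in>g ` {1..m}. (if g ` T = toggle k (g ` S) then cross_sign (g ` S - {k}) k else 0))"
    using assms(1) by (simp add: clifford_def permutes_image)
  also have "\<dots> = (\<Sum>k\<in>{1..m}. (if T = toggle k S then cross_sign (g ` S - {g k}) (g k) else 0))"
    unfolding sum.reindex[OF inj] o_def toggle_image[OF inj] inj_image_eq_iff[OF permutes_inj[OF assms(1)]] ..
  moreover have "(if T = toggle k S then cross_sign (g ` S - {g k}) (g k) else 0) * inv_sign g S =
      inv_sign g T * (if T = toggle k S then cross_sign (S - {k}) k else 0)" for k
    using inv_sign_toggle[OF fin inj, of k] by (simp add: mult.commute)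
  ultimately show ?thesis
    by (simp only: clifford_def[of m T S] sum_distrib_left sum_distrib_right)
qed

section \<open>Groups of block permutations\<close>

lemma inl_eq_iff [simp]: "inl x = inl y \<longleftrightarrow> x = y" and inr_eq_iff [simp]: "inr x = inr y \<longleftrightarrow> x = y"
  and inl_neq_inr [simp]: "inl x \<noteq> inr y" and inr_neq_inl [simp]: "inr y \<noteq> inl x"
  by (simp_all add: sum_encode_eq)

lemma copair_simps [simp]: "copair f g (inl x) = f x" "copair f g (inr y) = g y"
  by (simp_all add: copair_def)

lemma is_partition_indiscrete [simp]: "is_partition (indiscrete m)"
  by (auto simp: is_partition_def indiscrete_def equiv_def refl_on_def sym_def trans_def)

lemma is_partition_disj_union:
  "is_partition \<Lambda> \<Longrightarrow> is_partition \<Omega> \<Longrightarrow> is_partition (disj_union \<Lambda> \<Omega>)"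
  unfolding is_partition_def
proof (elim conjE, intro conjI equivI)
  assume fin: "finite (points \<Lambda>)" "finite (points \<Omega>)" and eq: "equiv (points \<Lambda>) (sim \<Lambda>)" "equiv (points \<Omega>) (sim \<Omega>)"
  show "finite (points (disj_union \<Lambda> \<Omega>))" using fin by (simp add: disj_union_def)
  show "sim (disj_union \<Lambda> \<Omega>) \<subseteq> points (disj_union \<Lambda> \<Omega>) \<times> points (disj_union \<Lambda> \<Omega>)"
    using eq[THEN equiv_type] by (auto simp: disj_union_def)
  show "refl_on (points (disj_union \<Lambda> \<Omega>)) (sim (disj_union \<Lambda> \<Omega>))"
    using eq by (auto simp: disj_union_def equiv_def refl_on_def)
  show "sym (sim (disj_union \<Lambda> \<Omega>))"
    using eq by (auto simp: disj_union_def equiv_def intro!: symI dest: symD)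
  show "trans (sim (disj_union \<Lambda> \<Omega>))"
    using eq by (auto simp: disj_union_def equiv_def intro!: transI dest: transD)
qed

lemma carrier_block_perms:
  "\<sigma> \<in> carrier (block_perms \<Lambda>) \<longleftrightarrow> \<sigma> permutes points \<Lambda> \<and> (\<forall>x\<in>points \<Lambda>. (x, \<sigma> x) \<in> sim \<Lambda>)"
  by (simp add: block_perms_def)

lemma block_perm_permutes: "\<sigma> \<in> carrier (block_perms \<Lambda>) \<Longrightarrow> \<sigma> permutes points \<Lambda>"
  and block_perm_sim: "\<sigma> \<in> carrier (block_perms \<Lambda>) \<Longrightarrow> x \<in> points \<Lambda> \<Longrightarrow> (x, \<sigma> x) \<in> sim \<Lambda>"
  by (simp_all add: carrier_block_perms)

lemma mult_block_perms [simp]: "\<sigma> \<otimes>\<^bsub>block_perms \<Lambda>\<^esub> \<tau> = \<sigma> \<circ> \<tau>"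
  and one_block_perms [simp]: "\<one>\<^bsub>block_perms \<Lambda>\<^esub> = id"
  by (simp_all add: block_perms_def)

lemma inv_block_perm:
  assumes "is_partition \<Lambda>" "\<sigma> \<in> carrier (block_perms \<Lambda>)"
  shows "inv_into UNIV \<sigma> \<in> carrier (block_perms \<Lambda>)"
  unfolding carrier_block_perms
proof (intro conjI ballI)
  have \<sigma>: "\<sigma> permutes points \<Lambda>" using assms(2) by (simp add: carrier_block_perms)
  show inv: "inv_into UNIV \<sigma> permutes points \<Lambda>" using \<sigma> by (rule permutes_inv)
  fix x assume "x \<in> points \<Lambda>"
  then have "inv_into UNIV \<sigma> x \<in> points \<Lambda>" using inv by (simp add: permutes_in_image)
  then have "(inv_into UNIV \<sigma> x, \<sigma> (inv_into UNIV \<sigma> x)) \<in> sim \<Lambda>" using assms(2) by (simp add: carrier_block_perms)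
  then show "(x, inv_into UNIV \<sigma> x) \<in> sim \<Lambda>"
    using assms(1) \<sigma> by (simp add: permutes_inverses is_partition_def equiv_def sym_def)
qed

lemma group_block_perms:
  assumes "is_partition \<Lambda>"
  shows "group (block_perms \<Lambda>)"
proof (rule groupI)
  fix \<sigma> \<tau> assume "\<sigma> \<in> carrier (block_perms \<Lambda>)" "\<tau> \<in> carrier (block_perms \<Lambda>)"
  then have p: "\<sigma> permutes points \<Lambda>" "\<tau> permutes points \<Lambda>"
    and s: "\<And>x. x \<in> points \<Lambda> \<Longrightarrow> (x, \<sigma> x) \<in> sim \<Lambda>" "\<And>x. x \<in> points \<Lambda> \<Longrightarrow> (x, \<tau> x) \<in> sim \<Lambda>"
    by (simp_all add: carrier_block_perms)
  have "trans (sim \<Lambda>)" using assms by (simp add: is_partition_def equiv_def)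
  then have "(x, \<sigma> (\<tau> x)) \<in> sim \<Lambda>" if "x \<in> points \<Lambda>" for x
    using transD[OF _ s(2)[OF that] s(1)] permutes_in_image[OF p(2)] that by blast
  with permutes_compose[OF p(2,1)] show "\<sigma> \<otimes>\<^bsub>block_perms \<Lambda>\<^esub> \<tau> \<in> carrier (block_perms \<Lambda>)"
    by (simp add: carrier_block_perms)
next
  show "\<one>\<^bsub>block_perms \<Lambda>\<^esub> \<in> carrier (block_perms \<Lambda>)"
    using assms by (auto simp: carrier_block_perms permutes_id is_partition_def equiv_def refl_on_def)
next
  fix \<sigma> assume \<sigma>: "\<sigma> \<in> carrier (block_perms \<Lambda>)"
  then have "inv_into UNIV \<sigma> \<otimes>\<^bsub>block_perms \<Lambda>\<^esub> \<sigma> = \<one>\<^bsub>block_perms \<Lambda>\<^esub>"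
    using permutes_inv_o(2)[OF block_perm_permutes] by simp
  then show "\<exists>\<tau>\<in>carrier (block_perms \<Lambda>). \<tau> \<otimes>\<^bsub>block_perms \<Lambda>\<^esub> \<sigma> = \<one>\<^bsub>block_perms \<Lambda>\<^esub>"
    using inv_block_perm[OF assms \<sigma>] by blast
qed (simp_all add: comp_assoc)

lemma monoid_block_perms: "is_partition \<Lambda> \<Longrightarrow> monoid (block_perms \<Lambda>)"
  by (rule group.is_monoid[OF group_block_perms])

lemma m_inv_block_perms:
  assumes "is_partition \<Lambda>" "\<sigma> \<in> carrier (block_perms \<Lambda>)"
  shows "inv\<^bsub>block_perms \<Lambda>\<^esub> \<sigma> = inv_into UNIV \<sigma>"
  by (rule group.inv_equality[OF group_block_perms[OF assms(1)] _ assms(2) inv_block_perm[OF assms]])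
    (use permutes_inv_o(2)[OF block_perm_permutes[OF assms(2)]] in simp)

lemma carrier_block_perms_indiscrete: "carrier (block_perms (indiscrete m)) = {\<sigma>. \<sigma> permutes {1..m}}"
  by (auto simp: block_perms_def indiscrete_def dest: permutes_in_image[THEN iffD2])

section \<open>Conjugation of permutations along a morphism\<close>

lemma conj_perm_apply: "inj_on f (points \<Lambda>) \<Longrightarrow> x \<in> points \<Lambda> \<Longrightarrow> conj_perm \<Lambda> f \<sigma> (f x) = f (\<sigma> x)"
  by (simp add: conj_perm_def)

lemma conj_perm_outside: "y \<notin> f ` points \<Lambda> \<Longrightarrow> conj_perm \<Lambda> f \<sigma> y = y"
  by (simp add: conj_perm_def)

lemma conj_perm_permutes: "bij_betw f (points \<Lambda>) Y \<Longrightarrow> \<sigma> permutes points \<Lambda> \<Longrightarrow> conj_perm \<Lambda> f \<sigma> permutes Y"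
  using permutes_bij_inv_into[of \<sigma> "points \<Lambda>" f Y] by (simp add: conj_perm_def[abs_def] bij_betw_def)

lemma conj_perm_hom:
  assumes "morphism \<Lambda> \<Omega> f"
  shows "conj_perm \<Lambda> f \<in> hom (block_perms \<Lambda>) (block_perms \<Omega>)"
    and "inj_on (conj_perm \<Lambda> f) (carrier (block_perms \<Lambda>))"
proof -
  have inj: "inj_on f (points \<Lambda>)" and im: "f ` points \<Lambda> = points \<Omega>" and bij: "bij_betw f (points \<Lambda>) (points \<Omega>)"
    and mono: "\<And>x y. (x, y) \<in> sim \<Lambda> \<Longrightarrow> (f x, f y) \<in> sim \<Omega>"
    using assms by (auto simp: morphism_def bij_betw_def)
  note app = conj_perm_apply[OF inj]
  show "conj_perm \<Lambda> f \<in> hom (block_perms \<Lambda>) (block_perms \<Omega>)"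
  proof (rule homI)
    fix \<sigma> assume \<sigma>: "\<sigma> \<in> carrier (block_perms \<Lambda>)"
    then show "conj_perm \<Lambda> f \<sigma> \<in> carrier (block_perms \<Omega>)"
      using conj_perm_permutes[OF bij] by (auto simp: carrier_block_perms im[symmetric] app mono)
  next
    fix \<sigma> \<tau> assume "\<sigma> \<in> carrier (block_perms \<Lambda>)" "\<tau> \<in> carrier (block_perms \<Lambda>)"
    then have \<tau>: "\<tau> x \<in> points \<Lambda>" if "x \<in> points \<Lambda>" for x
      using that by (simp add: carrier_block_perms permutes_in_image)
    show "conj_perm \<Lambda> f (\<sigma> \<otimes>\<^bsub>block_perms \<Lambda>\<^esub> \<tau>) = conj_perm \<Lambda> f \<sigma> \<otimes>\<^bsub>block_perms \<Omega>\<^esub> conj_perm \<Lambda> f \<tau>"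
    proof
      fix y show "conj_perm \<Lambda> f (\<sigma> \<otimes>\<^bsub>block_perms \<Lambda>\<^esub> \<tau>) y = (conj_perm \<Lambda> f \<sigma> \<otimes>\<^bsub>block_perms \<Omega>\<^esub> conj_perm \<Lambda> f \<tau>) y"
        by (cases "y \<in> f ` points \<Lambda>") (auto simp: app \<tau> conj_perm_outside)
    qed
  qed
  show "inj_on (conj_perm \<Lambda> f) (carrier (block_perms \<Lambda>))"
  proof (rule inj_onI)
    fix \<sigma> \<tau> assume s: "\<sigma> \<in> carrier (block_perms \<Lambda>)" "\<tau> \<in> carrier (block_perms \<Lambda>)"
      and eq: "conj_perm \<Lambda> f \<sigma> = conj_perm \<Lambda> f \<tau>"
    show "\<sigma> = \<tau>"
    proof
      fix x show "\<sigma> x = \<tau> x"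
      proof (cases "x \<in> points \<Lambda>")
        case True
        then have "f (\<sigma> x) = f (\<tau> x)" "\<sigma> x \<in> points \<Lambda>" "\<tau> x \<in> points \<Lambda>"
          using fun_cong[OF eq, of "f x"] s by (simp_all add: app carrier_block_perms permutes_in_image)
        then show ?thesis using inj by (auto dest: inj_onD)
      qed (use s[THEN block_perm_permutes] in \<open>simp add: permutes_not_in[where S = "points \<Lambda>"]\<close>)
    qed
  qed
qed

section \<open>Block permutations of a disjoint union\<close>

lemma points_disj_union: "points (disj_union \<Lambda> \<Omega>) = inl ` points \<Lambda> \<union> inr ` points \<Omega>"
  by (simp add: disj_union_def)

lemma sim_disj_union [simp]:
  "(inl x, z) \<in> sim (disj_union \<Lambda> \<Omega>) \<longleftrightarrow> (\<exists>y. z = inl y \<and> (x, y) \<in> sim \<Lambda>)"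
  "(inr x, z) \<in> sim (disj_union \<Lambda> \<Omega>) \<longleftrightarrow> (\<exists>y. z = inr y \<and> (x, y) \<in> sim \<Omega>)"
  by (auto simp: disj_union_def)

text \<open>No block meets both summands, so \<open>projl\<close> is never applied to a right tag;
  points outside the partition are fixed. Hence the equation holds for every number
  \<open>x\<close>, and products of projections need no side conditions.\<close>

lemma left_perm_eq:
  assumes "\<sigma> \<in> carrier (block_perms (disj_union \<Lambda> \<Omega>))"
  shows "\<sigma> (inl x) = inl (left_perm \<sigma> x)"
proof (cases "x \<in> points \<Lambda>")
  case True
  then have "(inl x, \<sigma> (inl x)) \<in> sim (disj_union \<Lambda> \<Omega>)"
    using block_perm_sim[OF assms, of "inl x"] by (simp add: points_disj_union)
  then show ?thesis by (auto simp: left_perm_def)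
next
  case False
  then have "\<sigma> (inl x) = inl x"
    using assms by (auto simp: carrier_block_perms points_disj_union intro!: permutes_not_in)
  then show ?thesis by (simp add: left_perm_def)
qed

lemma right_perm_eq:
  assumes "\<sigma> \<in> carrier (block_perms (disj_union \<Lambda> \<Omega>))"
  shows "\<sigma> (inr x) = inr (right_perm \<sigma> x)"
proof (cases "x \<in> points \<Omega>")
  case True
  then have "(inr x, \<sigma> (inr x)) \<in> sim (disj_union \<Lambda> \<Omega>)"
    using block_perm_sim[OF assms, of "inr x"] by (simp add: points_disj_union)
  then show ?thesis by (auto simp: right_perm_def)
next
  case False
  then have "\<sigma> (inr x) = inr x"
    using assms by (auto simp: carrier_block_perms points_disj_union intro!: permutes_not_in)
  then show ?thesis by (simp add: right_perm_def)
qed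

text \<open>Bijectivity of a projected permutation comes from the inverse: its projection inverts
  the projection, by multiplicativity.\<close>

lemma perm_projections_hom:
  assumes "is_partition \<Lambda>" "is_partition \<Omega>"
  shows "left_perm \<in> hom (block_perms (disj_union \<Lambda> \<Omega>)) (block_perms \<Lambda>)" (is ?L)
    and "right_perm \<in> hom (block_perms (disj_union \<Lambda> \<Omega>)) (block_perms \<Omega>)" (is ?R)
proof -
  let ?G = "block_perms (disj_union \<Lambda> \<Omega>)"
  note part = is_partition_disj_union[OF assms]
  interpret group ?G by (rule group_block_perms[OF part])
  have L_mult: "left_perm (\<sigma> \<circ> \<tau>) = left_perm \<sigma> \<circ> left_perm \<tau>"
    and R_mult: "right_perm (\<sigma> \<circ> \<tau>) = right_perm \<sigma> \<circ> right_perm \<tau>"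
    if "\<sigma> \<in> carrier ?G" "\<tau> \<in> carrier ?G" for \<sigma> \<tau>
    using that left_perm_eq[of _ \<Lambda> \<Omega>] right_perm_eq[of _ \<Lambda> \<Omega>] m_closed[of \<sigma> \<tau>]
    by (metis comp_apply ext inl_eq_iff mult_block_perms, metis comp_apply ext inr_eq_iff mult_block_perms)
  have "left_perm \<sigma> \<in> carrier (block_perms \<Lambda>) \<and> right_perm \<sigma> \<in> carrier (block_perms \<Omega>)" if \<sigma>: "\<sigma> \<in> carrier ?G" for \<sigma>
  proof -
    let ?\<tau> = "inv_into UNIV \<sigma>"
    have \<tau>: "?\<tau> \<in> carrier ?G" by (rule inv_block_perm[OF part \<sigma>])
    have id: "\<sigma> \<circ> ?\<tau> = id" "?\<tau> \<circ> \<sigma> = id"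
      using permutes_inv_o[OF block_perm_permutes[OF \<sigma>]] .
    have "left_perm id = id" "right_perm id = id" by (auto simp: left_perm_def right_perm_def)
    then have "bij (left_perm \<sigma>)" "bij (right_perm \<sigma>)"
      using L_mult[OF \<sigma> \<tau>] L_mult[OF \<tau> \<sigma>] R_mult[OF \<sigma> \<tau>] R_mult[OF \<tau> \<sigma>] id
      by (auto intro: o_bij[of "left_perm ?\<tau>"] o_bij[of "right_perm ?\<tau>"])
    moreover have "left_perm \<sigma> x = x" if "x \<notin> points \<Lambda>" for x
    proof -
      have "inl x \<notin> points (disj_union \<Lambda> \<Omega>)" using that by (auto simp: points_disj_union)
      then have "\<sigma> (inl x) = inl x"
        using \<sigma> permutes_not_in[of \<sigma>] unfolding carrier_block_perms by blast
      then show ?thesis using left_perm_eq[OF \<sigma>, of x] by simp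
    qed
    moreover have "right_perm \<sigma> x = x" if "x \<notin> points \<Omega>" for x
    proof -
      have "inr x \<notin> points (disj_union \<Lambda> \<Omega>)" using that by (auto simp: points_disj_union)
      then have "\<sigma> (inr x) = inr x"
        using \<sigma> permutes_not_in[of \<sigma>] unfolding carrier_block_perms by blast
      then show ?thesis using right_perm_eq[OF \<sigma>, of x] by simp
    qed
    moreover have "(x, left_perm \<sigma> x) \<in> sim \<Lambda>" if "x \<in> points \<Lambda>" for x
      using block_perm_sim[OF \<sigma>, of "inl x"] that by (simp add: points_disj_union left_perm_eq[OF \<sigma>])
    moreover have "(x, right_perm \<sigma> x) \<in> sim \<Omega>" if "x \<in> points \<Omega>" for x
      using block_perm_sim[OF \<sigma>, of "inr x"] that by (simp add: points_disj_union right_perm_eq[OF \<sigma>])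
    ultimately show ?thesis
      by (simp add: carrier_block_perms permutes_def bij_iff)
  qed
  with L_mult R_mult show ?L ?R by (auto intro!: homI)
qed

lemma left_perm_id [simp]: "left_perm id = id" and right_perm_id [simp]: "right_perm id = id"
  by (auto simp: left_perm_def right_perm_def)

section \<open>The trivial and the sign representation, and concatenation\<close>

lemma is_rep_trivial: "is_rep G trivial_rep"
  by (simp add: is_rep_def trivial_rep_def)

lemma is_rep_sign:
  assumes "is_partition \<Lambda>"
  shows "is_rep (block_perms \<Lambda>) sign_rep"
proof -
  have "permutation \<sigma>" if "\<sigma> \<in> carrier (block_perms \<Lambda>)" for \<sigma>
    using assms block_perm_permutes[OF that] by (auto simp: permutation_permutes is_partition_def)
  then show ?thesis
    by (auto simp: is_rep_def sign_rep_def sign_compose mat_eq_iff scalar_prod_def)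
qed

lemma concat_map_simps [simp]: "concat_map i (inl x) = x" "concat_map i (inr y) = i + y"
  by (simp_all add: concat_map_def)

lemma concat_map_bij: "bij_betw (concat_map i) (points (disj_union (indiscrete i) (indiscrete j))) {1..i + j}"
  by (rule bij_betw_byWitness[where f' = "\<lambda>k. if k \<le> i then inl k else inr (k - i)"])
    (auto simp: points_disj_union indiscrete_def image_iff Bex_def)

lemma morphism_concat_map:
  "morphism (disj_union (indiscrete i) (indiscrete j)) (indiscrete (i + j)) (concat_map i)"
  using concat_map_bij[of i j]
  by (auto simp: morphism_def is_partition_disj_union) (auto simp: indiscrete_def disj_union_def)

section \<open>Exterior powers as induced representations\<close>

lemma inv_sign_shift:
  assumes "\<And>y. y \<in> A \<Longrightarrow> g (i + y) = i + p y"
  shows "inv_sign g ((+) i ` A) = inv_sign p A"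
  using assms unfolding inv_sign_def
  by (simp add: prod.reindex cong: prod.cong)

text \<open>The matrix entries of the action \<open>g e\<^sub>T = inv_sign g T e\<^bsub>g(T)\<^esub>\<close> on the monomial basis of the exterior algebra of \<open>\<complex>\<^sup>m\<close>.\<close>

definition ext_fam :: "(nat \<Rightarrow> nat) \<Rightarrow> nat set \<Rightarrow> nat set \<Rightarrow> complex" where
  "ext_fam g S T = of_bool (S = g ` T) * inv_sign g T"

text \<open>Its block permutations form the product of the symmetric groups of degrees
  \<open>i\<close> and \<open>j\<close>, which \<open>young_emb\<close> realises as a Young subgroup
  of the one of degree \<open>i + j\<close>.\<close>

definition young :: "nat \<Rightarrow> nat \<Rightarrow> partition" where
  "young i j = disj_union (indiscrete i) (indiscrete j)"

lemma is_partition_young [simp]: "is_partition (young i j)"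
  by (simp add: young_def is_partition_disj_union)

definition young_emb :: "nat \<Rightarrow> nat \<Rightarrow> (nat \<Rightarrow> nat) \<Rightarrow> nat \<Rightarrow> nat" where
  "young_emb i j = conj_perm (young i j) (concat_map i)"

lemma young_emb_hom:
  "young_emb i j \<in> hom (block_perms (young i j)) (block_perms (indiscrete (i + j)))"
  "inj_on (young_emb i j) (carrier (block_perms (young i j)))"
  unfolding young_emb_def young_def by (rule conj_perm_hom[OF morphism_concat_map])+

lemma points_young: "points (young i j) = inl ` {1..i} \<union> inr ` {1..j}"
  by (simp add: young_def points_disj_union indiscrete_def)

lemma inj_concat_map: "inj_on (concat_map i) (points (young i j))"
  using concat_map_bij[of i j] by (simp add: young_def bij_betw_def)

lemma tail_eq_shift: "{i + 1..i + j} = (+) i ` {1..j::nat}"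
  by (simp add: image_add_atLeastAtMost)

text \<open>Concatenation lists the right block in order as the last \<open>j\<close> points, so the
  inversions there are those of the right component. This makes the character
  \<open>1 \<otimes> sgn\<close> of the Young subgroup visible as an
  \<open>inv_sign\<close>.\<close>

lemma young_emb_tail:
  assumes "h \<in> carrier (block_perms (young i j))"
  shows "young_emb i j h ` {i + 1..i + j} = {i + 1..i + j}"
    and "inv_sign (young_emb i j h) {i + 1..i + j} = of_int (sign (right_perm h))"
proof -
  have r: "right_perm h permutes {1..j}"
    using perm_projections_hom(2)[of "indiscrete i" "indiscrete j"] assms
    by (auto simp: hom_def young_def carrier_block_perms_indiscrete)
  have app: "young_emb i j h (i + y) = i + right_perm h y" if "y \<in> {1..j}" for y
  proof -
    have "young_emb i j h (concat_map i (inr y)) = concat_map i (h (inr y))"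
      unfolding young_emb_def using that by (intro conj_perm_apply inj_concat_map) (simp add: points_young)
    then show ?thesis using right_perm_eq[OF assms[unfolded young_def], of y] by simp
  qed
  have "young_emb i j h ` (+) i ` {1..j} = (+) i ` right_perm h ` {1..j}"
    unfolding image_image by (rule image_cong[OF refl]) (rule app)
  then show "young_emb i j h ` {i + 1..i + j} = {i + 1..i + j}"
    unfolding tail_eq_shift permutes_image[OF r] .
  show "inv_sign (young_emb i j h) {i + 1..i + j} = of_int (sign (right_perm h))"
    unfolding tail_eq_shift sign_eq_inv_sign[OF r finite_atLeastAtMost]
    by (rule inv_sign_shift) (rule app)
qed

text \<open>The Young subgroup is a stabiliser: a permutation preserving the set of the last
  \<open>j\<close> points preserves its complement too, and so splits into two block permutations.
  Questions about cosets thereby become equations between \<open>j\<close>-element sets.\<close>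

lemma young_emb_image:
  assumes "x permutes {1..i + j}"
  shows "x \<in> young_emb i j ` carrier (block_perms (young i j)) \<longleftrightarrow> x ` {i + 1..i + j} = {i + 1..i + j}"
proof
  assume "x \<in> young_emb i j ` carrier (block_perms (young i j))"
  then obtain h where "h \<in> carrier (block_perms (young i j))" "x = young_emb i j h" by blast
  then show "x ` {i + 1..i + j} = {i + 1..i + j}" using young_emb_tail(1) by blast
next
  assume J: "x ` {i + 1..i + j} = {i + 1..i + j}"
  have inj: "inj x" using assms by (rule permutes_inj)
  have mem: "x a \<in> {i + 1..i + j} \<longleftrightarrow> a \<in> {i + 1..i + j}" for a
    using inj_image_mem_iff[OF inj, of a "{i + 1..i + j}"] unfolding J .
  have mem_all: "x a \<in> {1..i + j} \<longleftrightarrow> a \<in> {1..i + j}" for a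
    by (rule permutes_in_image[OF assms])
  \<comment> \<open>\<open>\<psi>\<close> is the inverse of \<open>concat_map i\<close>; conjugating
    \<open>x\<close> along it gives the preimage of \<open>x\<close>.\<close>
  define \<psi> where "\<psi> k = (if k \<le> i then inl k else inr (k - i))" for k
  define h where "h = conj_perm (indiscrete (i + j)) \<psi> x"
  have pts: "points (indiscrete (i + j)) = {1..i + j}" by (simp add: indiscrete_def)
  have bij: "bij_betw \<psi> {1..i + j} (points (young i j))"
  proof (rule bij_betw_byWitness[where f' = "concat_map i"])
    have "inr (a - i) \<in> inr ` {1..j}" if "a \<in> {1..i + j}" "\<not> a \<le> i" for a
      using that by (intro imageI) auto
    then show "\<psi> ` {1..i + j} \<subseteq> points (young i j)" by (auto simp: \<psi>_def points_young)
  qed (auto simp: \<psi>_def points_young)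
  have h_perm: "h permutes points (young i j)"
    unfolding h_def using assms bij by (intro conj_perm_permutes) (simp_all add: pts)
  have app: "h (\<psi> a) = \<psi> (x a)" if "a \<in> {1..i + j}" for a
    unfolding h_def using that bij by (intro conj_perm_apply) (simp_all add: pts bij_betw_def)
  have \<psi>: "\<psi> (concat_map i z) = z" "concat_map i z \<in> {1..i + j}" if "z \<in> points (young i j)" for z
    using that by (auto simp: \<psi>_def points_young)
  have "(z, h z) \<in> sim (young i j)" if z: "z \<in> points (young i j)" for z
  proof -
    obtain a where a: "a \<in> {1..i + j}" "z = \<psi> a" using \<psi>[OF z] by metis
    have "x a \<le> i \<longleftrightarrow> a \<le> i" "x a \<in> {1..i + j}" using mem[of a] mem_all[of a] a(1) by auto
    then show ?thesis
      unfolding a(2) app[OF a(1)] using a(1) by (auto simp: \<psi>_def young_def indiscrete_def)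
  qed
  with h_perm have h: "h \<in> carrier (block_perms (young i j))" by (simp add: carrier_block_perms)
  have "young_emb i j h y = x y" for y
  proof (cases "y \<in> {1..i + j}")
    case True
    then have y: "y = concat_map i (\<psi> y)" "\<psi> y \<in> points (young i j)"
      using bij by (auto simp: \<psi>_def bij_betw_def)
    have xy: "concat_map i (\<psi> (x y)) = x y" by (simp add: \<psi>_def)
    have "young_emb i j h (concat_map i (\<psi> y)) = concat_map i (h (\<psi> y))"
      unfolding young_emb_def by (rule conj_perm_apply[OF inj_concat_map y(2)])
    then show ?thesis using y(1) app[OF True] xy by simp
  next
    case False
    then have "y \<notin> concat_map i ` points (young i j)"
      using concat_map_bij[of i j] by (simp add: bij_betw_def young_def)
    then show ?thesis
      unfolding young_emb_def using False assms by (simp add: conj_perm_outside permutes_not_in)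
  qed
  then have "young_emb i j h = x" by blast
  with h show "x \<in> young_emb i j ` carrier (block_perms (young i j))" by blast
qed

section \<open>Cosets of the Young subgroup as subsets of fixed size\<close>

lemma ex_permutes_image:
  assumes "finite A" "J \<subseteq> A" "S \<subseteq> A" "card S = card J"
  shows "\<exists>g. g permutes A \<and> g ` J = S"
proof -
  have fin: "finite J" "finite S" "finite (A - J)" "finite (A - S)"
    using assms finite_subset by auto
  obtain a where a: "bij_betw a J S" using finite_same_card_bij[OF fin(1,2)] assms(4) by auto
  obtain b where b: "bij_betw b (A - J) (A - S)"
    using finite_same_card_bij[OF fin(3,4)] assms fin by (auto simp: card_Diff_subset)
  define g where "g x = (if x \<in> J then a x else if x \<in> A then b x else x)" for x
  have "bij_betw g J S" using a by (subst bij_betw_cong[of _ _ a]) (auto simp: g_def)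
  moreover have "bij_betw g (A - J) (A - S)" using b by (subst bij_betw_cong[of _ _ b]) (auto simp: g_def)
  ultimately have "bij_betw g (J \<union> (A - J)) (S \<union> (A - S))" by (rule bij_betw_combine) auto
  then have "bij_betw g A A" using assms(2,3) by (simp add: Un_absorb1)
  then have "g permutes A" by (rule bij_imp_permutes) (use assms(2) in \<open>auto simp: g_def\<close>)
  moreover have "g ` J = S" using \<open>bij_betw g J S\<close> by (simp add: bij_betw_def)
  ultimately show ?thesis by blast
qed

text \<open>Since the subgroup is the stabiliser of the set of the last \<open>j\<close> points, a
  left coset is determined by the image of that set.\<close>

lemma inv_mult_mem_young_emb_iff:
  assumes "t permutes {1..i + j}" "g permutes {1..i + j}"
  shows "inv\<^bsub>block_perms (indiscrete (i + j))\<^esub> t \<circ> g \<in> young_emb i j ` carrier (block_perms (young i j)) \<longleftrightarrow>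
    t ` {i + 1..i + j} = g ` {i + 1..i + j}"
proof -
  let ?J = "{i + 1..i + j}"
  have "inv\<^bsub>block_perms (indiscrete (i + j))\<^esub> t = inv_into UNIV t"
    using assms by (simp add: m_inv_block_perms carrier_block_perms_indiscrete)
  moreover have "(inv_into UNIV t \<circ> g) permutes {1..i + j}"
    using assms by (intro permutes_compose permutes_inv)
  moreover have "(inv_into UNIV t \<circ> g) ` ?J = ?J \<longleftrightarrow> t ` ?J = g ` ?J"
    using permutes_inj[OF assms(1)] permutes_surj[OF assms(1)]
    by (metis image_comp image_f_inv_f image_inv_f_f)
  ultimately show ?thesis by (simp add: young_emb_image del: image_comp)
qed

lemma left_transversal_young_iff:
  "left_transversal (block_perms (indiscrete (i + j))) (young_emb i j ` carrier (block_perms (young i j))) ts \<longleftrightarrow>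
    (\<forall>t\<in>set ts. t permutes {1..i + j}) \<and>
    (\<forall>g. g permutes {1..i + j} \<longrightarrow> (\<exists>!k. k < length ts \<and> (ts ! k) ` {i + 1..i + j} = g ` {i + 1..i + j}))"
proof -
  have "(k < length ts \<and> inv\<^bsub>block_perms (indiscrete (i + j))\<^esub> (ts ! k) \<circ> g \<in> young_emb i j ` carrier (block_perms (young i j))) \<longleftrightarrow>
      (k < length ts \<and> (ts ! k) ` {i + 1..i + j} = g ` {i + 1..i + j})"
    if "\<forall>t\<in>set ts. t permutes {1..i + j}" "g permutes {1..i + j}" for g k
    using that inv_mult_mem_young_emb_iff[of "ts ! k" i j g] nth_mem[of k ts] by blast
  then show ?thesis
    unfolding left_transversal_def carrier_block_perms_indiscrete mult_block_perms mem_Collect_eq Ball_def subset_iff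
    by (simp cong: conj_cong imp_cong) blast?
qed

lemma left_transversal_young_exists:
  "\<exists>ts. left_transversal (block_perms (indiscrete (i + j))) (young_emb i j ` carrier (block_perms (young i j))) ts"
proof -
  let ?A = "{1..i + j}" and ?J = "{i + 1..i + j}"
  let ?X = "{S. S \<subseteq> ?A \<and> card S = j}"
  have "finite ?X" by simp
  then obtain Ss where Ss: "set Ss = ?X" "distinct Ss" using finite_distinct_list by metis
  have "\<forall>S\<in>?X. \<exists>g. g permutes ?A \<and> g ` ?J = S"
    by (auto intro!: ex_permutes_image)
  then obtain t where t: "\<And>S. S \<in> ?X \<Longrightarrow> t S permutes ?A \<and> t S ` ?J = S" by metis
  have nth: "Ss ! k \<in> ?X" if "k < length Ss" for k using that Ss(1) nth_mem by blast
  have nth_t: "(map t Ss ! k) ` ?J = Ss ! k" if "k < length Ss" for k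
    using t[OF nth[OF that]] that by (simp only: nth_map)
  have "\<exists>!k. k < length (map t Ss) \<and> (map t Ss ! k) ` ?J = g ` ?J" if "g permutes ?A" for g
  proof -
    have "g ` ?J \<in> set Ss"
      unfolding Ss(1) using permutes_image[OF that] permutes_inj_on[OF that] by (auto simp: card_image)
    then have "\<exists>!k. k < length Ss \<and> Ss ! k = g ` ?J" by (rule distinct_Ex1[OF Ss(2)])
    moreover have "k < length (map t Ss) \<and> (map t Ss ! k) ` ?J = g ` ?J \<longleftrightarrow> k < length Ss \<and> Ss ! k = g ` ?J" for k
      using nth_t[of k] by (cases "k < length Ss") (simp_all only: length_map simp_thms)
    ultimately show ?thesis by (simp only:)
  qed
  moreover have "\<forall>u\<in>set (map t Ss). u permutes ?A"
    using t Ss(1) by (simp only: set_map ball_simps) blast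
  ultimately have "left_transversal (block_perms (indiscrete (i + j))) (young_emb i j ` carrier (block_perms (young i j))) (map t Ss)"
    unfolding left_transversal_young_iff by blast
  then show ?thesis by blast
qed

text \<open>Stated for an arbitrary transversal, because the one inside \<open>induced\<close> is
  picked by \<open>SOME\<close>.\<close>

lemma bij_betw_transversal:
  assumes "left_transversal (block_perms (indiscrete (i + j))) (young_emb i j ` carrier (block_perms (young i j))) ts"
  shows "bij_betw (\<lambda>p. (ts ! p) ` {i + 1..i + j}) {..<length ts} {S. S \<subseteq> {1..i + j} \<and> card S = j}"
proof -
  let ?A = "{1..i + j}" and ?J = "{i + 1..i + j}"
  have t: "ts ! p permutes ?A" if "p < length ts" for p
    using assms[unfolded left_transversal_young_iff, THEN conjunct1] nth_mem[OF that] by (rule bspec)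
  have uniq: "\<exists>!k. k < length ts \<and> ts ! k ` ?J = g ` ?J" if "g permutes ?A" for g
    using assms[unfolded left_transversal_young_iff, THEN conjunct2] that by (elim allE impE)
  show ?thesis
  proof (rule bij_betw_imageI)
    show "inj_on (\<lambda>p. (ts ! p) ` ?J) {..<length ts}"
    proof (rule inj_onI)
      fix p q assume pq: "p \<in> {..<length ts}" "q \<in> {..<length ts}" and eq: "(ts ! p) ` ?J = (ts ! q) ` ?J"
      have ex: "\<exists>!k. k < length ts \<and> (ts ! k) ` ?J = (ts ! q) ` ?J" using uniq t pq by simp
      show "p = q" by (rule ex1E[OF ex]) (use pq eq in \<open>metis lessThan_iff\<close>)
    qed
    have "S \<in> (\<lambda>p. (ts ! p) ` ?J) ` {..<length ts}" if S: "S \<subseteq> ?A" "card S = j" for S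
    proof -
      obtain g where g: "g permutes ?A" "g ` ?J = S"
        using ex_permutes_image[of ?A ?J S] S by auto
      obtain k where "k < length ts" "(ts ! k) ` ?J = g ` ?J" using uniq[OF g(1)] by blast
      then show ?thesis using g(2) by blast
    qed
    moreover have "(ts ! p) ` ?J \<subseteq> ?A \<and> card ((ts ! p) ` ?J) = j" if "p < length ts" for p
      using permutes_image[OF t[OF that]] permutes_inj_on[OF t[OF that]] by (auto simp: card_image)
    ultimately show "(\<lambda>p. (ts ! p) ` ?J) ` {..<length ts} = {S. S \<subseteq> ?A \<and> card S = j}"
      by blast
  qed
qed

text \<open>The external product of the trivial and the sign representation in the shape produced by
  \<open>ext RU\<close>. As a dimension together with a function on permutations it is the same for
  all \<open>i\<close> and \<open>j\<close>.\<close>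

definition young_sign_rep :: "(nat \<Rightarrow> nat) rep" where
  "young_sign_rep = tensor (pullback left_perm trivial_rep) (pullback right_perm sign_rep)"

definition young_rep :: "nat \<Rightarrow> nat \<Rightarrow> (nat \<Rightarrow> nat) rep" where
  "young_rep i j = induced (block_perms (young i j)) (block_perms (indiscrete (i + j))) (young_emb i j) young_sign_rep"

lemma young_sign_rep_simps:
  "fst young_sign_rep = 1" "coef young_sign_rep h 0 0 = of_int (sign (right_perm h))"
  by (simp_all add: young_sign_rep_def tensor_def pullback_def trivial_rep_def sign_rep_def)

text \<open>The basis vector of the coset of \<open>t\<close> corresponds to \<open>e\<^bsub>t(J)\<^esub>\<close> for the set \<open>J\<close> of the last \<open>j\<close> points, up to the sign of \<open>t\<close> on \<open>J\<close>.\<close>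

lemma fam_iso_young_rep:
  "fam_iso (block_perms (indiscrete (i + j))) {..<fst (young_rep i j)} (coef (young_rep i j))
     {S. S \<subseteq> {1..i + j} \<and> card S = j} ext_fam"
proof -
  let ?G = "block_perms (indiscrete (i + j))" and ?H = "block_perms (young i j)"
  let ?A = "{1..i + j}" and ?J = "{i + 1..i + j}" and ?f = "young_emb i j"
  let ?K = "?f ` carrier ?H"
  define ts where "ts = (SOME ts. left_transversal ?G ?K ts)"
  have ts: "left_transversal ?G ?K ts"
    unfolding ts_def using left_transversal_young_exists by (rule someI_ex)
  have t: "ts ! p permutes ?A" if "p < length ts" for p
    using ts[unfolded left_transversal_young_iff, THEN conjunct1] nth_mem[OF that] by (rule bspec)
  define x where "x g p q = inv_into UNIV (ts ! p) \<circ> g \<circ> ts ! q" for g p q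
  have dim: "fst (young_rep i j) = length ts"
    by (simp add: young_rep_def induced_def Let_def ts_def young_sign_rep_simps)
  have coef: "coef (young_rep i j) g p q =
      (if x g p q \<in> ?K then of_int (sign (right_perm (the_inv_into (carrier ?H) ?f (x g p q)))) else 0)"
    if "p < length ts" "q < length ts" for g p q
    using that t by (simp add: young_rep_def induced_def Let_def ts_def[symmetric] young_sign_rep_simps x_def
        m_inv_block_perms carrier_block_perms_indiscrete)
  show ?thesis
  proof (rule fam_iso_monomial[where h = "\<lambda>p. (ts ! p) ` ?J" and s = "\<lambda>p. inv_sign (ts ! p) ?J"])
    show "bij_betw (\<lambda>p. (ts ! p) ` ?J) {..<fst (young_rep i j)} {S. S \<subseteq> ?A \<and> card S = j}"
      unfolding dim by (rule bij_betw_transversal[OF ts])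
    show "inv_sign (ts ! p) ?J \<noteq> 0" for p by (simp add: inv_sign_def)
    fix g p q assume "g \<in> carrier ?G" "p \<in> {..<fst (young_rep i j)}" "q \<in> {..<fst (young_rep i j)}"
    then have g: "g permutes ?A" and pq: "p < length ts" "q < length ts"
      by (simp_all add: carrier_block_perms_indiscrete dim)
    have gq: "(g \<circ> ts ! q) permutes ?A" using t[OF pq(2)] g by (rule permutes_compose)
    have x_perm: "x g p q permutes ?A"
      using t[OF pq(1)] gq by (simp add: x_def comp_assoc permutes_compose permutes_inv)
    \<comment> \<open>One permutation factored in two ways. Evaluating \<open>inv_sign\<close>
      multiplicatively on both factorisations gives the sign equation below.\<close>
    have tx: "ts ! p \<circ> x g p q = g \<circ> ts ! q"
      using permutes_inv_o(1)[OF t[OF pq(1)]] by (simp add: x_def comp_assoc[symmetric])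
    have inj: "inj_on f B" if "f permutes ?A" for f :: "nat \<Rightarrow> nat" and B
      using that by (rule permutes_inj_on)
    have K_iff: "x g p q \<in> ?K \<longleftrightarrow> (ts ! p) ` ?J = g ` (ts ! q) ` ?J"
      using inv_mult_mem_young_emb_iff[OF t[OF pq(1)] gq] t[OF pq(1)]
      by (simp add: x_def comp_assoc m_inv_block_perms carrier_block_perms_indiscrete image_comp)
    show "inv_sign (ts ! p) ?J * coef (young_rep i j) g p q =
        ext_fam g ((ts ! p) ` ?J) ((ts ! q) ` ?J) * inv_sign (ts ! q) ?J"
    proof (cases "x g p q \<in> ?K")
      case True
      then obtain h where h: "h \<in> carrier ?H" "x g p q = ?f h" by auto
      have xJ: "x g p q ` ?J = ?J" and "inv_sign (x g p q) ?J = of_int (sign (right_perm h))"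
        unfolding h(2) by (rule young_emb_tail[OF h(1)])+
      then have "inv_sign (ts ! p) ?J * coef (young_rep i j) g p q = inv_sign (ts ! p) (x g p q ` ?J) * inv_sign (x g p q) ?J"
        using True the_inv_into_f_f[OF young_emb_hom(2) h(1)] h(2) by (simp add: coef pq)
      also have "\<dots> = inv_sign (ts ! p \<circ> x g p q) ?J"
        using inj[OF x_perm] inj[OF t[OF pq(1)]] by (subst inv_sign_compose) auto
      also have "\<dots> = inv_sign g ((ts ! q) ` ?J) * inv_sign (ts ! q) ?J"
        unfolding tx using inj[OF g] inj[OF t[OF pq(2)]] by (subst inv_sign_compose) auto
      finally show ?thesis using True by (simp add: K_iff ext_fam_def)
    next
      case False
      then show ?thesis by (simp add: coef pq) (simp add: K_iff ext_fam_def)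
    qed
  qed simp
qed

text \<open>A family without entries between \<open>B\<close> and \<open>C\<close> is block diagonal
  on their union. This assembles exterior powers of several degrees while keeping the single family
  \<open>ext_fam\<close>.\<close>

lemma fam_iso_direct_sum_Un:
  assumes "is_rep G V" "is_rep G W" "fam_iso G {..<fst V} (coef V) B \<kappa>" "fam_iso G {..<fst W} (coef W) C \<kappa>"
    and "B \<inter> C = {}" "\<And>g b c. g \<in> carrier G \<Longrightarrow> b \<in> B \<Longrightarrow> c \<in> C \<Longrightarrow> \<kappa> g b c = 0 \<and> \<kappa> g c b = 0"
  shows "fam_iso G {..<fst (direct_sum V W)} (coef (direct_sum V W)) (B \<union> C) \<kappa>"
proof -
  have fin: "finite B" "finite C" using assms(3,4) by (auto simp: fam_iso_def)
  have "fam_iso G (B <+> C) (fam_sum \<kappa> \<kappa>) (B \<union> C) \<kappa>"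
  proof (rule fam_iso_reindex[where h = "case_sum id id"])
    show "bij_betw (case_sum id id) (B <+> C) (B \<union> C)"
      using assms(5) by (intro bij_betw_byWitness[where f' = "\<lambda>x. if x \<in> B then Inl x else Inr x"]) auto
  qed (use fin assms(6) in auto)
  with fam_iso_trans[OF fam_iso_direct_sum[OF assms(1,2)] fam_iso_sum[OF assms(3,4)]]
  show ?thesis by (auto intro: fam_iso_trans)
qed

text \<open>Toggling changes the parity of the cardinality, so between two even sets all
  intermediate sets are odd, and conversely. Both composites are then given by
  \<open>clifford_square\<close>, and division by \<open>m\<close> yields the inverse.\<close>

lemma fam_iso_even_odd:
  assumes "m > 0"
  shows "fam_iso (block_perms (indiscrete m)) {S. S \<subseteq> {1..m} \<and> even (card S)} ext_fam
    {S. S \<subseteq> {1..m} \<and> odd (card S)} ext_fam"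
proof -
  let ?A = "{1..m}"
  let ?E = "{S. S \<subseteq> ?A \<and> even (card S)}" and ?O = "{S. S \<subseteq> ?A \<and> odd (card S)}"
  have fin: "finite ?E" "finite ?O" by simp_all
  have finS: "finite S" if "S \<subseteq> ?A" for S using that finite_subset by blast
  have tog: "toggle k S \<subseteq> ?A" if "S \<subseteq> ?A" "k \<in> ?A" for k S
    using that by (rule toggle_subset[rotated])
  let ?Q = "\<lambda>S T. clifford m S T / of_nat m"
  have "inverse_fams ?E ?O (clifford m) ?Q"
    unfolding inverse_fams_def
  proof (intro conjI ballI)
    fix U S assume "U \<in> ?O" "S \<in> ?O"
    then have "(\<Sum>T\<in>?E. clifford m U T * clifford m T S) = of_nat m * of_bool (U = S)"
      using finS tog even_card_toggle by (intro clifford_square fin) auto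
    then show "(\<Sum>T\<in>?E. clifford m U T * ?Q T S) = of_bool (U = S)"
      using assms by (simp add: sum_divide_distrib[symmetric])
  next
    fix U S assume "U \<in> ?E" "S \<in> ?E"
    then have "(\<Sum>T\<in>?O. clifford m U T * clifford m T S) = of_nat m * of_bool (U = S)"
      using finS tog even_card_toggle by (intro clifford_square fin) auto
    then show "(\<Sum>T\<in>?O. ?Q U T * clifford m T S) = of_bool (U = S)"
      using assms by (simp add: sum_divide_distrib[symmetric])
  qed
  moreover have "intertwines (block_perms (indiscrete m)) ?E ext_fam ?O ext_fam (clifford m)"
    unfolding intertwines_def
  proof (intro ballI)
    fix g U S assume "g \<in> carrier (block_perms (indiscrete m))" and U: "U \<in> ?O" and S: "S \<in> ?E"
    then have g: "g permutes ?A" by (simp add: carrier_block_perms_indiscrete)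
    have card: "card (g ` B) = card B" for B using permutes_inj_on[OF g] by (rule card_image)
    have img: "g ` B \<subseteq> ?A" if "B \<subseteq> ?A" for B using that permutes_image[OF g] by blast
    \<comment> \<open>In the row of \<open>U\<close>, the only nonzero entry of
      \<open>ext_fam g\<close> is at the preimage of \<open>U\<close> under
      \<open>g\<close>.\<close>
    define T where "T = inv_into UNIV g ` U"
    have T: "g ` T = U" unfolding T_def by (rule image_f_inv_f) (rule permutes_surj[OF g])
    have "T \<subseteq> ?A" unfolding T_def using U permutes_image[OF permutes_inv[OF g]] by blast
    moreover have "card T = card U" using card[of T] T by simp
    ultimately have TO: "T \<in> ?O" using U by simp
    have "(\<Sum>S'\<in>?E. clifford m U S' * ext_fam g S' S) = (\<Sum>S'\<in>?E. if S' = g ` S then clifford m U S' * inv_sign g S else 0)"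
      by (intro sum.cong refl) (simp add: ext_fam_def)
    also have "\<dots> = clifford m (g ` T) (g ` S) * inv_sign g S"
      using fin S img[of S] by (simp add: sum.delta card T)
    also have "\<dots> = inv_sign g T * clifford m T S"
      using g S TO by (intro clifford_equivariant) auto
    also have "\<dots> = (\<Sum>T'\<in>?O. if T' = T then inv_sign g T' * clifford m T' S else 0)"
      using fin TO by (simp add: sum.delta)
    also have "\<dots> = (\<Sum>T'\<in>?O. ext_fam g U T' * clifford m T' S)"
    proof (intro sum.cong refl)
      fix T'
      have "U = g ` T' \<longleftrightarrow> T' = T"
        unfolding T[symmetric] inj_image_eq_iff[OF permutes_inj[OF g]] by blast
      then show "(if T' = T then inv_sign g T' * clifford m T' S else 0) = ext_fam g U T' * clifford m T' S"
        by (simp add: ext_fam_def)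
    qed
    finally show "(\<Sum>S'\<in>?E. clifford m U S' * ext_fam g S' S) = (\<Sum>T'\<in>?O. ext_fam g U T' * clifford m T' S)" .
  qed
  ultimately show ?thesis using fin by (auto simp: fam_iso_def)
qed

section \<open>The operations of \<open>RU\<close> on classes of representations\<close>

lemma rep_ring_pullback_rep_class:
  assumes "monoid H" "monoid G" "f \<in> hom H G" "f \<one>\<^bsub>H\<^esub> = \<one>\<^bsub>G\<^esub>" "is_rep G V"
  shows "rep_ring_pullback H f (rep_class G V) = rep_class H (pullback f V)"
proof -
  note rp = is_rep_pullback[OF assms(3,4)]
  have "iso_class H (pullback f zero_rep) = iso_class H zero_rep"
    by (intro iso_class_zero rp is_rep_zero) (simp add: pullback_def zero_rep_def)
  then show ?thesis
    using assms rp[OF assms(5)] rp[OF is_rep_zero]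
    by (simp add: rep_class_def rep_ring_pullback_virtual virtual_eq_iff groth_relI)
qed

lemma is_rep_young_sign: "is_rep (block_perms (young i j)) young_sign_rep"
proof -
  note homs = perm_projections_hom[OF is_partition_indiscrete is_partition_indiscrete, of i j, folded young_def]
  show ?thesis
    unfolding young_sign_rep_def
    by (intro is_rep_tensor monoid_block_perms is_rep_pullback[OF homs(1)] is_rep_pullback[OF homs(2)]
        is_rep_trivial is_rep_sign) simp_all
qed

lemma ext_RU_one_sign:
  "ext RU (indiscrete i) (indiscrete j) (rep_class (block_perms (indiscrete i)) trivial_rep)
     (rep_class (block_perms (indiscrete j)) sign_rep) = rep_class (block_perms (young i j)) young_sign_rep"
proof -
  note homs = perm_projections_hom[OF is_partition_indiscrete is_partition_indiscrete, of i j, folded young_def]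
  have m: "monoid (block_perms (young i j))" "monoid (block_perms (indiscrete k))" for k
    by (simp_all add: monoid_block_perms)
  have p: "is_rep (block_perms (young i j)) (pullback left_perm trivial_rep)"
    "is_rep (block_perms (young i j)) (pullback right_perm sign_rep)"
    by (rule is_rep_pullback[OF homs(1)] is_rep_pullback[OF homs(2)]; simp add: is_rep_trivial is_rep_sign)+
  show ?thesis
    using rep_ring_pullback_rep_class[OF m homs(1) _ is_rep_trivial]
      rep_ring_pullback_rep_class[OF m homs(2) _ is_rep_sign[OF is_partition_indiscrete]]
      rep_class_mult[OF m(1) p]
    by (simp add: RU_def young_def[symmetric] young_sign_rep_def)
qed

lemma
  shows is_rep_young_rep: "is_rep (block_perms (indiscrete (i + j))) (young_rep i j)"
    and tr_RU_young_sign: "tr RU (young i j) (indiscrete (i + j)) (concat_map i)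
      (rep_class (block_perms (young i j)) young_sign_rep) =
      rep_class (block_perms (indiscrete (i + j))) (young_rep i j)"
proof -
  note ind = group_block_perms[OF is_partition_young] group_block_perms[OF is_partition_indiscrete]
    young_emb_hom[of i j] left_transversal_young_exists[of i j]
  show "is_rep (block_perms (indiscrete (i + j))) (young_rep i j)"
    unfolding young_rep_def by (rule rep_ring_induced_virtual(2)[OF ind is_rep_young_sign is_rep_zero])
  show "tr RU (young i j) (indiscrete (i + j)) (concat_map i)
      (rep_class (block_perms (young i j)) young_sign_rep) =
      rep_class (block_perms (indiscrete (i + j))) (young_rep i j)"
    using rep_ring_induced_rep_class[OF ind is_rep_young_sign]
    by (simp add: RU_def young_rep_def young_emb_def)
qed

text \<open>Realises a sum of values of \<open>\<psi>\<close> as the value on one honest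
  representation, to which an isomorphism can then be applied. Exterior powers are added one degree
  at a time, and the sums are formed in the target group \<open>A\<close>.\<close>

lemma ex_rep_ext_powers:
  fixes \<psi> :: "virtual_rep \<Rightarrow> 'r" and A (structure)
  assumes "abelian_group A" "\<psi> \<in> carrier (rep_ring (block_perms (indiscrete m))) \<rightarrow> carrier A"
    and add: "\<And>x y. x \<in> carrier (rep_ring (block_perms (indiscrete m))) \<Longrightarrow> y \<in> carrier (rep_ring (block_perms (indiscrete m))) \<Longrightarrow>
      \<psi> (x \<oplus>\<^bsub>rep_ring (block_perms (indiscrete m))\<^esub> y) = \<psi> x \<oplus> \<psi> y"
    and J: "J \<subseteq> {..m}"
  shows "\<exists>E. is_rep (block_perms (indiscrete m)) E \<and>
    fam_iso (block_perms (indiscrete m)) {..<fst E} (coef E) {S. S \<subseteq> {1..m} \<and> card S \<in> J} ext_fam \<and>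
    \<psi> (rep_class (block_perms (indiscrete m)) E) =
      (\<Oplus>j\<in>J. \<psi> (rep_class (block_perms (indiscrete m)) (young_rep (m - j) j)))"
proof -
  let ?G = "block_perms (indiscrete m)"
  interpret abelian_group A by fact
  have mon: "monoid ?G" by (simp add: monoid_block_perms)
  have closed: "\<psi> (rep_class ?G V) \<in> carrier A" if "is_rep ?G V" for V
    using assms(2) rep_class_closed[OF that] by blast
  have young: "is_rep ?G (young_rep (m - j) j)"
    "fam_iso ?G {..<fst (young_rep (m - j) j)} (coef (young_rep (m - j) j)) {S. S \<subseteq> {1..m} \<and> card S = j} ext_fam"
    if "j \<le> m" for j
    using is_rep_young_rep[of "m - j" j] fam_iso_young_rep[of "m - j" j] that by simp_all
  have young_closed: "\<psi> (rep_class ?G (young_rep (m - j) j)) \<in> carrier A" if "j \<le> m" for j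
    using closed young(1) that by blast
  have "finite J" using J finite_subset by blast
  then show ?thesis using J
  proof (induction J rule: finite_induct)
    case empty
    have ds: "is_rep ?G (direct_sum zero_rep zero_rep)" by (intro is_rep_direct_sum mon is_rep_zero)
    have "rep_class ?G (direct_sum zero_rep zero_rep) = rep_class ?G zero_rep"
      by (intro rep_class_cong mon ds is_rep_zero rep_iso_dim_zero) (simp_all add: zero_rep_def direct_sum_def)
    \<comment> \<open>An element of an abelian group that equals its own double is zero, so
      additivity of \<open>\<psi>\<close> settles the empty sum.\<close>
    then have "\<psi> (rep_class ?G zero_rep) = \<psi> (rep_class ?G zero_rep) \<oplus> \<psi> (rep_class ?G zero_rep)"
      using add[OF rep_class_closed rep_class_closed, OF is_rep_zero is_rep_zero]
      by (simp add: rep_class_direct_sum mon)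
    then have "\<psi> (rep_class ?G zero_rep) = \<zero>"
      using closed[OF is_rep_zero] by (simp add: add.l_cancel_one')
    moreover have "fst (zero_rep :: (nat \<Rightarrow> nat) rep) = 0" by (simp add: zero_rep_def)
    ultimately show ?case
      by (intro exI[of _ zero_rep]) (simp add: fam_iso_def inverse_fams_def intertwines_def)
  next
    case (insert j J)
    then obtain E where E: "is_rep ?G E" "fam_iso ?G {..<fst E} (coef E) {S. S \<subseteq> {1..m} \<and> card S \<in> J} ext_fam"
      "\<psi> (rep_class ?G E) = (\<Oplus>j\<in>J. \<psi> (rep_class ?G (young_rep (m - j) j)))"
      by auto
    have j: "j \<le> m" using insert.prems by simp
    let ?V = "young_rep (m - j) j"
    have eq: "{S. S \<subseteq> {1..m} \<and> card S \<in> insert j J} = {S. S \<subseteq> {1..m} \<and> card S = j} \<union> {S. S \<subseteq> {1..m} \<and> card S \<in> J}"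
      by auto
    have iso: "fam_iso ?G {..<fst (direct_sum ?V E)} (coef (direct_sum ?V E))
        ({S. S \<subseteq> {1..m} \<and> card S = j} \<union> {S. S \<subseteq> {1..m} \<and> card S \<in> J}) ext_fam"
    proof (rule fam_iso_direct_sum_Un[OF young(1)[OF j] E(1) young(2)[OF j] E(2)])
      fix g b c assume "g \<in> carrier ?G" "b \<in> {S. S \<subseteq> {1..m} \<and> card S = j}" "c \<in> {S. S \<subseteq> {1..m} \<and> card S \<in> J}"
      moreover from this have "card (g ` B) = card B" for B
        by (intro card_image permutes_inj_on) (simp add: carrier_block_perms_indiscrete)
      ultimately show "ext_fam g b c = 0 \<and> ext_fam g c b = 0"
        using insert.hyps(2) by (auto simp: ext_fam_def)
    qed (use insert.hyps(2) in auto)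
    have sum: "\<psi> (rep_class ?G (direct_sum ?V E)) = (\<Oplus>j\<in>insert j J. \<psi> (rep_class ?G (young_rep (m - j) j)))"
      using insert.hyps insert.prems young(1)[OF j] E mon young_closed
      by (subst finsum_insert) (auto simp: rep_class_direct_sum add rep_class_closed)
    show ?case
      unfolding eq by (intro exI[of _ "direct_sum ?V E"] conjI is_rep_direct_sum[OF mon young(1)[OF j] E(1)] iso sum)
  qed
qed

text \<open>The two sums are values of \<open>\<psi>\<close> on representations \<open>E\<close> and
  \<open>F\<close> with the even and the odd subsets as bases. Clifford multiplication makes
  \<open>E\<close> and \<open>F\<close> isomorphic, so their classes coincide.\<close>

lemma ext_powers_even_odd:
  fixes \<psi> :: "virtual_rep \<Rightarrow> 'r" and A (structure)
  assumes "abelian_group A" "\<psi> \<in> carrier (rep_ring (block_perms (indiscrete m))) \<rightarrow> carrier A"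
    and "\<And>x y. x \<in> carrier (rep_ring (block_perms (indiscrete m))) \<Longrightarrow> y \<in> carrier (rep_ring (block_perms (indiscrete m))) \<Longrightarrow>
      \<psi> (x \<oplus>\<^bsub>rep_ring (block_perms (indiscrete m))\<^esub> y) = \<psi> x \<oplus> \<psi> y"
    and "m > 0"
  shows "(\<Oplus>j\<in>{j. j \<le> m \<and> even j}. \<psi> (rep_class (block_perms (indiscrete m)) (young_rep (m - j) j))) =
    (\<Oplus>j\<in>{j. j \<le> m \<and> odd j}. \<psi> (rep_class (block_perms (indiscrete m)) (young_rep (m - j) j)))"
proof -
  let ?G = "block_perms (indiscrete m)"
  have ex: "\<exists>E. is_rep ?G E \<and>
    fam_iso ?G {..<fst E} (coef E) {S. S \<subseteq> {1..m} \<and> card S \<in> J} ext_fam \<and>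
    \<psi> (rep_class ?G E) = (\<Oplus>j\<in>J. \<psi> (rep_class ?G (young_rep (m - j) j)))" if "J \<subseteq> {..m}" for J
    by (rule ex_rep_ext_powers[OF assms(1,2) _ that]) (rule assms(3))
  have card: "card S \<le> m" if "S \<subseteq> {1..m}" for S using card_mono[OF _ that] by simp
  have sets: "{S. S \<subseteq> {1..m} \<and> card S \<in> {j. j \<le> m \<and> P j}} = {S. S \<subseteq> {1..m} \<and> P (card S)}" for P
    using card by auto
  have sub: "{j. j \<le> m \<and> P j} \<subseteq> {..m}" for P by auto
  obtain E where E: "is_rep ?G E" "fam_iso ?G {..<fst E} (coef E) {S. S \<subseteq> {1..m} \<and> even (card S)} ext_fam"
    "\<psi> (rep_class ?G E) = (\<Oplus>j\<in>{j. j \<le> m \<and> even j}. \<psi> (rep_class ?G (young_rep (m - j) j)))"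
    using ex[OF sub[of even]] unfolding sets by (elim exE conjE) (rule that)
  obtain F where F: "is_rep ?G F" "fam_iso ?G {..<fst F} (coef F) {S. S \<subseteq> {1..m} \<and> odd (card S)} ext_fam"
    "\<psi> (rep_class ?G F) = (\<Oplus>j\<in>{j. j \<le> m \<and> odd j}. \<psi> (rep_class ?G (young_rep (m - j) j)))"
    using ex[OF sub[of odd]] unfolding sets by (elim exE conjE) (rule that)
  have "rep_iso ?G E F"
    using fam_iso_trans[OF fam_iso_trans[OF E(2) fam_iso_even_odd[OF assms(4)]] fam_iso_sym[OF F(2)]] E(1) F(1)
    by (simp add: rep_iso_iff_fam_iso)
  then have "rep_class ?G E = rep_class ?G F"
    using E(1) F(1) by (intro rep_class_cong monoid_block_perms) simp_all
  then show ?thesis using E(3) F(3) by simp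
qed

section \<open>The transfer product\<close>

lemma morphism_swap_map:
  assumes "is_partition \<Lambda>" "is_partition \<Omega>"
  shows "morphism (disj_union \<Lambda> \<Omega>) (disj_union \<Omega> \<Lambda>) swap_map"
proof -
  have "bij_betw swap_map (points (disj_union \<Lambda> \<Omega>)) (points (disj_union \<Omega> \<Lambda>))"
    by (rule bij_betw_byWitness[where f' = swap_map]) (auto simp: swap_map_def points_disj_union)
  then show ?thesis
    using assms by (auto simp: morphism_def is_partition_disj_union) (auto simp: disj_union_def swap_map_def)
qed

context partition_ring
begin

lemma cring_deg: "cring (deg R m)"
  by (simp add: deg_def cring_obj)

lemma abelian_group_deg: "abelian_group (deg R m)"
  using cring_deg by (simp add: cring_def ring_def)

lemma transfer_prod_eq:
  "transfer_prod R i j x y = tr R (young i j) (indiscrete (i + j)) (concat_map i) (ext R (indiscrete i) (indiscrete j) x y)"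
  by (simp add: transfer_prod_def young_def)

lemma tr_concat_hom:
  "tr R (young i j) (indiscrete (i + j)) (concat_map i) \<in> hom (add_monoid (obj R (young i j))) (add_monoid (deg R (i + j)))"
  unfolding young_def deg_def by (rule tr_hom[OF morphism_concat_map])

lemma ext_young_closed:
  "x \<in> carrier (deg R i) \<Longrightarrow> y \<in> carrier (deg R j) \<Longrightarrow> ext R (indiscrete i) (indiscrete j) x y \<in> carrier (obj R (young i j))"
  unfolding young_def deg_def by (rule ext_closed) simp_all

lemma transfer_prod_closed:
  "x \<in> carrier (deg R i) \<Longrightarrow> y \<in> carrier (deg R j) \<Longrightarrow> transfer_prod R i j x y \<in> carrier (deg R (i + j))"
  using tr_concat_hom[of i j] ext_young_closed[of x i y j] by (auto simp: transfer_prod_eq hom_def)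

lemma transfer_prod_hom_left:
  assumes "y \<in> carrier (deg R j)"
  shows "(\<lambda>x. transfer_prod R i j x y) \<in> hom (add_monoid (deg R i)) (add_monoid (deg R (i + j)))"
proof (rule homI)
  fix x x' assume x: "x \<in> carrier (add_monoid (deg R i))" "x' \<in> carrier (add_monoid (deg R i))"
  then have "ext R (indiscrete i) (indiscrete j) (x \<oplus>\<^bsub>deg R i\<^esub> x') y =
      ext R (indiscrete i) (indiscrete j) x y \<oplus>\<^bsub>obj R (young i j)\<^esub> ext R (indiscrete i) (indiscrete j) x' y"
    using assms unfolding young_def deg_def by (intro ext_add_left) simp_all
  then show "transfer_prod R i j (x \<otimes>\<^bsub>add_monoid (deg R i)\<^esub> x') y =
      transfer_prod R i j x y \<otimes>\<^bsub>add_monoid (deg R (i + j))\<^esub> transfer_prod R i j x' y"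
    using hom_mult[OF tr_concat_hom[of i j]] x assms ext_young_closed by (simp add: transfer_prod_eq)
qed (use transfer_prod_closed assms in simp)

lemma transfer_prod_uminus_left:
  assumes "x \<in> carrier (deg R i)" "y \<in> carrier (deg R j)"
  shows "transfer_prod R i j (\<ominus>\<^bsub>deg R i\<^esub> x) y = \<ominus>\<^bsub>deg R (i + j)\<^esub> transfer_prod R i j x y"
proof -
  interpret A: abelian_group "deg R i" by (rule abelian_group_deg)
  interpret B: abelian_group "deg R (i + j)" by (rule abelian_group_deg)
  interpret group_hom "add_monoid (deg R i)" "add_monoid (deg R (i + j))" "\<lambda>x. transfer_prod R i j x y"
    by (intro group_hom.intro group_hom_axioms.intro A.a_group B.a_group transfer_prod_hom_left assms(2))
  show ?thesis using hom_inv assms(1) by (simp add: a_inv_def)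
qed

text \<open>Swapping the summands before concatenating permutes the points differently, but the
  target has a single block, so the two morphisms are 2-isomorphic and have the same
  transfer.\<close>

lemma transfer_prod_commute:
  assumes "x \<in> carrier (deg R i)" "y \<in> carrier (deg R j)"
  shows "transfer_prod R j i y x = transfer_prod R i j x y"
proof -
  let ?e = "ext R (indiscrete i) (indiscrete j) x y"
  have e: "?e \<in> carrier (obj R (young i j))" using assms by (rule ext_young_closed)
  have swap: "morphism (young i j) (young j i) swap_map"
    unfolding young_def by (intro morphism_swap_map) simp_all
  have mor: "morphism (young i j) (indiscrete (i + j)) (concat_map i)"
    "morphism (young j i) (indiscrete (i + j)) (concat_map j)"
    using morphism_concat_map[of i j] morphism_concat_map[of j i] by (simp_all add: young_def add.commute)
  have mor': "morphism (young i j) (indiscrete (i + j)) (concat_map j \<circ> swap_map)"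
    using swap mor(2) by (auto simp: morphism_def intro: bij_betw_trans)
  have "two_isomorphic (young i j) (indiscrete (i + j)) (concat_map j \<circ> swap_map) (concat_map i)"
    using mor(1) mor' by (auto simp: two_isomorphic_def morphism_def indiscrete_def dest!: bij_betwE)
  then have "tr R (young i j) (indiscrete (i + j)) (concat_map i) ?e =
      tr R (young j i) (indiscrete (i + j)) (concat_map j) (tr R (young i j) (young j i) swap_map ?e)"
    using tr_two_iso[OF mor' mor(1) _ e] tr_comp[OF swap mor(2) e] by simp
  also have "tr R (young i j) (young j i) swap_map ?e = ext R (indiscrete j) (indiscrete i) y x"
    using assms unfolding young_def deg_def by (intro ext_sym) simp_all
  finally show ?thesis by (simp add: transfer_prod_eq add.commute)
qed

text \<open>The exponential condition exhibits the external product of \<open>r i\<close> and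
  \<open>r j\<close> as a restriction of \<open>r (i + j)\<close>, and \<open>projection\<close>
  moves a restricted factor out of a transfer.\<close>

lemma transfer_prod_mult_exponential:
  assumes "exponential R r" "x \<in> carrier (deg R i)" "y \<in> carrier (deg R j)"
  shows "transfer_prod R i j (x \<otimes>\<^bsub>deg R i\<^esub> r i) (y \<otimes>\<^bsub>deg R j\<^esub> r j) =
    r (i + j) \<otimes>\<^bsub>deg R (i + j)\<^esub> transfer_prod R i j x y"
proof -
  let ?e = "ext R (indiscrete i) (indiscrete j)"
  interpret Y: cring "obj R (young i j)" by (simp add: cring_obj)
  have r: "r k \<in> carrier (deg R k)" for k using assms(1) by (auto simp: exponential_def power_series_def)
  have "?e (x \<otimes>\<^bsub>deg R i\<^esub> r i) (y \<otimes>\<^bsub>deg R j\<^esub> r j) = ?e x y \<otimes>\<^bsub>obj R (young i j)\<^esub> ?e (r i) (r j)"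
    using assms r unfolding young_def deg_def by (intro ext_mult) simp_all
  also have "\<dots> = ?e (r i) (r j) \<otimes>\<^bsub>obj R (young i j)\<^esub> ?e x y"
    using assms r by (intro Y.m_comm ext_young_closed)
  also have "?e (r i) (r j) = res R (young i j) (indiscrete (i + j)) (concat_map i) (r (i + j))"
    using assms(1) by (simp add: exponential_def young_def)
  finally show ?thesis
    using projection[OF morphism_concat_map[of i j, folded young_def] r[of "i + j", unfolded deg_def] ext_young_closed[OF assms(2,3)]]
    by (simp add: transfer_prod_eq deg_def)
qed

text \<open>The unit of the external product is \<open>unit_map R 1\<close>, whereas the constant
  term of a series is compared with the ring identity in degree 0; the first hypothesis identifies
  them.\<close>

lemma transfer_prod_one_left:
  assumes "unit_map R 1 = \<one>\<^bsub>deg R 0\<^esub>" "y \<in> carrier (deg R j)"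
  shows "transfer_prod R 0 j \<one>\<^bsub>deg R 0\<^esub> y = y"
proof -
  have "concat_map 0 = unit_coh" by (simp add: concat_map_def unit_coh_def id_def)
  then show ?thesis
    using ext_unit_left[of "indiscrete j" y] assms by (simp add: transfer_prod_def deg_def)
qed

text \<open>The coefficients of a right inverse are determined recursively; this avoids associativity of the transfer product.\<close>

lemma right_inverse_unique:
  assumes "unit_map R 1 = \<one>\<^bsub>deg R 0\<^esub>" "x \<in> carrier (power_series R)" "x 0 = \<one>\<^bsub>deg R 0\<^esub>"
    and "y \<in> carrier (power_series R)" "z \<in> carrier (power_series R)"
    and "x \<otimes>\<^bsub>power_series R\<^esub> y = x \<otimes>\<^bsub>power_series R\<^esub> z"
  shows "y = z"
proof
  fix m show "y m = z m"
  proof (induction m rule: less_induct)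
    case (less m)
    interpret abelian_group "deg R m" by (rule abelian_group_deg)
    have c: "x k \<in> carrier (deg R k)" "y k \<in> carrier (deg R k)" "z k \<in> carrier (deg R k)" for k
      using assms by (auto simp: power_series_def)
    have tp: "transfer_prod R i (m - i) (x i) (w (m - i)) \<in> carrier (deg R m)"
      if "i \<le> m" "\<And>k. w k \<in> carrier (deg R k)" for i w
      using transfer_prod_closed[of "x i" i "w (m - i)" "m - i"] c that by simp
    \<comment> \<open>The summand \<open>i = 0\<close> isolates \<open>w m\<close>, because
      \<open>x 0\<close> is the identity; the other summands involve coefficients of
      \<open>w\<close> of degree below \<open>m\<close> only.\<close>
    have split: "(x \<otimes>\<^bsub>power_series R\<^esub> w) m =
        w m \<oplus>\<^bsub>deg R m\<^esub> finsum (deg R m) (\<lambda>i. transfer_prod R i (m - i) (x i) (w (m - i))) {1..m}"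
      if w: "\<And>k. w k \<in> carrier (deg R k)" for w
    proof -
      have "{..m} = insert 0 {1..m}" by auto
      then show ?thesis
        using tp[OF _ w] w[of m] transfer_prod_one_left[OF assms(1) w, of m]
        by (simp add: power_series_def assms(3) Pi_def)
    qed
    have "finsum (deg R m) (\<lambda>i. transfer_prod R i (m - i) (x i) (y (m - i))) {1..m} =
        finsum (deg R m) (\<lambda>i. transfer_prod R i (m - i) (x i) (z (m - i))) {1..m}" (is "?Y = ?Z")
      using less tp[of _ z] c by (intro finsum_cong') auto
    moreover have "y m \<oplus>\<^bsub>deg R m\<^esub> ?Y = z m \<oplus>\<^bsub>deg R m\<^esub> ?Z"
      using fun_cong[OF assms(6), of m] split c by simp
    moreover have "?Z \<in> carrier (deg R m)" using tp[of _ z] c by (intro finsum_closed) auto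
    ultimately show ?case using c by simp
  qed
qed

end

section \<open>The inverse of an exponential series\<close>

lemma obj_RU: "obj RU \<Lambda> = rep_ring (block_perms \<Lambda>)"
  by (simp add: RU_def)

text \<open>In \<open>RU\<close> the unit map sends 1 to the ring identity, and
  \<open>\<phi>\<close> preserves both the unit map and the identity.\<close>

lemma partition_ring_map_unit:
  assumes "partition_ring_map RU R \<phi>"
  shows "unit_map R 1 = \<one>\<^bsub>deg R 0\<^esub>"
proof -
  let ?G = "block_perms (indiscrete 0)"
  have mon: "monoid ?G" by (simp add: monoid_block_perms)
  have ds: "is_rep ?G (direct_sum zero_rep trivial_rep)"
    by (intro is_rep_direct_sum mon is_rep_zero is_rep_trivial)
  have "iso_class ?G (direct_sum zero_rep trivial_rep) = iso_class ?G trivial_rep"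
    using iso_add_zero[OF mon is_rep_trivial] iso_add_commute[OF mon, of "iso_class ?G zero_rep"]
    by (simp only: iso_class_direct_sum[OF mon is_rep_zero is_rep_trivial])
  then have "rep_class ?G (direct_sum zero_rep trivial_rep) = rep_class ?G trivial_rep"
    using rep_class_cong[OF mon ds is_rep_trivial] iso_class_eq_iff[OF ds is_rep_trivial] by blast
  \<comment> \<open>The integer multiple by 1 unfolds to zero plus the element, so this neutrality
    law is what evaluates \<open>unit_map RU 1\<close>.\<close>
  then have "\<zero>\<^bsub>rep_ring ?G\<^esub> \<oplus>\<^bsub>rep_ring ?G\<^esub> \<one>\<^bsub>rep_ring ?G\<^esub> = \<one>\<^bsub>rep_ring ?G\<^esub>"
    using rep_class_direct_sum[OF mon is_rep_zero is_rep_trivial] by (simp add: rep_ring_def)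
  then have "unit_map RU 1 = \<one>\<^bsub>obj RU (indiscrete 0)\<^esub>"
    by (simp add: RU_def add_pow_def int_pow_def nat_pow_def)
  moreover have "\<phi> (indiscrete 0) (unit_map RU 1) = unit_map R 1"
    "\<phi> (indiscrete 0) \<in> ring_hom (obj RU (indiscrete 0)) (obj R (indiscrete 0))"
    using assms by (simp_all add: partition_ring_map_def)
  ultimately show ?thesis by (simp add: ring_hom_def deg_def)
qed

lemma sign_element_zero:
  assumes "partition_ring_map RU R \<phi>"
  shows "sign_element \<phi> 0 = \<one>\<^bsub>deg R 0\<^esub>"
proof -
  let ?G = "block_perms (indiscrete 0)"
  have "carrier ?G = {id}" by (simp add: carrier_block_perms_indiscrete)
  then have "rep_iso ?G sign_rep trivial_rep"
    using is_rep_sign[OF is_partition_indiscrete, of 0] is_rep_trivial[of ?G]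
    by (simp add: rep_iso_iff_fam_iso)
      (intro fam_iso_reindex[where h = id], auto simp: sign_rep_def trivial_rep_def)
  then have "rep_class ?G sign_rep = \<one>\<^bsub>obj RU (indiscrete 0)\<^esub>"
    using is_rep_sign[OF is_partition_indiscrete, of 0] is_rep_trivial[of ?G]
    by (simp add: obj_RU rep_ring_def rep_class_cong monoid_block_perms)
  moreover have "\<phi> (indiscrete 0) \<in> ring_hom (obj RU (indiscrete 0)) (obj R (indiscrete 0))"
    using assms by (simp add: partition_ring_map_def)
  ultimately show ?thesis by (simp add: sign_element_def ring_hom_def deg_def)
qed

lemma sign_element_closed:
  assumes "partition_ring_map RU R \<phi>"
  shows "sign_element \<phi> m \<in> carrier (deg R m)"
proof -
  have "\<phi> (indiscrete m) \<in> ring_hom (obj RU (indiscrete m)) (obj R (indiscrete m))"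
    using assms by (simp add: partition_ring_map_def)
  then show ?thesis
    using rep_class_closed[OF is_rep_sign[OF is_partition_indiscrete, of m]]
    by (auto simp: ring_hom_def sign_element_def obj_RU deg_def)
qed

text \<open>\<open>\<phi>\<close> commutes with external products and transfers, so a transfer
  product in \<open>R\<close> is computed in \<open>RU\<close>, where it is the class of an induced
  representation.\<close>

lemma transfer_prod_one_sign:
  assumes "partition_ring_map RU R \<phi>"
  shows "\<phi> (indiscrete (i + j)) (rep_class (block_perms (indiscrete (i + j))) (young_rep i j)) =
    transfer_prod R i j \<one>\<^bsub>deg R i\<^esub> (sign_element \<phi> j)"
proof -
  let ?one = "rep_class (block_perms (indiscrete i)) trivial_rep"
  let ?sgn = "rep_class (block_perms (indiscrete j)) sign_rep"
  let ?Y = "rep_class (block_perms (young i j)) young_sign_rep"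
  have c: "?one \<in> carrier (obj RU (indiscrete i))" "?sgn \<in> carrier (obj RU (indiscrete j))" "?Y \<in> carrier (obj RU (young i j))"
    by (simp_all add: obj_RU rep_class_closed is_rep_trivial is_rep_sign is_rep_young_sign)
  have hom: "\<phi> (indiscrete i) \<in> ring_hom (obj RU (indiscrete i)) (obj R (indiscrete i))"
    and tr: "\<And>\<Lambda> \<Omega> f a. morphism \<Lambda> \<Omega> f \<Longrightarrow> a \<in> carrier (obj RU \<Lambda>) \<Longrightarrow> \<phi> \<Omega> (tr RU \<Lambda> \<Omega> f a) = tr R \<Lambda> \<Omega> f (\<phi> \<Lambda> a)"
    and ext: "\<And>\<Lambda> \<Omega> a b. is_partition \<Lambda> \<Longrightarrow> is_partition \<Omega> \<Longrightarrow> a \<in> carrier (obj RU \<Lambda>) \<Longrightarrow> b \<in> carrier (obj RU \<Omega>) \<Longrightarrow>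
      \<phi> (disj_union \<Lambda> \<Omega>) (ext RU \<Lambda> \<Omega> a b) = ext R \<Lambda> \<Omega> (\<phi> \<Lambda> a) (\<phi> \<Omega> b)"
    using assms by (simp_all add: partition_ring_map_def)
  have "\<phi> (indiscrete i) ?one = \<one>\<^bsub>deg R i\<^esub>"
    using hom by (simp add: ring_hom_def obj_RU deg_def rep_ring_def)
  then have Y: "\<phi> (young i j) ?Y = ext R (indiscrete i) (indiscrete j) \<one>\<^bsub>deg R i\<^esub> (sign_element \<phi> j)"
    using ext[OF _ _ c(1,2)] by (simp add: young_def[symmetric] ext_RU_one_sign sign_element_def)
  show ?thesis
    using tr[OF morphism_concat_map[of i j, folded young_def] c(3)]
    by (simp only: tr_RU_young_sign Y transfer_prod_def young_def[symmetric])
qed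

theorem proposition13p4:
  fixes R :: "'r partition_ring_data"
    and \<phi> :: "partition \<Rightarrow> virtual_rep \<Rightarrow> 'r"
    and r :: "nat \<Rightarrow> 'r"
  assumes "partition_ring R"
    and "partition_ring_map RU R \<phi>"
    and "exponential R r"
  shows "neg_arg R r \<in> Units (power_series R) \<and>
    inv\<^bsub>power_series R\<^esub> (neg_arg R r) = (\<lambda>m. sign_element \<phi> m \<otimes>\<^bsub>deg R m\<^esub> r m)"
proof -
  interpret partition_ring R by fact
  let ?P = "power_series R" and ?s = "sign_element \<phi>" and ?tp = "transfer_prod R"
  define A where "A = neg_arg R r"
  define B where "B = (\<lambda>m. ?s m \<otimes>\<^bsub>deg R m\<^esub> r m)"
  note unit = partition_ring_map_unit[OF assms(2)]
  have s: "?s m \<in> carrier (deg R m)" for m by (rule sign_element_closed[OF assms(2)])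
  have r: "r m \<in> carrier (deg R m)" for m using assms(3) by (auto simp: exponential_def power_series_def)
  have A_eq: "A m = (if even m then r m else \<ominus>\<^bsub>deg R m\<^esub> r m)" for m
  proof -
    interpret abelian_group "deg R m" by (rule abelian_group_deg)
    show ?thesis using r[of m] by (auto simp: A_def neg_arg_def add.int_pow_1 add.int_pow_neg)
  qed
  have A: "A m \<in> carrier (deg R m)" and B: "B m \<in> carrier (deg R m)" for m
  proof -
    interpret cring "deg R m" by (rule cring_deg)
    show "A m \<in> carrier (deg R m)" "B m \<in> carrier (deg R m)"
      using r[of m] s[of m] by (simp_all add: A_eq B_def)
  qed
  have A0: "A 0 = \<one>\<^bsub>deg R 0\<^esub>" using assms(3) by (simp add: A_eq exponential_def)
  have B0: "B 0 = \<one>\<^bsub>deg R 0\<^esub>"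
  proof -
    interpret cring "deg R 0" by (rule cring_deg)
    show ?thesis using assms(3) by (simp add: B_def sign_element_zero[OF assms(2)] exponential_def)
  qed
  \<comment> \<open>The summand of degree \<open>m\<close> in which the factor \<open>B\<close> has
    degree \<open>j\<close>; this index is chosen because the sign will depend on the parity of
    \<open>j\<close>.\<close>
  define g where "g m j = ?tp (m - j) j (A (m - j)) (B j)" for m j
  have g_closed: "g m j \<in> carrier (deg R m)" if "j \<le> m" for m j
    using transfer_prod_closed[OF A B, of "m - j" j] that by (simp add: g_def)
  have g_eq: "g m j = (if even j then A m else \<ominus>\<^bsub>deg R m\<^esub> A m) \<otimes>\<^bsub>deg R m\<^esub>
      \<phi> (indiscrete m) (rep_class (block_perms (indiscrete m)) (young_rep (m - j) j))" if j: "j \<le> m" for m j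
  proof -
    interpret cring "deg R m" by (rule cring_deg)
    interpret C: cring "deg R (m - j)" by (rule cring_deg)
    let ?t = "?tp (m - j) j \<one>\<^bsub>deg R (m - j)\<^esub> (?s j)"
    have t: "?t \<in> carrier (deg R m)"
      using transfer_prod_closed[OF C.one_closed s, of j] j by simp
    have "?tp (m - j) j (r (m - j)) (B j) = r m \<otimes>\<^bsub>deg R m\<^esub> ?t"
      using transfer_prod_mult_exponential[OF assms(3) C.one_closed s, of j] r j by (simp add: B_def)
    moreover have "?tp (m - j) j (\<ominus>\<^bsub>deg R (m - j)\<^esub> r (m - j)) (B j) = \<ominus>\<^bsub>deg R m\<^esub> ?tp (m - j) j (r (m - j)) (B j)"
      using transfer_prod_uminus_left[OF r B, of "m - j" j] j by simp
    ultimately have "g m j = (if even (m - j) then r m else \<ominus>\<^bsub>deg R m\<^esub> r m) \<otimes>\<^bsub>deg R m\<^esub> ?t"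
      using t r by (simp add: g_def A_eq l_minus)
    \<comment> \<open>The sign \<open>(-1)^(m - j)\<close> equals \<open>(-1)^m (-1)^j\<close>, and
      \<open>(-1)^m\<close> is absorbed into \<open>A m\<close>, a factor independent of
      \<open>j\<close>.\<close>
    also have "(if even (m - j) then r m else \<ominus>\<^bsub>deg R m\<^esub> r m) = (if even j then A m else \<ominus>\<^bsub>deg R m\<^esub> A m)"
      using j r[of m] by (auto simp: A_eq)
    finally show ?thesis using transfer_prod_one_sign[OF assms(2), of "m - j" j] j by simp
  qed
  have g_sum: "finsum (deg R m) (g m) {..m} = \<one>\<^bsub>?P\<^esub> m" for m
  proof (cases "m = 0")
    \<comment> \<open>In degree 0 the Clifford map has square 0 and is of no use, so the constant
      terms are compared directly.\<close>
    case True
    interpret cring "deg R 0" by (rule cring_deg)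
    show ?thesis
      using True A0 B0 transfer_prod_one_left[OF unit one_closed]
      by (simp add: g_def power_series_def)
  next
    case False
    interpret cring "deg R m" by (rule cring_deg)
    let ?a = "\<lambda>j. \<phi> (indiscrete m) (rep_class (block_perms (indiscrete m)) (young_rep (m - j) j))"
    let ?E = "{j. j \<le> m \<and> even j}" and ?O = "{j. j \<le> m \<and> odd j}"
    have hom: "\<phi> (indiscrete m) \<in> ring_hom (rep_ring (block_perms (indiscrete m))) (deg R m)"
      using assms(2) by (simp add: partition_ring_map_def deg_def obj_RU)
    have a: "?a j \<in> carrier (deg R m)" if "j \<le> m" for j
      using hom rep_class_closed[OF is_rep_young_rep[of "m - j" j]] that by (auto simp: ring_hom_def)
    \<comment> \<open>The common value of the even and the odd sum; the two halves of the
      coefficient are then \<open>A m\<close> times \<open>c\<close> and its negative.\<close>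
    define c where "c = finsum (deg R m) ?a ?E"
    have c: "c \<in> carrier (deg R m)" using a by (auto simp: c_def intro!: finsum_closed)
    have c': "c = finsum (deg R m) ?a ?O"
      unfolding c_def using hom False
      by (intro ext_powers_even_odd abelian_group_deg) (auto simp: ring_hom_def)
    have "{..m} = ?E \<union> ?O" by auto
    then have "finsum (deg R m) (g m) {..m} = finsum (deg R m) (g m) ?E \<oplus>\<^bsub>deg R m\<^esub> finsum (deg R m) (g m) ?O"
      using g_closed by (subst finsum_Un_disjoint[symmetric]) auto
    also have "finsum (deg R m) (g m) ?E = finsum (deg R m) (\<lambda>j. A m \<otimes>\<^bsub>deg R m\<^esub> ?a j) ?E"
      using a A by (intro finsum_cong') (auto simp: g_eq)
    also have "\<dots> = A m \<otimes>\<^bsub>deg R m\<^esub> c"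
      unfolding c_def using a A by (intro finsum_rdistr[symmetric]) auto
    also have "finsum (deg R m) (g m) ?O = finsum (deg R m) (\<lambda>j. (\<ominus>\<^bsub>deg R m\<^esub> A m) \<otimes>\<^bsub>deg R m\<^esub> ?a j) ?O"
      using a A by (intro finsum_cong') (auto simp: g_eq)
    also have "\<dots> = (\<ominus>\<^bsub>deg R m\<^esub> A m) \<otimes>\<^bsub>deg R m\<^esub> c"
      unfolding c' using a A by (intro finsum_rdistr[symmetric]) auto
    finally show ?thesis using A c False by (simp add: l_minus r_neg power_series_def)
  qed
  have AB: "A \<otimes>\<^bsub>?P\<^esub> B = \<one>\<^bsub>?P\<^esub>"
  proof
    fix m
    interpret cring "deg R m" by (rule cring_deg)
    \<comment> \<open>The product of series is indexed by the degree of its first factor,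
      \<open>g\<close> by that of the second.\<close>
    have inj: "inj_on (\<lambda>i. m - i) {..m}" by (auto simp: inj_on_def)
    have img: "(\<lambda>i. m - i) ` {..m} = {..m}" 
    proof
      have "i \<in> (\<lambda>i. m - i) ` {..m}" if "i \<le> m" for i
        using that by (intro image_eqI[of _ _ "m - i"]) auto
      then show "{..m} \<subseteq> (\<lambda>i. m - i) ` {..m}" by blast
    qed auto
    have "(A \<otimes>\<^bsub>?P\<^esub> B) m = finsum (deg R m) (\<lambda>i. g m (m - i)) {..m}"
    proof -
      have "?tp i (m - i) (A i) (B (m - i)) = g m (m - i)" if "i \<le> m" for i using that by (simp add: g_def)
      then show ?thesis
        unfolding power_series_def monoid.simps using g_closed by (intro finsum_cong') auto
    qed
    also have "\<dots> = finsum (deg R m) (g m) ((\<lambda>i. m - i) ` {..m})"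
      using g_closed inj by (intro finsum_reindex[symmetric]) auto
    finally show "(A \<otimes>\<^bsub>?P\<^esub> B) m = \<one>\<^bsub>?P\<^esub> m" unfolding img g_sum .
  qed
  \<comment> \<open>By commutativity of the transfer product the summands are again those of
    \<open>g\<close>, now with matching index, as \<open>B\<close> comes first.\<close>
  have BA: "B \<otimes>\<^bsub>?P\<^esub> A = \<one>\<^bsub>?P\<^esub>"
  proof
    fix m
    interpret cring "deg R m" by (rule cring_deg)
    have "(B \<otimes>\<^bsub>?P\<^esub> A) m = finsum (deg R m) (g m) {..m}"
      using g_closed[of _ m] transfer_prod_commute[OF A B]
      by (auto simp: power_series_def g_def intro!: finsum_cong')
    then show "(B \<otimes>\<^bsub>?P\<^esub> A) m = \<one>\<^bsub>?P\<^esub> m" by (simp add: g_sum)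
  qed
  have carrier: "A \<in> carrier ?P" "B \<in> carrier ?P" using A B by (simp_all add: power_series_def)
  have "inv\<^bsub>?P\<^esub> A = B"
    unfolding m_inv_def
  \<comment> \<open>The inverse is a definite description. Any other inverse \<open>y\<close>
    satisfies \<open>A y = A B\<close>, and the constant term of \<open>A\<close> is the identity,
    so the recursion for right inverses gives \<open>y = B\<close>.\<close>
  proof (rule the_equality)
    show "B \<in> carrier ?P \<and> A \<otimes>\<^bsub>?P\<^esub> B = \<one>\<^bsub>?P\<^esub> \<and> B \<otimes>\<^bsub>?P\<^esub> A = \<one>\<^bsub>?P\<^esub>"
      using carrier AB BA by simp
  next
    fix y assume "y \<in> carrier ?P \<and> A \<otimes>\<^bsub>?P\<^esub> y = \<one>\<^bsub>?P\<^esub> \<and> y \<otimes>\<^bsub>?P\<^esub> A = \<one>\<^bsub>?P\<^esub>"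
    then show "y = B" using right_inverse_unique[OF unit carrier(1) A0 _ carrier(2)] AB by simp
  qed
  moreover have "A \<in> Units ?P" using carrier AB BA by (auto simp: Units_def)
  ultimately show ?thesis by (simp add: A_def B_def)
qed

end
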